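(* Let $p\in(2,6)$, $\mu>0$, $\ell>0$, and let $\mathcal G$ be the real line with a pendant of length $\ell$, i.e. the metric graph consisting of two halflines and one bounded edge of length $\ell$, all attached at a single common vertex. Then $$\inf_{u\in H^1_\mu(\mathcal G)}E(u,\mathcal G)<E(\phi_\mu,\mathbb R),$$ so that $\mathcal G$ admits a ground state of mass $\mu$.
   Context: $H^1_\mu(\mathcal G)$: continuous functions on $\mathcal G$, $H^1$ on each edge, with $\int_{\mathcal G}|u|^2=\mu$. $E(u,\mathcal G)=\frac12\int_{\mathcal G}|u'|^2-\frac1p\int_{\mathcal G}|u|^p$. A ground state of mass $\mu$ is a minimizer of $E(\cdot,\mathcal G)$ on $H^1_\mu(\mathcal G)$. $\phi_\mu$ is the soliton of mass $\mu$ on $\mathbb R$, the minimizer of $E(\cdot,\mathbb R)$ on $H^1_\mu(\mathbb R)$. *)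

theory Defs
  imports "HOL-Analysis.Analysis"
begin

text \<open>Real-valued H^1 functions on an interval I with left endpoint a (closed):
  u is H^1 on I with weak derivative g iff u, g are in L^2(I), g is locally
  integrable and u(x) = u(a) + int_a^x g for all x in I (absolutely continuous
  representative).\<close>

definition H1_on :: "real set \<Rightarrow> real \<Rightarrow> (real \<Rightarrow> real) \<Rightarrow> (real \<Rightarrow> real) \<Rightarrow> bool" where
  "H1_on I a u g \<longleftrightarrow>
     g \<in> borel_measurable borel \<and>
     set_integrable lborel I (\<lambda>x. (u x)\<^sup>2) \<and>
     set_integrable lborel I (\<lambda>x. (g x)\<^sup>2) \<and>
     (\<forall>x\<in>I. set_integrable lborel {a..x} g \<and> u x = u a + (LINT t:{a..x}|lborel. g t))"

definition H1_line :: "(real \<Rightarrow> real) \<Rightarrow> (real \<Rightarrow> real) \<Rightarrow> bool" where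
  "H1_line u g \<longleftrightarrow>
     g \<in> borel_measurable borel \<and>
     integrable lborel (\<lambda>x. (u x)\<^sup>2) \<and>
     integrable lborel (\<lambda>x. (g x)\<^sup>2) \<and>
     (\<forall>x y. x \<le> y \<longrightarrow> set_integrable lborel {x..y} g \<and> u y = u x + (LINT t:{x..y}|lborel. g t))"

definition H1_mu_line :: "real \<Rightarrow> (real \<Rightarrow> real) \<Rightarrow> (real \<Rightarrow> real) \<Rightarrow> bool" where
  "H1_mu_line \<mu> u g \<longleftrightarrow> H1_line u g \<and> (LINT x|lborel. (u x)\<^sup>2) = \<mu>"

definition E_line :: "real \<Rightarrow> (real \<Rightarrow> real) \<Rightarrow> (real \<Rightarrow> real) \<Rightarrow> real" where
  "E_line p u g = (1/2) * (LINT x|lborel. (g x)\<^sup>2) - (1/p) * (LINT x|lborel. \<bar>u x\<bar> powr p)"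

text \<open>E(phi_mu, R): the energy of the soliton of mass mu, i.e. the minimum
  (= infimum) of E(., R) on H^1_mu(R).\<close>
definition soliton_energy :: "real \<Rightarrow> real \<Rightarrow> real" where
  "soliton_energy p \<mu> = Inf {E_line p u g | u g. H1_mu_line \<mu> u g}"

text \<open>The real line with a pendant of length l: the vertex is the common point 0
  of two half-lines [0,inf) (components 1 and 2) and of the bounded edge [0,l]
  (component 3; its endpoint l is a free degree-one vertex).
  A function on the graph is a triple of edge functions; likewise its derivative.\<close>

type_synonym graph_fun = "(real \<Rightarrow> real) \<times> (real \<Rightarrow> real) \<times> (real \<Rightarrow> real)"

definition H1_pendant :: "real \<Rightarrow> graph_fun \<Rightarrow> graph_fun \<Rightarrow> bool" where
  "H1_pendant l u g \<longleftrightarrow>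
     (case u of (u1, u2, u3) \<Rightarrow> case g of (g1, g2, g3) \<Rightarrow>
        H1_on {0..} 0 u1 g1 \<and> H1_on {0..} 0 u2 g2 \<and> H1_on {0..l} 0 u3 g3 \<and>
        u1 0 = u2 0 \<and> u2 0 = u3 0)"

definition mass_pendant :: "real \<Rightarrow> graph_fun \<Rightarrow> real" where
  "mass_pendant l u = (case u of (u1, u2, u3) \<Rightarrow>
     (LINT x:{0..}|lborel. (u1 x)\<^sup>2) + (LINT x:{0..}|lborel. (u2 x)\<^sup>2)
     + (LINT x:{0..l}|lborel. (u3 x)\<^sup>2))"

definition H1_mu_pendant :: "real \<Rightarrow> real \<Rightarrow> graph_fun \<Rightarrow> graph_fun \<Rightarrow> bool" where
  "H1_mu_pendant l \<mu> u g \<longleftrightarrow> H1_pendant l u g \<and> mass_pendant l u = \<mu>"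

definition E_pendant :: "real \<Rightarrow> real \<Rightarrow> graph_fun \<Rightarrow> graph_fun \<Rightarrow> real" where
  "E_pendant p l u g = (case u of (u1, u2, u3) \<Rightarrow> case g of (g1, g2, g3) \<Rightarrow>
     (1/2) * ((LINT x:{0..}|lborel. (g1 x)\<^sup>2) + (LINT x:{0..}|lborel. (g2 x)\<^sup>2)
              + (LINT x:{0..l}|lborel. (g3 x)\<^sup>2))
     - (1/p) * ((LINT x:{0..}|lborel. \<bar>u1 x\<bar> powr p) + (LINT x:{0..}|lborel. \<bar>u2 x\<bar> powr p)
              + (LINT x:{0..l}|lborel. \<bar>u3 x\<bar> powr p)))"

definition ground_state_pendant :: "real \<Rightarrow> real \<Rightarrow> real \<Rightarrow> graph_fun \<Rightarrow> graph_fun \<Rightarrow> bool" where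
  "ground_state_pendant p l \<mu> u g \<longleftrightarrow> H1_mu_pendant l \<mu> u g \<and>
     (\<forall>v h. H1_mu_pendant l \<mu> v h \<longrightarrow> E_pendant p l u g \<le> E_pendant p l v h)"

end

theory Submission
  imports Defs "HOL-Complex_Analysis.Great_Picard"
begin

text \<open>
  If \<open>\<bar>u\<bar> \<le> M\<close>, the energy density increased by \<open>M powr (p - 2) / p * u\<^sup>2\<close> dominates the derivative of an explicit
  function of \<open>u\<close>. Integrating from a maximum of \<open>\<bar>u\<bar>\<close> to both ends bounds the energy on the line, or on a
  tail of a half-line with small boundary value, from below by a function of \<open>M\<close> and the mass alone; its
  minimum \<open>c\<close> over \<open>M\<close> is attained by a soliton. Folding the top of this soliton monotonically onto the
  pendant leaves mass and \<open>L\<^sup>p\<close> norm unchanged and lowers the kinetic energy, so the infimum \<open>I\<close> on the graph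
  lies below \<open>c\<close>.

  A minimizing sequence converges, after passing to a subsequence, to some \<open>v\<close> of mass \<open>m \<le> \<mu>\<close>, and the
  tail bound gives \<open>E(v) + (\<mu> - m) / \<mu> * c \<le> I\<close>. Multiplying \<open>v\<close> by \<open>sqrt (\<mu> / m)\<close> shows
  \<open>m / \<mu> * I \<le> E(v)\<close>. Since \<open>I < c\<close>, this forces \<open>m = \<mu>\<close>, and \<open>v\<close> is a ground state.
\<close>

section \<open>Weak derivatives\<close>

text \<open>The explicit function is of Modica-Mortola type. With W(s) = (M^(p-2) s^2 - |s|^p)/p the
  increased density is u'^2/2 + W(u), which is at least sqrt(2 W(u)) |u'|, and M^(p-2)/p is the
  least shift that makes W nonnegative on [-M, M]. Equality holds where u'^2 = 2 W(u), the first
  integral of the soliton of height M. So the bound is sharp, and the same function yields an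
  antiderivative of the soliton's kinetic density.

  The obstacle to compactness is mass that leaves along the half-lines. On a tail the bound gives c
  times the share of the total mass found there, up to an error quadratic in the boundary value.
  This linearity in the mass matches the scaling inequality; it comes from a nonnegative peak term,
  which may be multiplied by a share of at most 1.

  The condition p < 6 enters twice: the peak term then grows faster in M than the mass term, and the
  L^p term is controlled by the power (p - 2)/4 < 1 of the kinetic energy.\<close>

definition antideriv_on :: "real set \<Rightarrow> (real \<Rightarrow> real) \<Rightarrow> (real \<Rightarrow> real) \<Rightarrow> bool" where
  "antideriv_on S u g \<longleftrightarrow> (\<forall>x\<in>S. \<forall>y\<in>S. x \<le> y \<longrightarrow>
     set_integrable lborel {x..y} g \<and> u y = u x + (LINT t:{x..y}|lborel. g t))"

lemma antideriv_on_subset: "antideriv_on S u g \<Longrightarrow> T \<subseteq> S \<Longrightarrow> antideriv_on T u g"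
  unfolding antideriv_on_def by blast

lemma set_integral_Icc_split:
  fixes f :: "real \<Rightarrow> real"
  assumes "set_integrable lborel {a..c} f" "a \<le> b" "b \<le> c"
  shows "(LINT t:{a..c}|lborel. f t) = (LINT t:{a..b}|lborel. f t) + (LINT t:{b..c}|lborel. f t)"
proof -
  have *: "{a..c} = {a..b} \<union> {b..c}" using assms by auto
  show ?thesis unfolding *
  proof (rule set_integral_Un_AE)
    show "AE x in lborel. \<not> (x \<in> {a..b} \<and> x \<in> {b..c})"
      using AE_lborel_singleton[of b] by eventually_elim auto
  qed (use assms in \<open>auto intro: set_integrable_subset\<close>)
qed

lemma set_integral_atLeast_split:
  fixes f :: "real \<Rightarrow> real"
  assumes "set_integrable lborel {a..} f" "a \<le> b"
  shows "(LINT t:{a..}|lborel. f t) = (LINT t:{a..b}|lborel. f t) + (LINT t:{b..}|lborel. f t)"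
proof -
  have *: "{a..} = {a..b} \<union> {b..}" using assms by auto
  show ?thesis unfolding *
  proof (rule set_integral_Un_AE)
    show "AE x in lborel. \<not> (x \<in> {a..b} \<and> x \<in> {b..})"
      using AE_lborel_singleton[of b] by eventually_elim auto
  qed (use assms in \<open>auto intro: set_integrable_subset\<close>)
qed

lemma set_integral_mono_set:
  fixes f :: "real \<Rightarrow> real"
  assumes "set_integrable lborel B f" "A \<in> sets borel" "A \<subseteq> B" "\<And>x. x \<in> B \<Longrightarrow> 0 \<le> f x"
  shows "(LINT t:A|lborel. f t) \<le> (LINT t:B|lborel. f t)"
proof -
  have "set_integrable lborel A f"
    using assms by (auto intro: set_integrable_subset)
  then show ?thesis
    unfolding set_lebesgue_integral_def using assms
    by (intro integral_mono) (auto simp: set_integrable_def indicator_def)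
qed

lemma set_integral_nonneg':
  fixes f :: "real \<Rightarrow> real"
  assumes "\<And>x. x \<in> A \<Longrightarrow> 0 \<le> f x"
  shows "0 \<le> (LINT t:A|lborel. f t)"
  unfolding set_lebesgue_integral_def using assms
  by (intro integral_nonneg_AE AE_I2) (auto simp: indicator_def)

text \<open>With the base point to the left of \<open>I\<close>, every \<open>{x..y}\<close> lies in
  \<open>{a..y}\<close>, and subtraction removes the base point. In this form the identity restricts
  to subintervals and tails.\<close>

lemma H1_on_antideriv:
  assumes "H1_on I a u g" and a: "\<And>x. x \<in> I \<Longrightarrow> a \<le> x"
  shows "antideriv_on I u g"
  unfolding antideriv_on_def
proof (intro ballI impI)
  fix x y assume xy: "x \<in> I" "y \<in> I" "x \<le> y"
  have int: "set_integrable lborel {a..y} g"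
    and eq: "u y = u a + (LINT t:{a..y}|lborel. g t)" "u x = u a + (LINT t:{a..x}|lborel. g t)"
    using assms xy unfolding H1_on_def by blast+
  show "set_integrable lborel {x..y} g \<and> u y = u x + (LINT t:{x..y}|lborel. g t)"
  proof
    show "set_integrable lborel {x..y} g"
      by (rule set_integrable_subset[OF int]) (use a xy in auto)
    show "u y = u x + (LINT t:{x..y}|lborel. g t)"
      using set_integral_Icc_split[OF int, of x] eq a xy by auto
  qed
qed

lemma antideriv_on_continuous:
  assumes "antideriv_on {a..b} u g"
  shows "continuous_on {a..b} u"
proof (cases "a \<le> b")
  case True
  then have int: "set_integrable lborel {a..b} g"
    using assms unfolding antideriv_on_def by auto
  have eq: "u a + integral {a..x} g = u x" if "x \<in> {a..b}" for x
  proof -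
    have "set_integrable lborel {a..x} g"
      by (rule set_integrable_subset[OF int]) (use that in auto)
    moreover have "u x = u a + (LINT t:{a..x}|lborel. g t)"
      using assms[unfolded antideriv_on_def, rule_format, of a x] that by auto
    ultimately show ?thesis
      using set_borel_integral_eq_integral(2)[of "{a..x}" g] by simp
  qed
  have "continuous_on {a..b} (\<lambda>x. u a + integral {a..x} g)"
    using set_borel_integral_eq_integral(1)[OF int]
    by (intro continuous_intros indefinite_integral_continuous_1)
  then show ?thesis
    by (rule continuous_on_eq) (rule eq)
qed auto

text \<open>Stands in for the chain rule for absolutely continuous functions; by Bolzano's bisection
  principle it suffices to check it on short intervals, where the mean value theorem applies.\<close>

lemma antideriv_on_chain_bound:
  fixes \<Phi> \<phi> :: "real \<Rightarrow> real"
  assumes u: "antideriv_on {a..b} u g" and ab: "a \<le> b"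
    and der: "\<And>s. (\<Phi> has_real_derivative \<phi> s) (at s)" and cont: "continuous_on UNIV \<phi>"
    and h: "set_integrable lborel {a..b} h"
    and le: "\<And>t. t \<in> {a..b} \<Longrightarrow> \<bar>\<phi> (u t)\<bar> * \<bar>g t\<bar> \<le> h t"
  shows "\<bar>\<Phi> (u b) - \<Phi> (u a)\<bar> \<le> (LINT t:{a..b}|lborel. h t)"
proof -
  have g: "set_integrable lborel {a..b} g"
    using u ab unfolding antideriv_on_def by auto
  have cu: "continuous_on {a..b} u"
    using antideriv_on_continuous[OF u] .
  \<comment> \<open>The slack \<open>e * \<bar>g t\<bar>\<close> pays for replacing
    \<open>\<phi>\<close> at a nearby value by \<open>\<phi> (u t)\<close>; its integral tends to 0
    with \<open>e\<close>.\<close>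
  have eps: "\<bar>\<Phi> (u b) - \<Phi> (u a)\<bar> \<le> (LINT t:{a..b}|lborel. h t + e * \<bar>g t\<bar>)" if e: "e > 0" for e
  proof -
    \<comment> \<open>Bisection also tests short intervals that stick out of \<open>{a..b}\<close>;
      the premise makes \<open>P\<close> vacuous for them.\<close>
    define P where "P s t \<longleftrightarrow> (a \<le> s \<and> t \<le> b \<longrightarrow>
        \<bar>\<Phi> (u t) - \<Phi> (u s)\<bar> \<le> (LINT t:{s..t}|lborel. h t + e * \<bar>g t\<bar>))" for s t
    have he: "set_integrable lborel {a..b} (\<lambda>t. h t + e * \<bar>g t\<bar>)"
      using h g by (intro set_integral_add) (auto intro: set_integrable_abs)
    have "P a b" using ab
    proof (induction rule: Bolzano)
      case (trans r s t)
      show ?case unfolding P_def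
      proof
        assume rt: "a \<le> r \<and> t \<le> b"
        have "(LINT t:{r..t}|lborel. h t + e * \<bar>g t\<bar>)
            = (LINT t:{r..s}|lborel. h t + e * \<bar>g t\<bar>) + (LINT t:{s..t}|lborel. h t + e * \<bar>g t\<bar>)"
          using rt trans by (intro set_integral_Icc_split) (auto intro: set_integrable_subset[OF he])
        then show "\<bar>\<Phi> (u t) - \<Phi> (u r)\<bar> \<le> (LINT t:{r..t}|lborel. h t + e * \<bar>g t\<bar>)"
          using trans rt unfolding P_def by linarith
      qed
    next
      case (local x)
      have "isCont \<phi> (u x)"
        using cont by (simp add: continuous_on_eq_continuous_at)
      then obtain d1 where d1: "d1 > 0" "\<And>z. dist z (u x) < d1 \<Longrightarrow> dist (\<phi> z) (\<phi> (u x)) < e / 2"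
        using e unfolding continuous_at_eps_delta by (metis half_gt_zero)
      obtain d where d: "d > 0" "\<And>z. z \<in> {a..b} \<Longrightarrow> dist z x < d \<Longrightarrow> dist (u z) (u x) < d1"
        using cu local d1(1) unfolding continuous_on_iff by (metis atLeastAtMost_iff)
      have "P s t" if st: "s \<le> x" "x \<le> t" "t - s < d" for s t
        unfolding P_def
      proof
        assume ab': "a \<le> s \<and> t \<le> b"
        have near: "dist (u r) (u x) < d1" if "r \<in> {s..t}" for r
          using that ab' st d(2)[of r] by (auto simp: dist_real_def)
        \<comment> \<open>The mean value theorem is applied to \<open>\<Phi>\<close> between the
          values \<open>u s\<close> and \<open>u t\<close>, not to the composition. If the values
          agree, both sides are 0.\<close>
        obtain \<xi> where xi: "dist \<xi> (u x) < d1" "\<Phi> (u t) - \<Phi> (u s) = \<phi> \<xi> * (u t - u s)"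
        proof (cases "u s = u t")
          case True
          then show ?thesis using that[of "u x"] d1 by auto
        next
          case False
          then consider "u s < u t" | "u t < u s" by linarith
          then show ?thesis
          proof cases
            case 1
            then obtain z where "u s < z" "z < u t" "\<Phi> (u t) - \<Phi> (u s) = (u t - u s) * \<phi> z"
              using MVT2[OF 1 der] by auto
            then show ?thesis using near[of s] near[of t] st
              by (intro that[of z]) (auto simp: dist_real_def)
          next
            case 2
            then obtain z where "u t < z" "z < u s" "\<Phi> (u s) - \<Phi> (u t) = (u s - u t) * \<phi> z"
              using MVT2[OF 2 der] by auto
            then show ?thesis using near[of s] near[of t] st
              by (intro that[of z]) (auto simp: dist_real_def algebra_simps)
          qed
        qed
        have gst: "set_integrable lborel {s..t} g" and ust: "u t - u s = (LINT r:{s..t}|lborel. g r)"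
          using u[unfolded antideriv_on_def, rule_format, of s t] ab' st by auto
        have "\<bar>u t - u s\<bar> \<le> (LINT r:{s..t}|lborel. \<bar>g r\<bar>)"
          unfolding ust set_lebesgue_integral_def
          by (rule order_trans[OF integral_abs_bound]) (simp add: abs_mult)
        then have "\<bar>\<Phi> (u t) - \<Phi> (u s)\<bar> \<le> \<bar>\<phi> \<xi>\<bar> * (LINT r:{s..t}|lborel. \<bar>g r\<bar>)"
          unfolding xi(2) abs_mult by (intro mult_left_mono) auto
        also have "\<dots> = (LINT r:{s..t}|lborel. \<bar>\<phi> \<xi>\<bar> * \<bar>g r\<bar>)"
          by simp
        also have "\<dots> \<le> (LINT r:{s..t}|lborel. h r + e * \<bar>g r\<bar>)"
        proof (rule set_integral_mono)
          show "set_integrable lborel {s..t} (\<lambda>r. \<bar>\<phi> \<xi>\<bar> * \<bar>g r\<bar>)"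
            using gst by (auto intro: set_integrable_abs)
          show "set_integrable lborel {s..t} (\<lambda>r. h r + e * \<bar>g r\<bar>)"
            using ab' by (auto intro: set_integrable_subset[OF he])
          fix r assume r: "r \<in> {s..t}"
          have "\<bar>\<phi> \<xi>\<bar> \<le> \<bar>\<phi> (u r)\<bar> + e"
            using d1(2)[OF xi(1)] d1(2)[OF near[OF r]] unfolding dist_real_def by linarith
          then have "\<bar>\<phi> \<xi>\<bar> * \<bar>g r\<bar> \<le> (\<bar>\<phi> (u r)\<bar> + e) * \<bar>g r\<bar>"
            by (intro mult_right_mono) auto
          also have "\<dots> \<le> h r + e * \<bar>g r\<bar>"
            using le[of r] r ab' by (auto simp: algebra_simps)
          finally show "\<bar>\<phi> \<xi>\<bar> * \<bar>g r\<bar> \<le> h r + e * \<bar>g r\<bar>" .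
        qed
        finally show "\<bar>\<Phi> (u t) - \<Phi> (u s)\<bar> \<le> (LINT t:{s..t}|lborel. h t + e * \<bar>g t\<bar>)" .
      qed
      then show ?case using d(1) by blast
    qed
    then show ?thesis unfolding P_def by auto
  qed
  define G where "G = (LINT t:{a..b}|lborel. \<bar>g t\<bar>)"
  have "(LINT t:{a..b}|lborel. h t + e * \<bar>g t\<bar>) = (LINT t:{a..b}|lborel. h t) + e * G" for e
    unfolding G_def using h g by (subst set_integral_add(2)) (auto intro: set_integrable_abs)
  then have le': "\<bar>\<Phi> (u b) - \<Phi> (u a)\<bar> \<le> (LINT t:{a..b}|lborel. h t) + e * G" if "e > 0" for e
    using eps[OF that] by simp
  have "((\<lambda>e. (LINT t:{a..b}|lborel. h t) + e * G) \<longlongrightarrow> (LINT t:{a..b}|lborel. h t) + 0 * G) (at_right 0)"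
    by (intro tendsto_intros)
  moreover have "eventually (\<lambda>e. \<bar>\<Phi> (u b) - \<Phi> (u a)\<bar> \<le> (LINT t:{a..b}|lborel. h t) + e * G) (at_right 0)"
    using le' by (auto simp: eventually_at_right_field intro: exI[of _ 1])
  ultimately have "\<bar>\<Phi> (u b) - \<Phi> (u a)\<bar> \<le> (LINT t:{a..b}|lborel. h t) + 0 * G"
    by (intro tendsto_lowerbound[where F="at_right 0"]) auto
  then show ?thesis by simp
qed

section \<open>Pointwise bounds from mass and kinetic energy\<close>

lemma exists_small_value:
  fixes f :: "real \<Rightarrow> real"
  assumes f: "set_integrable lborel {a..} f" and e: "e > 0" and nn: "\<And>x. x \<ge> a \<Longrightarrow> 0 \<le> f x"
  shows "\<exists>x\<ge>b. x \<ge> a \<and> f x < e"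
proof (rule ccontr)
  assume "\<not> ?thesis"
  then have ge: "\<And>x. x \<ge> max a b \<Longrightarrow> f x \<ge> e" by (auto simp: not_less)
  define c where "c = max a b"
  define I where "I = (LINT t:{a..}|lborel. f t)"
  have "e * r \<le> I" if "r \<ge> 0" for r
  proof -
    have fi: "set_integrable lborel {c..c+r} f"
      by (rule set_integrable_subset[OF f]) (auto simp: c_def)
    have "(LINT t:{c..c+r}|lborel. e) \<le> (LINT t:{c..c+r}|lborel. f t)"
      by (intro set_integral_mono fi borel_integrable_atLeastAtMost'[OF continuous_on_const])
        (auto simp: ge c_def)
    also have "\<dots> \<le> I"
      unfolding I_def using f nn by (intro set_integral_mono_set) (auto simp: c_def)
    finally show ?thesis using that by (simp add: set_lebesgue_integral_def mult.commute)
  qed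
  from this[of "(\<bar>I\<bar> + 1) / e"] e have "\<bar>I\<bar> + 1 \<le> I" by simp
  then show False by simp
qed

lemma weighted_amgm:
  fixes a b \<theta> :: real
  assumes "\<theta> > 0"
  shows "2 * \<bar>a\<bar> * \<bar>b\<bar> \<le> \<theta> * a\<^sup>2 + b\<^sup>2 / \<theta>"
proof -
  have "0 \<le> (\<theta> * \<bar>a\<bar> - \<bar>b\<bar>)\<^sup>2 / \<theta>" using assms by simp
  also have "\<dots> = \<theta> * a\<^sup>2 + b\<^sup>2 / \<theta> - 2 * \<bar>a\<bar> * \<bar>b\<bar>"
    using assms by (simp add: power2_diff field_simps power2_eq_square)
  finally show ?thesis by simp
qed

text \<open>The chain bound for the square function, with 2 |u g| split by a weighted mean
  inequality. The free weight \<open>\<theta>\<close> is later chosen to balance mass against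
  kinetic energy, which gives a Gagliardo-Nirenberg bound on sup |u|.\<close>

lemma square_diff_bound:
  assumes u: "antideriv_on {a..b} u g" and ab: "a \<le> b" and th: "\<theta> > 0"
    and iu: "set_integrable lborel {a..b} (\<lambda>t. (u t)\<^sup>2)"
    and ig: "set_integrable lborel {a..b} (\<lambda>t. (g t)\<^sup>2)"
  shows "\<bar>(u b)\<^sup>2 - (u a)\<^sup>2\<bar> \<le> \<theta> * (LINT t:{a..b}|lborel. (u t)\<^sup>2) + (LINT t:{a..b}|lborel. (g t)\<^sup>2) / \<theta>"
proof -
  have "\<bar>(u b)\<^sup>2 - (u a)\<^sup>2\<bar> \<le> (LINT t:{a..b}|lborel. \<theta> * (u t)\<^sup>2 + (g t)\<^sup>2 / \<theta>)"
  proof (rule antideriv_on_chain_bound[OF u ab, where \<phi> = "\<lambda>s. 2 * s"])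
    show "((\<lambda>s. s\<^sup>2) has_real_derivative 2 * s) (at s)" for s :: real
      by (auto intro!: derivative_eq_intros)
    show "set_integrable lborel {a..b} (\<lambda>t. \<theta> * (u t)\<^sup>2 + (g t)\<^sup>2 / \<theta>)"
      using iu ig by (intro set_integral_add) auto
    show "\<bar>2 * u t\<bar> * \<bar>g t\<bar> \<le> \<theta> * (u t)\<^sup>2 + (g t)\<^sup>2 / \<theta>" for t
      using weighted_amgm[OF th, of "u t" "g t"] by (simp add: abs_mult)
  qed (auto intro!: continuous_intros)
  also have "\<dots> = \<theta> * (LINT t:{a..b}|lborel. (u t)\<^sup>2) + (LINT t:{a..b}|lborel. (g t)\<^sup>2) / \<theta>"
    using iu ig by (subst set_integral_add(2)) auto
  finally show ?thesis .
qed

text \<open>Integrability provides a point where the square is below any given \<open>e\<close>; the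
  increment from \<open>a\<close> to this point is bounded by the previous lemma.\<close>

lemma square_bound_halfline:
  assumes u: "antideriv_on {a..} u g" and th: "\<theta> > 0"
    and iu: "set_integrable lborel {a..} (\<lambda>t. (u t)\<^sup>2)"
    and ig: "set_integrable lborel {a..} (\<lambda>t. (g t)\<^sup>2)"
  shows "(u a)\<^sup>2 \<le> \<theta> * (LINT t:{a..}|lborel. (u t)\<^sup>2) + (LINT t:{a..}|lborel. (g t)\<^sup>2) / \<theta>" (is "_ \<le> ?R")
proof (rule field_le_epsilon)
  fix e :: real assume "e > 0"
  then obtain y where y: "y \<ge> a" "(u y)\<^sup>2 < e"
    using exists_small_value[OF iu, of e a] by auto
  have "\<bar>(u y)\<^sup>2 - (u a)\<^sup>2\<bar> \<le> \<theta> * (LINT t:{a..y}|lborel. (u t)\<^sup>2) + (LINT t:{a..y}|lborel. (g t)\<^sup>2) / \<theta>"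
    using y by (intro square_diff_bound antideriv_on_subset[OF u] th
        set_integrable_subset[OF iu] set_integrable_subset[OF ig]) auto
  also have "\<dots> \<le> ?R"
    using th iu ig by (intro add_mono mult_left_mono divide_right_mono set_integral_mono_set) auto
  finally show "(u a)\<^sup>2 \<le> ?R + e" using y by linarith
qed

section \<open>Calibration of the energy\<close>

text \<open>This is sqrt(2 W) for W(s) = (s^2 - |s|^p)/p, the potential belonging to height 1.
  Truncation at 0 extends it continuously to |s| > 1, where W is negative, so that
  \<open>calib\<close> is differentiable and nondecreasing everywhere.\<close>

definition calib_deriv :: "real \<Rightarrow> real \<Rightarrow> real" where
  "calib_deriv p s = sqrt (2 / p) * sqrt (max 0 (s\<^sup>2 - \<bar>s\<bar> powr p))"

definition calib :: "real \<Rightarrow> real \<Rightarrow> real" where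
  "calib p s = (LBINT y=0..s. calib_deriv p y)"

lemma continuous_calib_deriv:
  assumes "2 < p"
  shows "continuous_on S (calib_deriv p)"
  unfolding calib_deriv_def using assms by (intro continuous_intros continuous_on_powr') auto

lemma calib_has_derivative:
  assumes "2 < p"
  shows "(calib p has_real_derivative calib_deriv p s) (at s)"
proof -
  let ?a = "min 0 s - 1" and ?b = "max 0 s + 1"
  have "((\<lambda>u. LBINT y=ereal 0..u. calib_deriv p y) has_vector_derivative calib_deriv p s) (at s within {?a..?b})"
    by (rule interval_integral_FTC2) (use continuous_calib_deriv[OF assms] in auto)
  then have "(calib p has_vector_derivative calib_deriv p s) (at s within {?a..?b})"
    unfolding calib_def[abs_def] zero_ereal_def[symmetric] .
  moreover have "at s within {?a..?b} = at s"
    by (rule at_within_interior) auto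
  ultimately show ?thesis
    by (simp add: has_real_derivative_iff_has_vector_derivative)
qed

lemma calib_0 [simp]: "calib p 0 = 0"
  unfolding calib_def zero_ereal_def[symmetric] by simp

lemma calib_deriv_nonneg: "2 < p \<Longrightarrow> 0 \<le> calib_deriv p s"
  unfolding calib_deriv_def by simp

lemma calib_mono:
  assumes "2 < p" "s \<le> t"
  shows "calib p s \<le> calib p t"
  by (rule DERIV_nonneg_imp_nondecreasing[OF assms(2)])
    (use calib_has_derivative[OF assms(1)] calib_deriv_nonneg[OF assms(1)] in blast)

lemma calib_uminus:
  assumes "2 < p"
  shows "calib p (- s) = - calib p s"
proof -
  have "((\<lambda>s. calib p s + calib p (- s)) has_real_derivative 0) (at s)" for s
  proof -
    have "((\<lambda>s. calib p (- s)) has_real_derivative calib_deriv p (- s) * (- 1)) (at s)"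
      by (rule DERIV_chain2[OF calib_has_derivative[OF assms]]) (auto intro!: derivative_eq_intros)
    from DERIV_add[OF calib_has_derivative[OF assms] this] show ?thesis
      by (simp add: calib_deriv_def)
  qed
  then have "calib p s + calib p (- s) = calib p 0 + calib p (- 0)"
    by (intro DERIV_isconst_all) auto
  then show ?thesis by simp
qed

lemma calib_abs:
  assumes "2 < p"
  shows "\<bar>calib p s\<bar> = calib p \<bar>s\<bar>"
proof (cases "s \<ge> 0")
  case True
  then show ?thesis using calib_mono[OF assms True] by simp
next
  case False
  then show ?thesis using calib_mono[OF assms, of 0 "- s"] calib_uminus[OF assms, of s] by simp
qed

text \<open>The potential is positive strictly between 0 and 1. The strictness of the energy gap
  originates here: folding the soliton saves a positive multiple of such a difference.\<close>

lemma calib_less_calib_1: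
  assumes "2 < p" "0 \<le> s" "s < 1"
  shows "calib p s < calib p 1"
proof (rule DERIV_pos_imp_increasing_open[of s 1 "calib p"])
  fix x :: real assume x: "s < x" "x < 1"
  have "x powr p < x powr 2"
    using x assms by (intro powr_less_mono') auto
  then have "calib_deriv p x > 0"
    using x assms by (simp add: calib_deriv_def)
  then show "\<exists>y. (calib p has_real_derivative y) (at x) \<and> 0 < y"
    using calib_has_derivative[OF assms(1)] by blast
next
  show "continuous_on {s..1} (calib p)"
    using calib_has_derivative[OF assms(1)] DERIV_isCont
    by (intro continuous_at_imp_continuous_on) blast
qed (use assms in auto)

lemma calib_1_pos: "2 < p \<Longrightarrow> 0 < calib p 1"
  using calib_less_calib_1[of p 0] by simp

text \<open>Dropping the power term leaves the derivative sqrt(2/p) s. The quadratic order makes the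
  cost of cutting a function at \<open>R\<close> proportional to
  \<open>(u R)\<^sup>2\<close>.\<close>

lemma calib_le_square:
  assumes "2 < p" "0 \<le> s"
  shows "calib p s \<le> sqrt (2 / p) / 2 * s\<^sup>2"
proof -
  have "(\<lambda>s. sqrt (2 / p) / 2 * s\<^sup>2 - calib p s) 0 \<le> (\<lambda>s. sqrt (2 / p) / 2 * s\<^sup>2 - calib p s) s"
  proof (rule DERIV_nonneg_imp_nondecreasing[OF assms(2)])
    fix x :: real assume x: "0 \<le> x" "x \<le> s"
    have "((\<lambda>s. sqrt (2 / p) / 2 * s\<^sup>2 - calib p s) has_real_derivative
        sqrt (2 / p) * x - calib_deriv p x) (at x)"
      using calib_has_derivative[OF assms(1)] by (auto intro!: derivative_eq_intros)
    moreover have "sqrt (max 0 (x\<^sup>2 - \<bar>x\<bar> powr p)) \<le> sqrt (x\<^sup>2)"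
      by (intro real_sqrt_le_mono) auto
    then have "calib_deriv p x \<le> sqrt (2 / p) * x"
      unfolding calib_deriv_def using x assms by (intro mult_left_mono) auto
    ultimately show "\<exists>y. ((\<lambda>s. sqrt (2 / p) / 2 * s\<^sup>2 - calib p s) has_real_derivative y) (at x) \<and> 0 \<le> y"
      by (metis diff_ge_0_iff_ge)
  qed
  then show ?thesis by simp
qed

text \<open>The integrand of the energy shifted by \<open>M powr (p - 2) / p\<close> times the mass is, where
  \<open>\<bar>u\<bar> \<le> M\<close>, at least \<open>\<bar>(scaled_calib p M \<circ> u)'\<bar>\<close>, with equality along the soliton of height \<open>M\<close>.\<close>

definition scaled_calib :: "real \<Rightarrow> real \<Rightarrow> real \<Rightarrow> real" where
  "scaled_calib p M s = M powr ((p + 2) / 2) * calib p (s / M)"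

text \<open>The potential of height M at s is M^p times the one of height 1 at s/M. The square root
  gives the exponent p/2, and integration in s adds one more factor M, hence (p + 2)/2 in
  \<open>scaled_calib\<close>.\<close>

definition scaled_calib_deriv :: "real \<Rightarrow> real \<Rightarrow> real \<Rightarrow> real" where
  "scaled_calib_deriv p M s = M powr (p / 2) * calib_deriv p (s / M)"

lemma scaled_calib_has_derivative:
  assumes "2 < p" "0 < M"
  shows "(scaled_calib p M has_real_derivative scaled_calib_deriv p M s) (at s)"
proof -
  have "((\<lambda>s. calib p (s / M)) has_real_derivative calib_deriv p (s / M) * (1 / M)) (at s)"
    by (rule DERIV_chain2[OF calib_has_derivative[OF assms(1)]])
      (use assms in \<open>auto intro!: derivative_eq_intros\<close>)
  from DERIV_cmult[OF this, of "M powr ((p + 2) / 2)"]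
  have "(scaled_calib p M has_real_derivative M powr ((p + 2) / 2) * (calib_deriv p (s / M) * (1 / M))) (at s)"
    unfolding scaled_calib_def[abs_def] .
  moreover have "M powr ((p + 2) / 2) = M powr (p / 2) * M"
    using assms by (simp add: add_divide_distrib powr_add)
  ultimately show ?thesis
    using assms by (simp add: scaled_calib_deriv_def mult_ac)
qed

lemma continuous_scaled_calib_deriv:
  assumes "2 < p" "0 < M"
  shows "continuous_on S (scaled_calib_deriv p M)"
  unfolding scaled_calib_deriv_def
  by (intro continuous_intros continuous_on_compose2[OF continuous_calib_deriv[OF assms(1), of UNIV]])
    (use assms in auto)

text \<open>Where \<open>\<bar>s\<bar> \<le> M\<close> the truncation is inactive, and the square is
  twice the shifted potential of height M.\<close>

lemma scaled_calib_deriv_square: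
  assumes "2 < p" "0 < M" "\<bar>s\<bar> \<le> M"
  shows "(scaled_calib_deriv p M s)\<^sup>2 = 2 / p * (M powr (p - 2) * s\<^sup>2 - \<bar>s\<bar> powr p)"
proof -
  define x where "x = \<bar>s\<bar> / M"
  have x: "0 \<le> x" "x \<le> 1" using assms by (auto simp: x_def)
  have "x powr p \<le> x powr 2"
    using x assms by (intro powr_mono') auto
  then have le: "0 \<le> x\<^sup>2 - x powr p"
    using x by simp
  have x2: "(s / M)\<^sup>2 = x\<^sup>2" "\<bar>s / M\<bar> = x"
    using assms by (auto simp: x_def power_divide)
  have "(scaled_calib_deriv p M s)\<^sup>2 = (M powr (p / 2))\<^sup>2 * (2 / p * (x\<^sup>2 - x powr p))"
    unfolding scaled_calib_deriv_def calib_deriv_def x2 power_mult_distrib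
    using le assms by simp
  also have "(M powr (p / 2))\<^sup>2 = M powr p"
    using assms by (simp add: power2_eq_square powr_add[symmetric])
  also have "M powr p * (2 / p * (x\<^sup>2 - x powr p)) = 2 / p * (M powr p / M\<^sup>2 * s\<^sup>2 - \<bar>s\<bar> powr p)"
    using assms unfolding x_def by (simp add: powr_divide power_divide field_simps)
  also have "M powr p / M\<^sup>2 = M powr (p - 2)"
    using assms by (simp add: powr_diff)
  finally show ?thesis .
qed

lemma scaled_calib_abs:
  assumes "2 < p" "0 < M"
  shows "\<bar>scaled_calib p M s\<bar> = scaled_calib p M \<bar>s\<bar>"
  unfolding scaled_calib_def using assms calib_abs[OF assms(1), of "s / M"] by (simp add: abs_mult)

lemma scaled_calib_mono:
  assumes "2 < p" "0 < M" "s \<le> t"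
  shows "scaled_calib p M s \<le> scaled_calib p M t"
  unfolding scaled_calib_def using assms
  by (intro mult_left_mono calib_mono divide_right_mono) auto

lemma scaled_calib_le_square:
  assumes "2 < p" "0 < M" "0 \<le> s"
  shows "scaled_calib p M s \<le> sqrt (2 / p) / 2 * M powr ((p - 2) / 2) * s\<^sup>2"
proof -
  have "scaled_calib p M s \<le> M powr ((p + 2) / 2) * (sqrt (2 / p) / 2 * (s / M)\<^sup>2)"
    unfolding scaled_calib_def using assms by (intro mult_left_mono calib_le_square) auto
  also have "M powr ((p + 2) / 2) = M powr ((p - 2) / 2) * M\<^sup>2"
    using powr_add[of M "(p - 2) / 2" 2] assms by (simp add: field_simps)
  finally show ?thesis using assms by (simp add: power_divide mult_ac)
qed

section \<open>Lower bounds for the energy\<close>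

lemma set_integrable_abs_powr:
  fixes u :: "real \<Rightarrow> real"
  assumes u: "set_integrable lborel S (\<lambda>x. (u x)\<^sup>2)" and S: "S \<in> sets borel"
    and B: "\<And>x. x \<in> S \<Longrightarrow> \<bar>u x\<bar> \<le> B" and p: "2 < p"
  shows "set_integrable lborel S (\<lambda>x. \<bar>u x\<bar> powr p)"
    and "(LINT x:S|lborel. \<bar>u x\<bar> powr p) \<le> B powr (p - 2) * (LINT x:S|lborel. (u x)\<^sup>2)"
proof -
  have le: "\<bar>u x\<bar> powr p \<le> B powr (p - 2) * (u x)\<^sup>2" if "x \<in> S" for x
  proof (cases "u x = 0")
    case False
    have "\<bar>u x\<bar> powr p = \<bar>u x\<bar> powr (p - 2) * \<bar>u x\<bar> powr 2"
      by (simp add: powr_add[symmetric] del: powr_numeral)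
    also have "\<dots> \<le> B powr (p - 2) * \<bar>u x\<bar> powr 2"
      using B[OF that] p by (intro mult_right_mono powr_mono2) auto
    finally show ?thesis using False by simp
  qed simp
  \<comment> \<open>Measurability is given for the square of \<open>u\<close> on \<open>S\<close>,
    so the power p is written as the power p/2 of that square.\<close>
  have eq: "indicator S x *\<^sub>R (\<bar>u x\<bar> powr p) = \<bar>indicator S x *\<^sub>R (u x)\<^sup>2\<bar> powr (p / 2)" for x
  proof (cases "u x = 0")
    case False
    have "(u x)\<^sup>2 = \<bar>u x\<bar> powr 2" using False by simp
    then have "\<bar>(u x)\<^sup>2\<bar> powr (p / 2) = \<bar>u x\<bar> powr p"
      by (simp add: powr_powr del: powr_numeral)
    then show ?thesis by (simp add: indicator_def)
  qed (simp add: indicator_def)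
  have [measurable]: "(\<lambda>x. indicator S x *\<^sub>R (u x)\<^sup>2) \<in> borel_measurable lborel"
    using u unfolding set_integrable_def by (rule borel_measurable_integrable)
  have meas: "set_borel_measurable lborel S (\<lambda>x. \<bar>u x\<bar> powr p)"
    unfolding set_borel_measurable_def eq by measurable
  show int: "set_integrable lborel S (\<lambda>x. \<bar>u x\<bar> powr p)"
    by (rule set_integrable_bound[OF set_integrable_mult_right[OF u, of "B powr (p - 2)"] meas])
      (auto intro!: AE_I2 order_trans[OF le])
  have "(LINT x:S|lborel. \<bar>u x\<bar> powr p) \<le> (LINT x:S|lborel. B powr (p - 2) * (u x)\<^sup>2)"
    using u by (intro set_integral_mono int le) auto
  then show "(LINT x:S|lborel. \<bar>u x\<bar> powr p) \<le> B powr (p - 2) * (LINT x:S|lborel. (u x)\<^sup>2)"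
    by simp
qed

definition energy_on :: "real \<Rightarrow> real set \<Rightarrow> (real \<Rightarrow> real) \<Rightarrow> (real \<Rightarrow> real) \<Rightarrow> real" where
  "energy_on p S u g = (1/2) * (LINT x:S|lborel. (g x)\<^sup>2) - (1/p) * (LINT x:S|lborel. \<bar>u x\<bar> powr p)"

text \<open>The increased density \<open>h\<close> dominates the derivative of
  \<open>scaled_calib p M\<close> along \<open>u\<close>. It is nonnegative, so its integral over
  \<open>S\<close> is at least the one over \<open>{y1..y2}\<close>. There the function climbs from
  \<open>y1\<close> to \<open>x0\<close> and descends to \<open>y2\<close>, which is why the value
  at \<open>x0\<close> counts twice.\<close>

lemma calibration:
  assumes p: "2 < p" and M: "0 < M" and S: "S \<in> sets borel" and u: "antideriv_on S u g"
    and iu: "set_integrable lborel S (\<lambda>x. (u x)\<^sup>2)" and ig: "set_integrable lborel S (\<lambda>x. (g x)\<^sup>2)"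
    and uM: "\<And>x. x \<in> S \<Longrightarrow> \<bar>u x\<bar> \<le> M" and y: "y1 \<le> x0" "x0 \<le> y2" "{y1..y2} \<subseteq> S"
  shows "2 * scaled_calib p M \<bar>u x0\<bar> - scaled_calib p M \<bar>u y1\<bar> - scaled_calib p M \<bar>u y2\<bar>
           - M powr (p - 2) / p * (LINT x:S|lborel. (u x)\<^sup>2) \<le> energy_on p S u g"
proof -
  define h where "h x = (1/2) * (g x)\<^sup>2 + (M powr (p - 2) / p * (u x)\<^sup>2 - (1/p) * \<bar>u x\<bar> powr p)" for x
  note ip = set_integrable_abs_powr(1)[OF iu S uM p]
  have ih: "set_integrable lborel S h"
    unfolding h_def using iu ig ip by (intro set_integral_add set_integral_diff) auto
  have hge: "\<bar>scaled_calib_deriv p M (u x)\<bar> * \<bar>g x\<bar> \<le> h x" if "x \<in> S" for x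
    using weighted_amgm[of 1 "scaled_calib_deriv p M (u x)" "g x"]
      scaled_calib_deriv_square[OF p M uM[OF that]] p
    by (simp add: h_def field_simps)
  have hnn: "0 \<le> h x" if "x \<in> S" for x
    using hge[OF that] by (meson abs_ge_zero mult_nonneg_nonneg order_trans)
  have step: "\<bar>scaled_calib p M (u b) - scaled_calib p M (u a)\<bar> \<le> (LINT t:{a..b}|lborel. h t)"
    if "a \<le> b" "{a..b} \<subseteq> S" for a b
  proof (rule antideriv_on_chain_bound[OF antideriv_on_subset[OF u that(2)] that(1)])
    show "(scaled_calib p M has_real_derivative scaled_calib_deriv p M s) (at s)" for s
      by (rule scaled_calib_has_derivative[OF p M])
    show "continuous_on UNIV (scaled_calib_deriv p M)"
      by (rule continuous_scaled_calib_deriv[OF p M])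
    show "set_integrable lborel {a..b} h"
      by (rule set_integrable_subset[OF ih]) (use that in auto)
    show "\<bar>scaled_calib_deriv p M (u t)\<bar> * \<bar>g t\<bar> \<le> h t" if "t \<in> {a..b}" for t
      using hge[of t] that \<open>{a..b} \<subseteq> S\<close> by blast
  qed
  have "(LINT t:{y1..x0}|lborel. h t) + (LINT t:{x0..y2}|lborel. h t) = (LINT t:{y1..y2}|lborel. h t)"
    by (rule set_integral_Icc_split[symmetric, OF set_integrable_subset[OF ih] y(1,2)]) (use y in auto)
  also have "\<dots> \<le> (LINT t:S|lborel. h t)"
    by (rule set_integral_mono_set[OF ih]) (use y hnn in auto)
  also have "\<dots> = energy_on p S u g + M powr (p - 2) / p * (LINT x:S|lborel. (u x)\<^sup>2)"
  proof -
    have "(LINT x:S|lborel. h x) = (LINT x:S|lborel. (1/2) * (g x)\<^sup>2)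
        + ((LINT x:S|lborel. M powr (p - 2) / p * (u x)\<^sup>2) - (LINT x:S|lborel. (1/p) * \<bar>u x\<bar> powr p))"
      unfolding h_def using iu ig ip
      by (subst set_integral_add(2) set_integral_diff(2);
          (intro set_integral_diff(1) set_integrable_mult_right)?; simp?)+
    then show ?thesis by (simp add: energy_on_def)
  qed
  finally have main: "(LINT t:{y1..x0}|lborel. h t) + (LINT t:{x0..y2}|lborel. h t)
      \<le> energy_on p S u g + M powr (p - 2) / p * (LINT x:S|lborel. (u x)\<^sup>2)" .
  have sub: "{y1..x0} \<subseteq> S" "{x0..y2} \<subseteq> S" using y by auto
  show ?thesis
    \<comment> \<open>The values at \<open>\<bar>u\<bar>\<close> are the absolute values of those at
      \<open>u\<close>, so the triangle inequality covers changes of sign.\<close>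
    using main step[OF y(1) sub(1)] step[OF y(2) sub(2)]
    unfolding scaled_calib_abs[OF p M, symmetric] by linarith
qed

text \<open>Covers both the line (\<open>d = 0\<close>) and a tail \<open>{R..}\<close>
  (\<open>d = \<bar>u R\<bar>\<close>). Calibrating at M = sup |u| turns the peak into a multiple of
  \<open>M powr ((p + 2) / 2)\<close>, and only the left end leaves an error. The bound
  \<open>B\<close> makes the coefficient of this error independent of M.\<close>

lemma energy_lower_bound:
  assumes p: "2 < p" and S: "S \<in> sets borel" "S \<noteq> {}" and u: "antideriv_on S u g"
    and iu: "set_integrable lborel S (\<lambda>x. (u x)\<^sup>2)" and ig: "set_integrable lborel S (\<lambda>x. (g x)\<^sup>2)"
    and B: "\<And>x. x \<in> S \<Longrightarrow> \<bar>u x\<bar> \<le> B" and d: "0 \<le> d"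
    and ends: "\<And>x0 e. x0 \<in> S \<Longrightarrow> e > 0 \<Longrightarrow>
        \<exists>y1 y2. y1 \<le> x0 \<and> x0 \<le> y2 \<and> {y1..y2} \<subseteq> S \<and> \<bar>u y1\<bar> \<le> d + e \<and> \<bar>u y2\<bar> \<le> e"
    and mu: "0 < \<mu>" "(LINT x:S|lborel. (u x)\<^sup>2) \<le> \<mu>"
    and c: "\<And>M. 0 \<le> M \<Longrightarrow> c \<le> 2 * calib p 1 * M powr ((p + 2) / 2) - \<mu> * M powr (p - 2) / p"
  shows "(LINT x:S|lborel. (u x)\<^sup>2) / \<mu> * c - sqrt (2 / p) / 2 * B powr ((p - 2) / 2) * d\<^sup>2
           \<le> energy_on p S u g"
proof -
  define m where "m = (LINT x:S|lborel. (u x)\<^sup>2)"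
  have m0: "0 \<le> m" unfolding m_def by (intro set_integral_nonneg') auto
  define M where "M = (SUP x\<in>S. \<bar>u x\<bar>)"
  have bdd: "bdd_above ((\<lambda>x. \<bar>u x\<bar>) ` S)" using B by (intro bdd_aboveI2)
  have uM: "\<bar>u x\<bar> \<le> M" if "x \<in> S" for x
    unfolding M_def using that bdd by (intro cSUP_upper)
  have MB: "M \<le> B" unfolding M_def using S(2) B by (intro cSUP_least)
  have M0: "0 \<le> M" using uM S(2) by (metis abs_ge_zero all_not_in_conv order_trans)
  have rest: "0 \<le> sqrt (2 / p) / 2 * B powr ((p - 2) / 2) * d\<^sup>2" using p by simp
  show ?thesis
  \<comment> \<open>The scaled calibration divides by M, so the zero function is treated apart: its
    mass share is 0 and its energy is purely kinetic.\<close>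
  proof (cases "M = 0")
    case True
    then have u0: "u x = 0" if "x \<in> S" for x using uM[OF that] by simp
    have "m = 0"
      unfolding m_def using u0 by (subst set_lebesgue_integral_cong[where g="\<lambda>x. 0"]) (use S in auto)
    moreover have "(LINT x:S|lborel. \<bar>u x\<bar> powr p) = 0"
      using u0 by (subst set_lebesgue_integral_cong[where g="\<lambda>x. 0"]) (use S in auto)
    moreover have "0 \<le> (LINT x:S|lborel. (g x)\<^sup>2)" by (intro set_integral_nonneg') auto
    ultimately show ?thesis using rest by (simp add: energy_on_def m_def)
  next
    case False
    with M0 have Mp: "0 < M" by simp
    define E where "E = energy_on p S u g + M powr (p - 2) / p * m"
    \<comment> \<open>The supremum need not be attained and the ends are only nearly small, so the
      estimate first carries an \<open>e\<close>, which continuity removes.\<close>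
    have "2 * scaled_calib p M (M - e) - scaled_calib p M (d + e) - scaled_calib p M e \<le> E"
      if e: "e > 0" for e
    proof -
      obtain x0 where x0: "x0 \<in> S" "M - e < \<bar>u x0\<bar>"
        using less_cSUP_iff[OF S(2) bdd, of "M - e"] e unfolding M_def by auto
      obtain y1 y2 where y: "y1 \<le> x0" "x0 \<le> y2" "{y1..y2} \<subseteq> S" "\<bar>u y1\<bar> \<le> d + e" "\<bar>u y2\<bar> \<le> e"
        using ends[OF x0(1) e] by blast
      show ?thesis
        using calibration[OF p Mp S(1) u iu ig uM y(1,2,3)]
          scaled_calib_mono[OF p Mp less_imp_le[OF x0(2)]]
          scaled_calib_mono[OF p Mp y(4)] scaled_calib_mono[OF p Mp y(5)]
        unfolding E_def m_def by linarith
    qed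
    then have ev: "eventually (\<lambda>e. 2 * scaled_calib p M (M - e) - scaled_calib p M (d + e)
        - scaled_calib p M e \<le> E) (at_right 0)"
      by (auto simp: eventually_at_right_field intro: exI[of _ 1])
    have cont: "isCont (scaled_calib p M) s" for s
      using scaled_calib_has_derivative[OF p Mp] DERIV_isCont by blast
    have "((\<lambda>e. 2 * scaled_calib p M (M - e) - scaled_calib p M (d + e) - scaled_calib p M e)
        \<longlongrightarrow> 2 * scaled_calib p M (M - 0) - scaled_calib p M (d + 0) - scaled_calib p M 0) (at_right 0)"
      by (intro tendsto_intros isCont_tendsto_compose[OF cont])
    then have "2 * scaled_calib p M M - scaled_calib p M d - scaled_calib p M 0 \<le> E"
      using tendsto_upperbound[OF _ ev] by simp
    moreover have "scaled_calib p M 0 = 0" "scaled_calib p M M = calib p 1 * M powr ((p + 2) / 2)"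
      using Mp by (simp_all add: scaled_calib_def)
    moreover have "scaled_calib p M d \<le> sqrt (2 / p) / 2 * B powr ((p - 2) / 2) * d\<^sup>2"
      using p M0 MB d
      by (intro order_trans[OF scaled_calib_le_square[OF p Mp d]] mult_right_mono mult_left_mono powr_mono2) auto
    \<comment> \<open>The hypothesis on \<open>c\<close> is weighted by the mass share. This gives
      the mass term the coefficient \<open>m\<close> exactly, while the nonnegative peak term grows
      when its factor \<open>m / \<mu>\<close> is replaced by 1.\<close>
    moreover have "m / \<mu> * c \<le> 2 * (calib p 1 * M powr ((p + 2) / 2)) - M powr (p - 2) / p * m"
    proof -
      have "m / \<mu> * c \<le> m / \<mu> * (2 * calib p 1 * M powr ((p + 2) / 2) - \<mu> * M powr (p - 2) / p)"
        using c[OF M0] m0 mu by (intro mult_left_mono) auto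
      also have "\<dots> = m / \<mu> * (2 * calib p 1 * M powr ((p + 2) / 2)) - M powr (p - 2) / p * m"
        using mu by (simp add: field_simps)
      also have "m / \<mu> * (2 * calib p 1 * M powr ((p + 2) / 2)) \<le> 1 * (2 * calib p 1 * M powr ((p + 2) / 2))"
        using mu m0 calib_1_pos[OF p] by (intro mult_right_mono) (auto simp: m_def)
      finally show ?thesis by simp
    qed
    ultimately show ?thesis unfolding E_def m_def[symmetric] by linarith
  qed
qed

section \<open>The soliton\<close>

text \<open>\<open>crit\<close> says that M0 is a critical point of 2 A M^a - \<mu> M^b / p with a =
  (p + 2)/2 and b = p - 2. In the variable x = M/M0 the claim is Young's inequality for x^b with
  exponent a/b, which exceeds 1 because p < 6.\<close>

lemma reduced_energy_min:
  fixes p A \<mu> M0 M :: real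
  assumes p: "2 < p" "p < 6" and A: "0 < A" and M0: "0 < M0" and M: "0 \<le> M"
    and crit: "A * (p + 2) * M0 powr ((6 - p) / 2) = \<mu> * (p - 2) / p"
  shows "2 * A * M0 powr ((p + 2) / 2) - \<mu> * M0 powr (p - 2) / p
       \<le> 2 * A * M powr ((p + 2) / 2) - \<mu> * M powr (p - 2) / p"
proof -
  define a where "a = (p + 2) / 2"
  define b where "b = p - 2"
  have ab: "0 < b" "b < a" using p by (auto simp: a_def b_def)
  define x where "x = M / M0"
  have x: "0 \<le> x" "M = M0 * x" using M M0 by (auto simp: x_def)
  define K where "K = 2 * A * M0 powr a"
  have K: "0 \<le> K" unfolding K_def using A by simp
  have "M0 powr a = M0 powr ((6 - p) / 2) * M0 powr b"
    unfolding powr_add[symmetric] by (simp add: a_def b_def field_simps)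
  then have "a * K = A * (p + 2) * M0 powr ((6 - p) / 2) * M0 powr b"
    by (simp add: a_def K_def)
  also have "\<dots> = b * (\<mu> * M0 powr b / p)" unfolding crit by (simp add: b_def)
  \<comment> \<open>Criticality expresses the mass term through the peak term, so both carry the
    factor \<open>K\<close>.\<close>
  finally have L: "\<mu> * M0 powr b / p = a / b * K" using ab by (simp add: field_simps)
  have young: "x powr b \<le> b / a * x powr a + (1 - b / a)"
  proof -
    have "x powr b * 1 \<le> (x powr b) powr (a / b) / (a / b) + 1 powr (a / (a - b)) / (a / (a - b))"
      using ab by (intro Youngs_inequality) (auto simp: field_simps)
    then show ?thesis using ab x by (simp add: powr_powr field_simps)
  qed
  have "2 * A * M powr a - \<mu> * M powr b / p = K * x powr a - (\<mu> * M0 powr b / p) * x powr b"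
    unfolding x(2) K_def using M0 x(1) by (simp add: powr_mult)
  also have "\<dots> = K * (x powr a - a / b * x powr b)"
    unfolding L by (simp add: algebra_simps)
  finally have 1: "2 * A * M powr a - \<mu> * M powr b / p = K * (x powr a - a / b * x powr b)" .
  have "a / b * x powr b \<le> a / b * (b / a * x powr a + (1 - b / a))"
    using young ab by (intro mult_left_mono) auto
  also have "\<dots> = x powr a + (a / b - 1)" using ab by (simp add: field_simps)
  finally have "K * (1 - a / b) \<le> K * (x powr a - a / b * x powr b)"
    using K by (intro mult_left_mono) auto
  moreover have "2 * A * M0 powr a - \<mu> * M0 powr b / p = K * (1 - a / b)"
    unfolding L by (simp add: K_def algebra_simps)
  ultimately show ?thesis using 1 unfolding a_def b_def by simp
qed

lemma set_integral_FTC_atLeast: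
  fixes f F :: "real \<Rightarrow> real"
  assumes f: "continuous_on UNIV f"
    and F: "\<And>x. a \<le> x \<Longrightarrow> (F has_real_derivative f x) (at x)"
    and nn: "\<And>x. a \<le> x \<Longrightarrow> 0 \<le> f x" and lim: "(F \<longlongrightarrow> T) at_top"
  shows "set_integrable lborel {a..} f" and "(LINT x:{a..}|lborel. f x) = T - F a"
proof -
  have [measurable]: "f \<in> borel_measurable borel"
    using f by (rule borel_measurable_continuous_onI)
  have mono: "F a \<le> F x" if "a \<le> x" for x
    using that by (intro DERIV_nonneg_imp_nondecreasing[of a x F]) (use F nn in auto)
  have T: "F a \<le> T"
    by (rule tendsto_lowerbound[OF lim]) (use mono in \<open>auto simp: eventually_at_top_linorder\<close>)
  have "(\<integral>\<^sup>+x. ennreal (f x) * indicator {a..} x \<partial>lborel) = T - F a"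
    by (rule nn_integral_FTC_atLeast) (use F nn lim in auto)
  also have "(\<integral>\<^sup>+x. ennreal (f x) * indicator {a..} x \<partial>lborel) = (\<integral>\<^sup>+x. ennreal (indicator {a..} x *\<^sub>R f x) \<partial>lborel)"
    by (intro nn_integral_cong) (auto simp: indicator_def)
  finally have "has_bochner_integral lborel (\<lambda>x. indicator {a..} x *\<^sub>R f x) (T - F a)"
    using T nn by (intro has_bochner_integral_nn_integral) (auto simp: indicator_def)
  then show "set_integrable lborel {a..} f" "(LINT x:{a..}|lborel. f x) = T - F a"
    unfolding set_integrable_def set_lebesgue_integral_def
    by (auto simp: has_bochner_integral_iff)
qed

lemma set_integral_FTC_Icc:
  fixes f F :: "real \<Rightarrow> real"
  assumes f: "continuous_on UNIV f" and "a \<le> b"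
    and F: "\<And>x. a \<le> x \<Longrightarrow> x \<le> b \<Longrightarrow> (F has_real_derivative f x) (at x)"
  shows "set_integrable lborel {a..b} f" and "(LINT x:{a..b}|lborel. f x) = F b - F a"
proof -
  have "has_bochner_integral lborel (\<lambda>x. f x * indicator {a..b} x) (F b - F a)"
    using f assms(2) F by (intro has_bochner_integral_FTC_Icc_real)
      (auto simp: continuous_on_eq_continuous_at)
  then show "set_integrable lborel {a..b} f" "(LINT x:{a..b}|lborel. f x) = F b - F a"
    unfolding set_integrable_def set_lebesgue_integral_def
    by (auto simp: has_bochner_integral_iff mult.commute)
qed

section \<open>The explicit soliton profile\<close>

definition soliton_rate :: "real \<Rightarrow> real \<Rightarrow> real" where
  "soliton_rate p M = sqrt (2 / p) * M powr ((p - 2) / 2) * (p - 2) / 2"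

text \<open>The classical sech power of height M. The rate k satisfies (2 k / (p - 2))^2 = 2 M^(p-2)
  / p, the value for which the first integral u'^2 = 2 W(u) holds.\<close>

definition soliton :: "real \<Rightarrow> real \<Rightarrow> real \<Rightarrow> real" where
  "soliton p M x = M * cosh (soliton_rate p M * x) powr (- (2 / (p - 2)))"

definition soliton_deriv :: "real \<Rightarrow> real \<Rightarrow> real \<Rightarrow> real" where
  "soliton_deriv p M x = - (2 / (p - 2) * soliton_rate p M) * soliton p M x * tanh (soliton_rate p M * x)"

context
  fixes p M :: real
  assumes p: "2 < p" and M: "0 < M"
begin

lemma soliton_rate_pos: "0 < soliton_rate p M"
  unfolding soliton_rate_def using p M by simp

lemma soliton_pos: "0 < soliton p M x"
  unfolding soliton_def using M by (simp add: cosh_real_pos less_imp_neq[OF cosh_real_pos, symmetric])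

lemma soliton_0: "soliton p M 0 = M"
  unfolding soliton_def by simp

lemma soliton_le: "soliton p M x \<le> M"
proof -
  have "cosh (soliton_rate p M * x) powr (- (2 / (p - 2))) \<le> cosh (soliton_rate p M * x) powr 0"
    using p cosh_real_ge_1 by (intro powr_mono) auto
  then show ?thesis unfolding soliton_def using M
    by (simp add: cosh_real_nonzero)
qed

lemma soliton_less:
  assumes "0 < x"
  shows "soliton p M x < M"
proof -
  have "0 < soliton_rate p M * x" using assms soliton_rate_pos by simp
  then have "cosh 0 < cosh (soliton_rate p M * x)"
    by (subst cosh_real_nonneg_less_iff) auto
  then have "cosh (soliton_rate p M * x) powr (- (2 / (p - 2))) < cosh (soliton_rate p M * x) powr 0"
    using p by (intro powr_less_mono) auto
  then show ?thesis unfolding soliton_def using M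
    by (simp add: cosh_real_nonzero)
qed

lemma soliton_has_derivative: "(soliton p M has_real_derivative soliton_deriv p M x) (at x)"
proof -
  let ?k = "soliton_rate p M" and ?a = "2 / (p - 2)"
  have pos: "0 < cosh (?k * x)" by (rule cosh_real_pos)
  have "((\<lambda>x. cosh (?k * x) powr (- ?a)) has_real_derivative
      (- ?a) * cosh (?k * x) powr (- ?a - 1) * (sinh (?k * x) * ?k)) (at x)"
    using pos by (auto intro!: derivative_eq_intros)
  from DERIV_cmult[OF this, of M]
  have "(soliton p M has_real_derivative M * ((- ?a) * cosh (?k * x) powr (- ?a - 1) * (sinh (?k * x) * ?k))) (at x)"
    unfolding soliton_def[abs_def] .
  moreover have "cosh (?k * x) powr (- ?a - 1) = cosh (?k * x) powr (- ?a) / cosh (?k * x)"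
    using pos by (simp add: powr_diff)
  ultimately show ?thesis
    by (simp add: soliton_deriv_def soliton_def tanh_def mult_ac)
qed

lemma continuous_soliton: "continuous_on S (soliton p M)"
  using soliton_has_derivative DERIV_isCont by (intro continuous_at_imp_continuous_on) blast

lemma continuous_soliton_deriv: "continuous_on S (soliton_deriv p M)"
  unfolding soliton_deriv_def[abs_def]
  by (intro continuous_intros continuous_soliton) (auto simp: cosh_real_nonzero)

lemma rate_square: "(2 / (p - 2) * soliton_rate p M)\<^sup>2 = 2 / p * M powr (p - 2)"
proof -
  have "2 / (p - 2) * soliton_rate p M = sqrt (2 / p) * M powr ((p - 2) / 2)"
    unfolding soliton_rate_def using p by simp
  moreover have "(M powr ((p - 2) / 2))\<^sup>2 = M powr (p - 2)"
    using M by (simp add: power2_eq_square powr_add[symmetric])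
  ultimately show ?thesis using p by (simp add: power_mult_distrib)
qed

text \<open>With a = 2/(p - 2) the exponent -a p equals -2 a - 2: the power p of the profile is its
  square with two further factors 1/cosh.\<close>

lemma soliton_powr: "soliton p M x powr p = M powr (p - 2) * (soliton p M x)\<^sup>2 / (cosh (soliton_rate p M * x))\<^sup>2"
proof -
  let ?c = "cosh (soliton_rate p M * x)" and ?a = "2 / (p - 2)"
  have c: "0 < ?c" by (rule cosh_real_pos)
  have "?a * (p - 2) = 2" using p by (metis diff_gt_0_iff_gt less_irrefl nonzero_eq_divide_eq)
  then have "- ?a * p = - ?a + - ?a + - 2" by (simp add: right_diff_distrib)
  then have "?c powr (- ?a * p) = (?c powr (- ?a))\<^sup>2 * ?c powr (- 2)"
    by (simp only: powr_add power2_eq_square)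
  also have "?c powr (- 2) = 1 / ?c\<^sup>2" using c by (simp add: powr_minus inverse_eq_divide)
  finally have 1: "(?c powr (- ?a)) powr p = (?c powr (- ?a))\<^sup>2 / ?c\<^sup>2"
    by (simp add: powr_powr)
  have "M powr p = M powr (p - 2) * M\<^sup>2" using M powr_add[of M "p - 2" 2] by simp
  then show ?thesis
    unfolding soliton_def using M 1 by (simp add: powr_mult power_mult_distrib)
qed

text \<open>The first integral of the soliton equation. It comes from tanh^2 = 1 - 1/cosh^2, where
  \<open>soliton_powr\<close> turns the part with 1/cosh^2 into the power p.\<close>

lemma soliton_deriv_square:
  "(soliton_deriv p M x)\<^sup>2 = 2 / p * (M powr (p - 2) * (soliton p M x)\<^sup>2 - soliton p M x powr p)"
proof -
  let ?c = "cosh (soliton_rate p M * x)"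
  have c: "?c > 0" by (rule cosh_real_pos)
  have "(tanh (soliton_rate p M * x))\<^sup>2 = 1 - 1 / ?c\<^sup>2"
  proof -
    have "(sinh (soliton_rate p M * x))\<^sup>2 = ?c\<^sup>2 - 1"
      using cosh_square_eq[of "soliton_rate p M * x"] by simp
    then show ?thesis using c by (simp add: tanh_def power_divide diff_divide_distrib)
  qed
  then have "(soliton_deriv p M x)\<^sup>2 = 2 / p * M powr (p - 2) * (soliton p M x)\<^sup>2 * (1 - 1 / ?c\<^sup>2)"
    unfolding soliton_deriv_def power_mult_distrib power2_minus rate_square[simplified power_mult_distrib] by simp
  then show ?thesis unfolding soliton_powr by (simp add: right_diff_distrib mult.assoc)
qed

text \<open>The equality case of the calibration: the squares agree by the first integral, and the
  profile decreases to the right of its peak.\<close>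

lemma soliton_deriv_eq:
  assumes "0 \<le> x"
  shows "soliton_deriv p M x = - scaled_calib_deriv p M (soliton p M x)"
proof -
  have "(soliton_deriv p M x)\<^sup>2 = (scaled_calib_deriv p M (soliton p M x))\<^sup>2"
    using scaled_calib_deriv_square[OF p M, of "soliton p M x"] soliton_pos[of x] soliton_le[of x]
      soliton_deriv_square[of x] by simp
  moreover have "soliton_deriv p M x \<le> 0"
  proof -
    have "0 \<le> 2 / (p - 2) * soliton_rate p M * soliton p M x * tanh (soliton_rate p M * x)"
      using assms soliton_rate_pos soliton_pos[of x] p by (intro mult_nonneg_nonneg) auto
    then show ?thesis by (simp add: soliton_deriv_def)
  qed
  moreover have "0 \<le> scaled_calib_deriv p M (soliton p M x)"
    unfolding scaled_calib_deriv_def using calib_deriv_nonneg[OF p] by simp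
  ultimately show ?thesis unfolding power2_eq_iff by linarith
qed

text \<open>One factor of the square is replaced by means of the equality case, after which the
  chain rule applies. Kinetic integrals over pieces of the soliton become differences of values of
  \<open>scaled_calib\<close>.\<close>

lemma kinetic_antideriv:
  assumes "0 \<le> x"
  shows "((\<lambda>x. - scaled_calib p M (soliton p M x)) has_real_derivative (soliton_deriv p M x)\<^sup>2) (at x)"
proof -
  have "((\<lambda>x. scaled_calib p M (soliton p M x)) has_real_derivative
      scaled_calib_deriv p M (soliton p M x) * soliton_deriv p M x) (at x)"
    by (rule DERIV_chain2[OF scaled_calib_has_derivative[OF p M] soliton_has_derivative])
  from DERIV_minus[OF this] show ?thesis
    unfolding soliton_deriv_eq[OF assms] by (simp add: power2_eq_square)
qed

text \<open>For the profile f, eliminating f'' and f^p from (f f')' = f'^2 + f f'' by the soliton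
  equation and its first integral leaves (p + 2)/2 f'^2 - (p - 2)/p M^(p-2) f^2. Solving for f^2 and
  inserting the antiderivative of f'^2 gives this formula.\<close>

definition mass_antideriv :: "real \<Rightarrow> real" where
  "mass_antideriv x = ((p + 2) / 2 * - scaled_calib p M (soliton p M x) - soliton p M x * soliton_deriv p M x)
      / (M powr (p - 2) * (p - 2) / p)"

text \<open>Pohozaev's identity in differential form.\<close>

lemma mass_antideriv_has_derivative:
  assumes "0 \<le> x"
  shows "(mass_antideriv has_real_derivative (soliton p M x)\<^sup>2) (at x)"
proof -
  define k where "k = soliton_rate p M"
  define a where "a = 2 / (p - 2)"
  define s where "s = soliton p M x"
  define T where "T = tanh (k * x)"
  have "0 < a" "2 / a = p - 2" using p by (auto simp: a_def)
  then have a: "0 < a" "p = 2 + 2 / a" by auto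
  have der: "soliton_deriv p M x = - (a * k) * s * T"
    by (simp add: soliton_deriv_def a_def k_def s_def T_def)
  have "((\<lambda>x. tanh (k * x)) has_real_derivative (1 - T\<^sup>2) * k) (at x)"
    unfolding T_def by (auto intro!: derivative_eq_intros simp: cosh_real_nonzero)
  from DERIV_cmult[OF DERIV_mult[OF soliton_has_derivative this], of "- (a * k)"]
  have "(soliton_deriv p M has_real_derivative
      - (a * k) * (soliton_deriv p M x * T + s * ((1 - T\<^sup>2) * k))) (at x)"
    unfolding soliton_deriv_def[abs_def] T_def s_def k_def a_def by (simp add: mult_ac)
  from DERIV_mult[OF soliton_has_derivative this]
  have D2: "((\<lambda>x. soliton p M x * soliton_deriv p M x) has_real_derivative
      soliton_deriv p M x * soliton_deriv p M x + (- (a * k) * (soliton_deriv p M x * T + s * ((1 - T\<^sup>2) * k))) * s) (at x)"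
    by (simp add: s_def)
  have D: "(mass_antideriv has_real_derivative
      (((p + 2) / 2 * (soliton_deriv p M x)\<^sup>2 - (soliton_deriv p M x * soliton_deriv p M x + (- (a * k) * (soliton_deriv p M x * T + s * ((1 - T\<^sup>2) * k))) * s)))
      / (M powr (p - 2) * (p - 2) / p)) (at x)"
    unfolding mass_antideriv_def[abs_def]
    by (rule DERIV_cdivide[OF DERIV_diff[OF DERIV_cmult[OF kinetic_antideriv[OF assms]] D2]])
  have "M powr (p - 2) * (p - 2) / p = a * k\<^sup>2"
  proof -
    have "(a * k)\<^sup>2 = 2 / p * M powr (p - 2)" using rate_square by (simp add: a_def k_def)
    moreover have "a * k\<^sup>2 = (a * k)\<^sup>2 / a" using \<open>0 < a\<close> by (simp add: power2_eq_square)
    ultimately have "a * k\<^sup>2 = 2 / p * M powr (p - 2) / a" by simp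
    then show ?thesis using p by (simp add: a_def)
  qed
  moreover have "((p + 2) / 2 * (soliton_deriv p M x)\<^sup>2 - (soliton_deriv p M x * soliton_deriv p M x + (- (a * k) * (soliton_deriv p M x * T + s * ((1 - T\<^sup>2) * k))) * s)) = a * k\<^sup>2 * s\<^sup>2"
  proof -
    \<comment> \<open>Written with a = 2/(p - 2), this factor makes the terms with
      \<open>T\<^sup>2\<close> cancel.\<close>
    have "(p + 2) / 2 = 2 + 1 / a" using a by (simp add: field_simps)
    then have e: "(p + 2) / 2 * a\<^sup>2 = 2 * a\<^sup>2 + a" using a by (simp add: power2_eq_square field_simps)
    have "(p + 2) / 2 * (soliton_deriv p M x)\<^sup>2 = ((p + 2) / 2 * a\<^sup>2) * k\<^sup>2 * s\<^sup>2 * T\<^sup>2"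
      unfolding der by (simp add: power_mult_distrib)
    then show ?thesis unfolding e unfolding der by (simp add: power2_eq_square algebra_simps)
  qed
  ultimately show ?thesis
    using D a soliton_rate_pos by (simp add: s_def k_def)
qed

lemma soliton_tendsto_0: "(soliton p M \<longlongrightarrow> 0) at_top"
proof -
  have "LIM x at_top. cosh (soliton_rate p M * x) :> at_top"
    by (rule filterlim_compose[OF cosh_real_at_top filterlim_tendsto_pos_mult_at_top[OF tendsto_const soliton_rate_pos filterlim_ident]])
  then have "((\<lambda>x. cosh (soliton_rate p M * x) powr (- (2 / (p - 2)))) \<longlongrightarrow> 0) at_top"
    using p by (intro tendsto_neg_powr) auto
  from tendsto_mult_left[OF this, of M] show ?thesis
    unfolding soliton_def[abs_def] by simp
qed

lemma soliton_deriv_tendsto_0: "(soliton_deriv p M \<longlongrightarrow> 0) at_top"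
proof -
  have lim: "((\<lambda>x. 2 / (p - 2) * soliton_rate p M * soliton p M x) \<longlongrightarrow> 0) at_top"
    using tendsto_mult_left[OF soliton_tendsto_0, of "2 / (p - 2) * soliton_rate p M"] by simp
  have bound: "\<bar>soliton_deriv p M x\<bar> \<le> 2 / (p - 2) * soliton_rate p M * soliton p M x" for x
  proof -
    have "\<bar>soliton_deriv p M x\<bar> = 2 / (p - 2) * soliton_rate p M * soliton p M x * \<bar>tanh (soliton_rate p M * x)\<bar>"
      using p soliton_pos[of x] soliton_rate_pos by (simp add: soliton_deriv_def abs_mult)
    also have "\<dots> \<le> 2 / (p - 2) * soliton_rate p M * soliton p M x * 1"
      using p soliton_pos[of x] soliton_rate_pos tanh_real_bounds[of "soliton_rate p M * x"]
      by (intro mult_left_mono) auto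
    finally show ?thesis by simp
  qed
  show ?thesis
  proof (rule Lim_null_comparison[OF _ lim])
    show "\<forall>\<^sub>F x in at_top. norm (soliton_deriv p M x) \<le> 2 / (p - 2) * soliton_rate p M * soliton p M x"
      using bound by (intro always_eventually allI) (simp only: real_norm_def)
  qed
qed

lemma scaled_calib_soliton_tendsto: "((\<lambda>x. scaled_calib p M (soliton p M x)) \<longlongrightarrow> 0) at_top"
proof -
  have "isCont (scaled_calib p M) 0"
    using scaled_calib_has_derivative[OF p M] DERIV_isCont by blast
  from isCont_tendsto_compose[OF this soliton_tendsto_0] show ?thesis
    by (simp add: scaled_calib_def)
qed

lemma mass_antideriv_tendsto: "(mass_antideriv \<longlongrightarrow> 0) at_top"
proof -
  have "(mass_antideriv \<longlongrightarrow> ((p + 2) / 2 * - 0 - 0 * 0) / (M powr (p - 2) * (p - 2) / p)) at_top"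
    unfolding mass_antideriv_def[abs_def]
    by (intro tendsto_intros scaled_calib_soliton_tendsto soliton_tendsto_0 soliton_deriv_tendsto_0)
      (use p M in auto)
  then show ?thesis by simp
qed

lemma mass_antideriv_0: "mass_antideriv 0 = - ((p + 2) / 2 * (calib p 1 * M powr ((p + 2) / 2))) / (M powr (p - 2) * (p - 2) / p)"
  unfolding mass_antideriv_def soliton_0 using M by (simp add: scaled_calib_def soliton_deriv_def)

end

section \<open>The soliton folded onto the pendant\<close>

lemma antideriv_on_of_has_derivative:
  assumes "\<And>x. (u has_real_derivative g x) (at x)" and "continuous_on UNIV g"
  shows "antideriv_on S u g"
  unfolding antideriv_on_def using set_integral_FTC_Icc[OF assms(2) _ assms(1)] by simp

lemma H1_on_of_has_derivative:
  assumes "\<And>x. (u has_real_derivative g x) (at x)" and g: "continuous_on UNIV g"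
    and "set_integrable lborel I (\<lambda>x. (u x)\<^sup>2)" "set_integrable lborel I (\<lambda>x. (g x)\<^sup>2)"
    and a: "\<And>x. x \<in> I \<Longrightarrow> a \<le> x"
  shows "H1_on I a u g"
proof -
  have "antideriv_on UNIV u g"
    using assms by (intro antideriv_on_of_has_derivative)
  then have "set_integrable lborel {a..x} g \<and> u x = u a + (LINT t:{a..x}|lborel. g t)" if "x \<in> I" for x
    using a[OF that] unfolding antideriv_on_def by blast
  then show ?thesis
    unfolding H1_on_def using assms borel_measurable_continuous_onI[OF g] by blast
qed

text \<open>The first integral solved for the power p. It reduces L^p integrals to mass and kinetic
  integrals, whose antiderivatives are known.\<close>

lemma soliton_abs_powr:
  assumes "2 < p" "0 < M"
  shows "\<bar>soliton p M x\<bar> powr p = M powr (p - 2) * (soliton p M x)\<^sup>2 - p / 2 * (soliton_deriv p M x)\<^sup>2"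
  using soliton_deriv_square[OF assms, of x] soliton_pos[OF assms, of x] assms by (simp add: field_simps)

text \<open>The top of the soliton, of width \<open>l\<close>, is rearranged monotonically onto the pendant, which
  divides its kinetic energy by four; the two tails fill the half-lines.\<close>

lemma pendant_competitor:
  assumes p: "2 < p" and M: "0 < M" and l: "0 < l"
    and mu: "\<mu> = (p + 2) * (calib p 1 * M powr ((p + 2) / 2)) / (M powr (p - 2) * (p - 2) / p)"
  shows "\<exists>u g. H1_mu_pendant l \<mu> u g \<and>
    E_pendant p l u g < 2 * calib p 1 * M powr ((p + 2) / 2) - \<mu> * M powr (p - 2) / p"
proof -
  \<comment> \<open>The top of the soliton occupies [-r, r], a set of length exactly
    \<open>l\<close>.\<close>
  define r where "r = l / 2"
  have r: "0 < r" using l by (simp add: r_def)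
  define N where "N = mass_antideriv p M"
  define Q where "Q x = - scaled_calib p M (soliton p M x)" for x
  define u1 where "u1 x = soliton p M (x + r)" for x
  define g1 where "g1 x = soliton_deriv p M (x + r)" for x
  \<comment> \<open>The factor 1/2 stretches half of the top to the full length \<open>l\<close>, so
    superlevel sets keep their measure. The vertex receives the value at \<open>r\<close>, as on the
    half-lines, and the peak sits at the free end.\<close>
  define u3 where "u3 x = soliton p M (r - x / 2)" for x
  \<comment> \<open>The first integral, and with it the L^p norm, involves the soliton derivative
    \<open>d3\<close> rather than the halved slope \<open>g3\<close>.\<close>
  define d3 where "d3 x = soliton_deriv p M (r - x / 2)" for x
  define g3 where "g3 x = - (1 / 2) * d3 x" for x
  note sd = soliton_has_derivative[OF p M]
  note cs = continuous_soliton[OF p M] and cd = continuous_soliton_deriv[OF p M]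
  have Nd: "(N has_real_derivative (soliton p M x)\<^sup>2) (at x)" if "0 \<le> x" for x
    unfolding N_def by (rule mass_antideriv_has_derivative[OF p M that])
  have Qd: "(Q has_real_derivative (soliton_deriv p M x)\<^sup>2) (at x)" if "0 \<le> x" for x
    unfolding Q_def[abs_def] by (rule kinetic_antideriv[OF p M that])
  have Nlim: "(N \<longlongrightarrow> 0) at_top" unfolding N_def by (rule mass_antideriv_tendsto[OF p M])
  have Qlim: "(Q \<longlongrightarrow> 0) at_top"
    unfolding Q_def[abs_def] using tendsto_minus[OF scaled_calib_soliton_tendsto[OF p M]] by simp
  have shift: "filterlim (\<lambda>x. x + r) at_top at_top"
    by (rule filterlim_at_top_mono[OF filterlim_ident]) (use r in auto)
  have c1: "continuous_on UNIV u1" "continuous_on UNIV g1" "continuous_on UNIV u3" "continuous_on UNIV d3" "continuous_on UNIV g3"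
    unfolding u1_def[abs_def] g1_def[abs_def] u3_def[abs_def] g3_def[abs_def] d3_def[abs_def]
    by (auto intro!: continuous_intros continuous_on_compose2[OF cs[of UNIV]] continuous_on_compose2[OF cd[of UNIV]])
  have csq: "continuous_on UNIV (\<lambda>x. (u1 x)\<^sup>2)" "continuous_on UNIV (\<lambda>x. (g1 x)\<^sup>2)"
      "continuous_on UNIV (\<lambda>x. (u3 x)\<^sup>2)" "continuous_on UNIV (\<lambda>x. (d3 x)\<^sup>2)"
    using c1 by (intro continuous_on_power; simp)+
  have sh: "((\<lambda>x. x + r) has_real_derivative 1) (at x)"
    and sc: "((\<lambda>x. r - x / 2) has_real_derivative - (1 / 2)) (at x)" for x
    by (auto intro!: derivative_eq_intros)
  have du1: "(u1 has_real_derivative g1 x) (at x)" for x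
    unfolding u1_def[abs_def] g1_def using DERIV_chain2[OF sd sh, of x] by simp
  have du3: "(u3 has_real_derivative g3 x) (at x)" for x
    unfolding u3_def[abs_def] g3_def d3_def
    using DERIV_chain2[OF sd sc, of x] by simp
  have I1: "set_integrable lborel {0..} (\<lambda>x. (u1 x)\<^sup>2)" "(LINT x:{0..}|lborel. (u1 x)\<^sup>2) = 0 - N (0 + r)"
  proof -
    have *: "((\<lambda>x. N (x + r)) has_real_derivative (u1 x)\<^sup>2) (at x)" if "0 \<le> x" for x
      unfolding u1_def by (rule DERIV_cong[OF DERIV_chain2[OF Nd sh]]) (use that r in auto)
    show "set_integrable lborel {0..} (\<lambda>x. (u1 x)\<^sup>2)" "(LINT x:{0..}|lborel. (u1 x)\<^sup>2) = 0 - N (0 + r)"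
      using set_integral_FTC_atLeast[OF csq(1) * _ filterlim_compose[OF Nlim shift], of 0] by auto
  qed
  have I2: "set_integrable lborel {0..} (\<lambda>x. (g1 x)\<^sup>2)" "(LINT x:{0..}|lborel. (g1 x)\<^sup>2) = 0 - Q (0 + r)"
  proof -
    have *: "((\<lambda>x. Q (x + r)) has_real_derivative (g1 x)\<^sup>2) (at x)" if "0 \<le> x" for x
      unfolding g1_def by (rule DERIV_cong[OF DERIV_chain2[OF Qd sh]]) (use that r in auto)
    show "set_integrable lborel {0..} (\<lambda>x. (g1 x)\<^sup>2)" "(LINT x:{0..}|lborel. (g1 x)\<^sup>2) = 0 - Q (0 + r)"
      using set_integral_FTC_atLeast[OF csq(2) * _ filterlim_compose[OF Qlim shift], of 0] by auto
  qed
  have I3: "set_integrable lborel {0..l} (\<lambda>x. (u3 x)\<^sup>2)" "(LINT x:{0..l}|lborel. (u3 x)\<^sup>2) = -2 * N 0 + 2 * N r"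
  proof -
    have *: "((\<lambda>x. -2 * N (r - x / 2)) has_real_derivative (u3 x)\<^sup>2) (at x)" if "0 \<le> x" "x \<le> l" for x
    proof -
      have "((\<lambda>x. N (r - x / 2)) has_real_derivative (soliton p M (r - x / 2))\<^sup>2 * (- (1/2))) (at x)"
        by (rule DERIV_chain2[OF Nd sc]) (use that in \<open>auto simp: r_def\<close>)
      from DERIV_cmult[OF this, of "-2"] show ?thesis by (simp add: u3_def)
    qed
    show "set_integrable lborel {0..l} (\<lambda>x. (u3 x)\<^sup>2)" "(LINT x:{0..l}|lborel. (u3 x)\<^sup>2) = -2 * N 0 + 2 * N r"
      using set_integral_FTC_Icc[OF csq(3) less_imp_le[OF l] *] by (auto simp: r_def)
  qed
  have I4: "set_integrable lborel {0..l} (\<lambda>x. (d3 x)\<^sup>2)" "(LINT x:{0..l}|lborel. (d3 x)\<^sup>2) = -2 * Q 0 + 2 * Q r"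
  proof -
    have *: "((\<lambda>x. -2 * Q (r - x / 2)) has_real_derivative (d3 x)\<^sup>2) (at x)" if "0 \<le> x" "x \<le> l" for x
    proof -
      have "((\<lambda>x. Q (r - x / 2)) has_real_derivative (soliton_deriv p M (r - x / 2))\<^sup>2 * (- (1/2))) (at x)"
        by (rule DERIV_chain2[OF Qd sc]) (use that in \<open>auto simp: r_def\<close>)
      from DERIV_cmult[OF this, of "-2"] show ?thesis by (simp add: d3_def)
    qed
    show "set_integrable lborel {0..l} (\<lambda>x. (d3 x)\<^sup>2)" "(LINT x:{0..l}|lborel. (d3 x)\<^sup>2) = -2 * Q 0 + 2 * Q r"
      using set_integral_FTC_Icc[OF csq(4) less_imp_le[OF l] *] by (auto simp: r_def)
  qed
  have g3sq: "(g3 x)\<^sup>2 = (1/4) * (d3 x)\<^sup>2" for x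
    unfolding g3_def by (simp add: power2_eq_square)
  have I5: "set_integrable lborel {0..l} (\<lambda>x. (g3 x)\<^sup>2)" "(LINT x:{0..l}|lborel. (g3 x)\<^sup>2) = (1/4) * (-2 * Q 0 + 2 * Q r)"
    unfolding g3sq using I4 by auto
  have P1: "(LINT x:{0..}|lborel. \<bar>u1 x\<bar> powr p) = M powr (p - 2) * (- N r) - p / 2 * (- Q r)"
  proof -
    have "(LINT x:{0..}|lborel. \<bar>u1 x\<bar> powr p) = (LINT x:{0..}|lborel. M powr (p - 2) * (u1 x)\<^sup>2 - p / 2 * (g1 x)\<^sup>2)"
      unfolding u1_def g1_def soliton_abs_powr[OF p M] ..
    also have "\<dots> = (LINT x:{0..}|lborel. M powr (p - 2) * (u1 x)\<^sup>2) - (LINT x:{0..}|lborel. p / 2 * (g1 x)\<^sup>2)"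
      by (rule set_integral_diff(2)) (use I1(1) I2(1) in auto)
    also have "\<dots> = M powr (p - 2) * (- N r) - p / 2 * (- Q r)"
      unfolding set_integral_mult_right I1(2) I2(2) by simp
    finally show ?thesis .
  qed
  have P3: "(LINT x:{0..l}|lborel. \<bar>u3 x\<bar> powr p) = M powr (p - 2) * (-2 * N 0 + 2 * N r) - p / 2 * (-2 * Q 0 + 2 * Q r)"
  proof -
    have "(LINT x:{0..l}|lborel. \<bar>u3 x\<bar> powr p) = (LINT x:{0..l}|lborel. M powr (p - 2) * (u3 x)\<^sup>2 - p / 2 * (d3 x)\<^sup>2)"
      unfolding u3_def d3_def soliton_abs_powr[OF p M] ..
    also have "\<dots> = (LINT x:{0..l}|lborel. M powr (p - 2) * (u3 x)\<^sup>2) - (LINT x:{0..l}|lborel. p / 2 * (d3 x)\<^sup>2)"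
      by (rule set_integral_diff(2)) (use I3(1) I4(1) in auto)
    also have "\<dots> = M powr (p - 2) * (-2 * N 0 + 2 * N r) - p / 2 * (-2 * Q 0 + 2 * Q r)"
      unfolding set_integral_mult_right I3(2) I4(2) ..
    finally show ?thesis .
  qed
  \<comment> \<open>\<open>N\<close> tends to 0 at infinity, so \<open>- N 0\<close> is the mass of
    half the soliton; the hypothesis on \<open>\<mu>\<close> fixes the mass of the whole.\<close>
  have N0: "-2 * N 0 = \<mu>"
    unfolding N_def mass_antideriv_0[OF p M] mu using p M by simp
  have Q0: "Q 0 = - (calib p 1 * M powr ((p + 2) / 2))"
    unfolding Q_def soliton_0[OF p M] using M by (simp add: scaled_calib_def)
  have "soliton p M r / M < 1"
    using soliton_less[OF p M r] M by simp
  then have "calib p (soliton p M r / M) < calib p 1"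
    using soliton_pos[OF p M, of r] M p by (intro calib_less_calib_1) auto
  then have Qr: "Q 0 < Q r"
    unfolding Q_def scaled_calib_def soliton_0[OF p M] using M by simp
  have H: "H1_on {0..} 0 u1 g1" "H1_on {0..l} 0 u3 g3"
    using du1 du3 c1 I1 I2 I3 I5 by (auto intro!: H1_on_of_has_derivative)
  have "H1_mu_pendant l \<mu> (u1, u1, u3) (g1, g1, g3)"
    unfolding H1_mu_pendant_def H1_pendant_def mass_pendant_def
    using H I1(2) I3(2) N0 by (simp add: u1_def u3_def)
  \<comment> \<open>The top of the soliton has kinetic integral 2 (Q r - Q 0). Three quarters of it
    disappear, and with the factor 1/2 of the energy this saves 3/4 (Q r - Q 0).\<close>
  moreover have "E_pendant p l (u1, u1, u3) (g1, g1, g3) =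
     2 * calib p 1 * M powr ((p + 2) / 2) - \<mu> * M powr (p - 2) / p - (3/4) * (Q r - Q 0)"
    unfolding E_pendant_def prod.case P1 P3 I2(2) I5(2) N0[symmetric] using p Q0 by (simp add: field_simps)
  ultimately show ?thesis using Qr by (intro exI) auto
qed

text \<open>Shows that the set whose infimum is \<open>soliton_energy\<close> is nonempty. The
  profile and its squared derivative are even, so integrals over a half-line are doubled.\<close>

lemma soliton_H1_mu_line:
  assumes p: "2 < p" and M: "0 < M"
    and mu: "\<mu> = (p + 2) * (calib p 1 * M powr ((p + 2) / 2)) / (M powr (p - 2) * (p - 2) / p)"
  shows "H1_mu_line \<mu> (soliton p M) (soliton_deriv p M)"
proof -
  note cs = continuous_soliton[OF p M] and cd = continuous_soliton_deriv[OF p M]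
  have even: "soliton p M (- x) = soliton p M x" "(soliton_deriv p M (- x))\<^sup>2 = (soliton_deriv p M x)\<^sup>2" for x
    by (simp_all add: soliton_def soliton_deriv_def)
  have 1: "has_bochner_integral lborel (\<lambda>x. (soliton p M x)\<^sup>2) (2 *\<^sub>R (0 - mass_antideriv p M 0))"
  proof (rule has_bochner_integral_even_function)
    show "has_bochner_integral lborel (\<lambda>x. indicator {0..} x *\<^sub>R (soliton p M x)\<^sup>2) (0 - mass_antideriv p M 0)"
      using set_integral_FTC_atLeast[OF _ mass_antideriv_has_derivative[OF p M] _ mass_antideriv_tendsto[OF p M], of 0] cs[of UNIV]
      unfolding has_bochner_integral_iff set_integrable_def set_lebesgue_integral_def
      by (auto intro!: continuous_intros)
  qed (simp add: even)
  have 2: "has_bochner_integral lborel (\<lambda>x. (soliton_deriv p M x)\<^sup>2) (2 *\<^sub>R (0 - - scaled_calib p M (soliton p M 0)))"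
  proof (rule has_bochner_integral_even_function)
    have "((\<lambda>x. - scaled_calib p M (soliton p M x)) \<longlongrightarrow> 0) at_top"
      using tendsto_minus[OF scaled_calib_soliton_tendsto[OF p M]] by simp
    from set_integral_FTC_atLeast[OF _ kinetic_antideriv[OF p M] _ this, of 0] cd[of UNIV]
    show "has_bochner_integral lborel (\<lambda>x. indicator {0..} x *\<^sub>R (soliton_deriv p M x)\<^sup>2) (0 - - scaled_calib p M (soliton p M 0))"
      unfolding has_bochner_integral_iff set_integrable_def set_lebesgue_integral_def
      by (auto intro!: continuous_intros)
  qed (simp add: even)
  have mass: "2 *\<^sub>R (0 - mass_antideriv p M 0) = \<mu>"
    unfolding mass_antideriv_0[OF p M] mu using p M by simp
  have "antideriv_on UNIV (soliton p M) (soliton_deriv p M)"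
    using soliton_has_derivative[OF p M] cd by (intro antideriv_on_of_has_derivative)
  then show ?thesis
    unfolding H1_mu_line_def H1_line_def antideriv_on_def
    using 1 2 mass borel_measurable_continuous_onI[OF cd]
    unfolding has_bochner_integral_iff by blast
qed

section \<open>Comparison with the real line\<close>

lemma integrable_lborel_UNIV: "set_integrable lborel UNIV f \<longleftrightarrow> integrable lborel f"
  by (simp add: set_integrable_def)

lemma set_integral_UNIV: "(LINT x:UNIV|lborel. f x) = integral\<^sup>L lborel f"
  by (simp add: set_lebesgue_integral_def)

text \<open>The general bound with \<open>d = 0\<close> on the whole line: small values occur
  arbitrarily far out on both sides, and the mass share is 1.\<close>

lemma E_line_lower_bound:
  assumes p: "2 < p" and mu: "0 < \<mu>" and u: "H1_mu_line \<mu> u g"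
    and c: "\<And>M. 0 \<le> M \<Longrightarrow> c \<le> 2 * calib p 1 * M powr ((p + 2) / 2) - \<mu> * M powr (p - 2) / p"
  shows "c \<le> E_line p u g"
proof -
  have iu: "set_integrable lborel UNIV (\<lambda>x. (u x)\<^sup>2)" and ig: "set_integrable lborel UNIV (\<lambda>x. (g x)\<^sup>2)"
    and ad: "antideriv_on UNIV u g" and mass: "(LINT x:UNIV|lborel. (u x)\<^sup>2) = \<mu>"
    using u unfolding H1_mu_line_def H1_line_def antideriv_on_def integrable_lborel_UNIV set_integral_UNIV by auto
  have iu': "set_integrable lborel {x..} (\<lambda>x. (u x)\<^sup>2)" "set_integrable lborel {x..} (\<lambda>x. (g x)\<^sup>2)" for x
    by (rule set_integrable_subset[OF iu] set_integrable_subset[OF ig]; simp)+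
  define B where "B = sqrt (1 * (LINT x:UNIV|lborel. (u x)\<^sup>2) + (LINT x:UNIV|lborel. (g x)\<^sup>2) / 1)"
  have B: "\<bar>u x\<bar> \<le> B" for x
  proof -
    have "(u x)\<^sup>2 \<le> 1 * (LINT t:{x..}|lborel. (u t)\<^sup>2) + (LINT t:{x..}|lborel. (g t)\<^sup>2) / 1"
      by (rule square_bound_halfline[OF antideriv_on_subset[OF ad] _ iu']) auto
    also have "\<dots> \<le> 1 * (LINT x:UNIV|lborel. (u x)\<^sup>2) + (LINT x:UNIV|lborel. (g x)\<^sup>2) / 1"
      by (intro add_mono mult_left_mono divide_right_mono set_integral_mono_set iu ig) auto
    finally have "sqrt ((u x)\<^sup>2) \<le> B" unfolding B_def by (rule real_sqrt_le_mono)
    then show ?thesis by simp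
  qed
  have right: "\<exists>y\<ge>x. \<bar>u y\<bar> \<le> e" if e: "e > 0" for x e
  proof -
    obtain y where "y \<ge> x" "(u y)\<^sup>2 < e\<^sup>2"
      using exists_small_value[OF iu'(1), of "e\<^sup>2" x x] e by auto
    then show ?thesis using e abs_le_square_iff[of "u y" e] by auto
  qed
  have left: "\<exists>y\<le>x. \<bar>u y\<bar> \<le> e" if e: "e > 0" for x e
  proof -
    \<comment> \<open>Reflection turns the search for small values on the left into the half-line
      statement.\<close>
    have "integrable lborel (\<lambda>x. (u (0 + (-1) * x))\<^sup>2)"
      by (rule lborel_integrable_real_affine) (use iu in \<open>auto simp: integrable_lborel_UNIV\<close>)
    then have "set_integrable lborel UNIV (\<lambda>x. (u (- x))\<^sup>2)"
      by (simp add: integrable_lborel_UNIV)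
    then have "set_integrable lborel {- x..} (\<lambda>x. (u (- x))\<^sup>2)"
      by (rule set_integrable_subset) auto
    then obtain y where "y \<ge> - x" "(u (- y))\<^sup>2 < e\<^sup>2"
      using exists_small_value[of "- x" "\<lambda>x. (u (- x))\<^sup>2" "e\<^sup>2" "- x"] e by auto
    then show ?thesis using e abs_le_square_iff[of "u (- y)" e] by (intro exI[of _ "- y"]) auto
  qed
  have "(LINT x:UNIV|lborel. (u x)\<^sup>2) / \<mu> * c - sqrt (2 / p) / 2 * B powr ((p - 2) / 2) * 0\<^sup>2 \<le> energy_on p UNIV u g"
  proof (rule energy_lower_bound[OF p _ _ ad iu ig B])
    fix x0 e :: real assume e: "e > 0"
    obtain y1 y2 where "y1 \<le> x0" "\<bar>u y1\<bar> \<le> e" "x0 \<le> y2" "\<bar>u y2\<bar> \<le> e"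
      using left[OF e, of x0] right[OF e, of x0] by blast
    then show "\<exists>y1 y2. y1 \<le> x0 \<and> x0 \<le> y2 \<and> {y1..y2} \<subseteq> UNIV \<and> \<bar>u y1\<bar> \<le> 0 + e \<and> \<bar>u y2\<bar> \<le> e"
      by auto
  qed (use mu mass c in auto)
  then show ?thesis
    using mu unfolding mass energy_on_def E_line_def set_integral_UNIV by simp
qed

text \<open>\<open>c\<close> is the reduced energy at its critical height. The criticality equation
  times M^(p-2) is also the condition that the soliton of height M has mass \<open>\<mu>\<close>, so
  the same \<open>M\<close> serves the lower bound on the line and the competitor on the
  graph.\<close>

lemma pendant_below_soliton_energy:
  assumes p: "2 < p" "p < 6" and mu: "0 < \<mu>" and l: "0 < l"
  shows "\<exists>c. (\<forall>M\<ge>0. c \<le> 2 * calib p 1 * M powr ((p + 2) / 2) - \<mu> * M powr (p - 2) / p) \<and>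
     c \<le> soliton_energy p \<mu> \<and> (\<exists>u g. H1_mu_pendant l \<mu> u g \<and> E_pendant p l u g < c)"
proof -
  define A where "A = calib p 1"
  have A: "0 < A" unfolding A_def by (rule calib_1_pos[OF p(1)])
  define M where "M = (\<mu> * (p - 2) / p / (A * (p + 2))) powr (2 / (6 - p))"
  have pos: "0 < \<mu> * (p - 2) / p / (A * (p + 2))" using p mu A by simp
  have M: "0 < M" unfolding M_def powr_gt_zero using pos by (rule less_imp_neq[symmetric])
  have "M powr ((6 - p) / 2) = \<mu> * (p - 2) / p / (A * (p + 2))"
  proof -
    have "2 / (6 - p) * ((6 - p) / 2) = 1"
      using p by (simp only: times_divide_times_eq mult.commute[of 2]) simp
    then show ?thesis unfolding M_def powr_powr using powr_one[OF less_imp_le[OF pos]] by (simp only:)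
  qed
  then have crit: "A * (p + 2) * M powr ((6 - p) / 2) = \<mu> * (p - 2) / p"
    using A p by simp
  have "M powr ((p + 2) / 2) = M powr ((6 - p) / 2) * M powr (p - 2)"
    unfolding powr_add[symmetric] by (simp add: field_simps)
  then have "(p + 2) * (A * M powr ((p + 2) / 2)) = \<mu> * (p - 2) / p * M powr (p - 2)"
    unfolding crit[symmetric] by simp
  then have mu': "\<mu> = (p + 2) * (calib p 1 * M powr ((p + 2) / 2)) / (M powr (p - 2) * (p - 2) / p)"
    using p M unfolding A_def by simp
  define c where "c = 2 * calib p 1 * M powr ((p + 2) / 2) - \<mu> * M powr (p - 2) / p"
  have c: "c \<le> 2 * calib p 1 * K powr ((p + 2) / 2) - \<mu> * K powr (p - 2) / p" if "0 \<le> K" for K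
    unfolding c_def using reduced_energy_min[OF p A M that crit] by (simp add: A_def)
  have "c \<le> soliton_energy p \<mu>"
    unfolding soliton_energy_def
  proof (rule cInf_greatest)
    show "{E_line p u g |u g. H1_mu_line \<mu> u g} \<noteq> {}"
      using soliton_H1_mu_line[OF p(1) M mu'] by blast
  qed (use E_line_lower_bound[OF p(1) mu _ c] in auto)
  then show ?thesis
    using c pendant_competitor[OF p(1) M l mu'] unfolding c_def[symmetric] by blast
qed

section \<open>Coercivity on the graph\<close>

lemma H1_onD:
  assumes "H1_on I a u g"
  shows "set_integrable lborel I (\<lambda>x. (u x)\<^sup>2)" "set_integrable lborel I (\<lambda>x. (g x)\<^sup>2)"
    "g \<in> borel_measurable borel"
  using assms unfolding H1_on_def by auto

lemma H1_halfline_bound: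
  assumes u: "H1_on {0..} 0 u g" and x: "0 \<le> x" and th: "\<theta> > 0"
  shows "(u x)\<^sup>2 \<le> \<theta> * (LINT t:{0..}|lborel. (u t)\<^sup>2) + (LINT t:{0..}|lborel. (g t)\<^sup>2) / \<theta>"
proof -
  note iu = H1_onD(1)[OF u] and ig = H1_onD(2)[OF u]
  have ad: "antideriv_on {0..} u g" by (rule H1_on_antideriv[OF u]) auto
  have "(u x)\<^sup>2 \<le> \<theta> * (LINT t:{x..}|lborel. (u t)\<^sup>2) + (LINT t:{x..}|lborel. (g t)\<^sup>2) / \<theta>"
    using x by (intro square_bound_halfline antideriv_on_subset[OF ad] th
        set_integrable_subset[OF iu] set_integrable_subset[OF ig]) auto
  also have "\<dots> \<le> \<theta> * (LINT t:{0..}|lborel. (u t)\<^sup>2) + (LINT t:{0..}|lborel. (g t)\<^sup>2) / \<theta>"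
    using th x by (intro add_mono mult_left_mono divide_right_mono set_integral_mono_set iu ig) auto
  finally show ?thesis .
qed

definition kinetic_pendant :: "real \<Rightarrow> graph_fun \<Rightarrow> real" where
  "kinetic_pendant l g = (case g of (g1, g2, g3) \<Rightarrow>
     (LINT x:{0..}|lborel. (g1 x)\<^sup>2) + (LINT x:{0..}|lborel. (g2 x)\<^sup>2) + (LINT x:{0..l}|lborel. (g3 x)\<^sup>2))"

text \<open>Half-lines are estimated from infinity. Values on the pendant are compared with the
  vertex value, which the first half-line controls; the two estimates use different edges, so their
  sum stays within \<open>S\<close>.\<close>

lemma pendant_sup_bound:
  assumes H: "H1_mu_pendant l \<mu> (u1, u2, u3) (g1, g2, g3)" and th: "\<theta> > 0" and l: "0 < l"
  defines "S \<equiv> \<theta> * \<mu> + kinetic_pendant l (g1, g2, g3) / \<theta>"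
  shows "0 \<le> x \<Longrightarrow> (u1 x)\<^sup>2 \<le> S" "0 \<le> x \<Longrightarrow> (u2 x)\<^sup>2 \<le> S" "0 \<le> x \<Longrightarrow> x \<le> l \<Longrightarrow> (u3 x)\<^sup>2 \<le> S"
proof -
  have H1: "H1_on {0..} 0 u1 g1" and H2: "H1_on {0..} 0 u2 g2" and H3: "H1_on {0..l} 0 u3 g3"
    and v: "u1 0 = u3 0"
    using H unfolding H1_mu_pendant_def H1_pendant_def by auto
  define m1 m2 m3 where "m1 = (LINT x:{0..}|lborel. (u1 x)\<^sup>2)"
    and "m2 = (LINT x:{0..}|lborel. (u2 x)\<^sup>2)" and "m3 = (LINT x:{0..l}|lborel. (u3 x)\<^sup>2)"
  define k1 k2 k3 where "k1 = (LINT x:{0..}|lborel. (g1 x)\<^sup>2)"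
    and "k2 = (LINT x:{0..}|lborel. (g2 x)\<^sup>2)" and "k3 = (LINT x:{0..l}|lborel. (g3 x)\<^sup>2)"
  have mu: "\<mu> = m1 + m2 + m3"
    using H unfolding H1_mu_pendant_def mass_pendant_def m1_def m2_def m3_def by auto
  have nn: "0 \<le> m1" "0 \<le> m2" "0 \<le> m3" "0 \<le> k1" "0 \<le> k2" "0 \<le> k3"
    unfolding m1_def m2_def m3_def k1_def k2_def k3_def by (rule set_integral_nonneg'; simp)+
  then have nn': "0 \<le> \<theta> * m1" "0 \<le> \<theta> * m2" "0 \<le> \<theta> * m3" "0 \<le> k1 / \<theta>" "0 \<le> k2 / \<theta>" "0 \<le> k3 / \<theta>"
    using th by auto
  have S: "S = \<theta> * m1 + \<theta> * m2 + \<theta> * m3 + k1 / \<theta> + k2 / \<theta> + k3 / \<theta>"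
    unfolding S_def mu kinetic_pendant_def k1_def k2_def k3_def prod.case
    by (simp add: distrib_left add_divide_distrib)
  show "(u1 x)\<^sup>2 \<le> S" if "0 \<le> x"
    using H1_halfline_bound[OF H1 that th] nn' unfolding S m1_def[symmetric] k1_def[symmetric] by linarith
  show "(u2 x)\<^sup>2 \<le> S" if "0 \<le> x"
    using H1_halfline_bound[OF H2 that th] nn' unfolding S m2_def[symmetric] k2_def[symmetric] by linarith
  show "(u3 x)\<^sup>2 \<le> S" if x: "0 \<le> x" "x \<le> l"
  proof -
    note iu = H1_onD(1)[OF H3] and ig = H1_onD(2)[OF H3]
    have ad: "antideriv_on {0..l} u3 g3" by (rule H1_on_antideriv[OF H3]) auto
    have "\<bar>(u3 x)\<^sup>2 - (u3 0)\<^sup>2\<bar> \<le> \<theta> * (LINT t:{0..x}|lborel. (u3 t)\<^sup>2) + (LINT t:{0..x}|lborel. (g3 t)\<^sup>2) / \<theta>"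
      using x by (intro square_diff_bound antideriv_on_subset[OF ad] th
        set_integrable_subset[OF iu] set_integrable_subset[OF ig]) auto
    also have "\<dots> \<le> \<theta> * m3 + k3 / \<theta>"
      unfolding m3_def k3_def
      using th x by (intro add_mono mult_left_mono divide_right_mono set_integral_mono_set iu ig) auto
    finally show ?thesis
      using H1_halfline_bound[OF H1 order_refl th] nn'
      unfolding S m1_def[symmetric] k1_def[symmetric] v by linarith
  qed
qed

text \<open>Young's inequality with exponents 1/r and 1/(1 - r), the factor 4 being placed so that
  the slope is at most 1/4. This absorbs the L^p term into half of the kinetic part of the
  energy.\<close>

lemma powr_le_linear:
  fixes D r :: real
  assumes "0 < r" "r < 1" "0 \<le> D"
  shows "\<exists>C. \<forall>y\<ge>0. D * y powr r \<le> y / 4 + C"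
proof (intro exI allI impI)
  fix y :: real assume y: "0 \<le> y"
  have eq: "(y / 4) powr r * (D * 4 powr r) = D * y powr r"
    using y by (simp add: powr_divide)
  have "(y / 4) powr r * (D * 4 powr r) \<le> ((y / 4) powr r) powr (1 / r) / (1 / r)
      + (D * 4 powr r) powr (1 / (1 - r)) / (1 / (1 - r))"
    using assms by (intro Youngs_inequality) (auto simp: field_simps)
  also have "((y / 4) powr r) powr (1 / r) / (1 / r) = r * (y / 4)"
    using assms y by (simp add: powr_powr)
  also have "\<dots> \<le> 1 * (y / 4)" using assms y by (intro mult_right_mono) auto
  finally show "D * y powr r \<le> y / 4 + (D * 4 powr r) powr (1 / (1 - r)) / (1 / (1 - r))"
    unfolding eq by simp
qed

lemma kinetic_pendant_nonneg: "0 \<le> kinetic_pendant l g"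
  unfolding kinetic_pendant_def
  by (cases g) (auto intro!: add_nonneg_nonneg set_integral_nonneg')

text \<open>From sup u^2 \<le> 2 sqrt(\<mu> (K + 1)) the L^p term is at most a constant times (K +
  1)^((p-2)/4), which is sublinear in the kinetic integral K because p < 6.\<close>

lemma E_pendant_coercive:
  assumes p: "2 < p" "p < 6" and mu: "0 < \<mu>" and l: "0 < l"
  shows "\<exists>C. \<forall>u g. H1_mu_pendant l \<mu> u g \<longrightarrow> kinetic_pendant l g / 4 - C \<le> E_pendant p l u g"
proof -
  define D where "D = \<mu> / p * (2 * sqrt \<mu>) powr ((p - 2) / 2)"
  obtain C where C: "\<And>y. y \<ge> 0 \<Longrightarrow> D * y powr ((p - 2) / 4) \<le> y / 4 + C"
    using powr_le_linear[of "(p - 2) / 4" D] p mu unfolding D_def by auto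
  have "kinetic_pendant l g / 4 - (C + 1 / 4) \<le> E_pendant p l u g" if H: "H1_mu_pendant l \<mu> u g" for u g
  proof -
    obtain u1 u2 u3 where u: "u = (u1, u2, u3)" by (cases u)
    obtain g1 g2 g3 where g: "g = (g1, g2, g3)" by (cases g)
    define K where "K = kinetic_pendant l g"
    have K: "0 \<le> K" unfolding K_def by (rule kinetic_pendant_nonneg)
    \<comment> \<open>Balances the two terms of \<open>S\<close>; \<open>K + 1\<close> in place of
      \<open>K\<close> keeps the weight positive when \<open>K = 0\<close>.\<close>
    define \<theta> where "\<theta> = sqrt ((K + 1) / \<mu>)"
    have th_eq: "\<theta> = sqrt (K + 1) / sqrt \<mu>" by (simp add: \<theta>_def real_sqrt_divide)
    have ab: "0 < sqrt \<mu>" "0 < sqrt (K + 1)" using mu K by auto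
    have th: "0 < \<theta>" using K mu by (simp add: \<theta>_def)
    define S where "S = \<theta> * \<mu> + K / \<theta>"
    have S0: "0 \<le> S" using K mu th by (simp add: S_def)
    have "S \<le> \<theta> * \<mu> + (K + 1) / \<theta>" unfolding S_def using th by (intro add_left_mono divide_right_mono) auto
    also have "\<theta> * \<mu> = sqrt (K + 1) / sqrt \<mu> * (sqrt \<mu> * sqrt \<mu>)"
      unfolding th_eq using mu by simp
    also have "\<dots> = sqrt \<mu> * sqrt (K + 1)" using ab by (simp del: real_sqrt_mult_self)
    also have "(K + 1) / \<theta> = (sqrt (K + 1) * sqrt (K + 1)) / (sqrt (K + 1) / sqrt \<mu>)"
      unfolding th_eq using K by simp
    also have "\<dots> = sqrt \<mu> * sqrt (K + 1)" using ab by (simp del: real_sqrt_mult_self)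
    finally have S: "S \<le> (2 * sqrt \<mu>) * sqrt (K + 1)" by simp
    define B where "B = sqrt S"
    have bnd: "\<bar>x\<bar> \<le> B" if "x\<^sup>2 \<le> S" for x
      using real_sqrt_le_mono[OF that] by (simp add: B_def)
    note sup = pendant_sup_bound[OF H[unfolded u g] th l]
    have HH: "H1_on {0..} 0 u1 g1" "H1_on {0..} 0 u2 g2" "H1_on {0..l} 0 u3 g3"
      and mass: "(LINT x:{0..}|lborel. (u1 x)\<^sup>2) + (LINT x:{0..}|lborel. (u2 x)\<^sup>2)
         + (LINT x:{0..l}|lborel. (u3 x)\<^sup>2) = \<mu>"
      using H unfolding H1_mu_pendant_def H1_pendant_def mass_pendant_def u g by auto
    have L: "(LINT x:{0..}|lborel. \<bar>u1 x\<bar> powr p) \<le> B powr (p - 2) * (LINT x:{0..}|lborel. (u1 x)\<^sup>2)"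
      "(LINT x:{0..}|lborel. \<bar>u2 x\<bar> powr p) \<le> B powr (p - 2) * (LINT x:{0..}|lborel. (u2 x)\<^sup>2)"
      "(LINT x:{0..l}|lborel. \<bar>u3 x\<bar> powr p) \<le> B powr (p - 2) * (LINT x:{0..l}|lborel. (u3 x)\<^sup>2)"
      using sup HH p unfolding S_def[symmetric, unfolded K_def g]
      by (auto intro!: set_integrable_abs_powr(2) H1_onD(1) bnd simp: S_def K_def g)
    define X where "X = (1/p) * ((LINT x:{0..}|lborel. \<bar>u1 x\<bar> powr p) + (LINT x:{0..}|lborel. \<bar>u2 x\<bar> powr p)
         + (LINT x:{0..l}|lborel. \<bar>u3 x\<bar> powr p))"
    have "X \<le> (1/p) * (B powr (p - 2) * \<mu>)"
      unfolding X_def mass[symmetric] distrib_left[of "B powr (p - 2)"]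
      using p L by (intro mult_left_mono add_mono) auto
    also have "\<dots> = \<mu> / p * S powr ((p - 2) / 2)"
      unfolding B_def using S0 by (simp add: powr_half_sqrt[symmetric] powr_powr field_simps)
    also have "\<dots> \<le> \<mu> / p * ((2 * sqrt \<mu>) * sqrt (K + 1)) powr ((p - 2) / 2)"
      using S S0 p mu by (intro mult_left_mono powr_mono2) auto
    also have "\<dots> = D * (K + 1) powr ((p - 2) / 4)"
      unfolding D_def using mu K
      by (simp add: powr_mult powr_half_sqrt[symmetric] powr_powr field_simps)
    also have "\<dots> \<le> (K + 1) / 4 + C" using C[of "K + 1"] K by simp
    finally have "X \<le> (K + 1) / 4 + C" .
    moreover have "E_pendant p l u g = K / 2 - X"
      unfolding E_pendant_def K_def X_def kinetic_pendant_def u g prod.case by simp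
    ultimately show ?thesis unfolding K_def[symmetric] by (simp add: add_divide_distrib)
  qed
  then show ?thesis by blast
qed

section \<open>Compactness\<close>

lemma Fatou_bound:
  fixes f :: "nat \<Rightarrow> 'a \<Rightarrow> real"
  assumes f: "\<And>n. integrable M (f n)" and nn: "\<And>n x. 0 \<le> f n x" and K: "\<And>n. integral\<^sup>L M (f n) \<le> K"
    and lim: "AE x in M. (\<lambda>n. f n x) \<longlonglongrightarrow> g x" and [measurable]: "g \<in> borel_measurable M"
  shows "integrable M g" and "integral\<^sup>L M g \<le> K"
proof -
  have [measurable]: "\<And>n. f n \<in> borel_measurable M" using f by auto
  have K0: "0 \<le> K" using K[of 0] Bochner_Integration.integral_nonneg[of M "f 0"] nn by (meson order_trans)
  have gnn: "AE x in M. 0 \<le> g x"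
    using lim by eventually_elim (rule LIMSEQ_le_const, auto simp: nn)
  have "(\<integral>\<^sup>+x. ennreal (g x) \<partial>M) = (\<integral>\<^sup>+x. liminf (\<lambda>n. ennreal (f n x)) \<partial>M)"
  proof (rule nn_integral_cong_AE)
    show "AE x in M. ennreal (g x) = liminf (\<lambda>n. ennreal (f n x))"
      using lim by eventually_elim (rule lim_imp_Liminf[symmetric], auto)
  qed
  also have "\<dots> \<le> liminf (\<lambda>n. \<integral>\<^sup>+x. ennreal (f n x) \<partial>M)"
    by (rule nn_integral_liminf) measurable
  also have "\<dots> \<le> liminf (\<lambda>n. ennreal K)"
    using f nn K by (intro Liminf_mono always_eventually allI) (simp add: nn_integral_eq_integral ennreal_leI)
  also have "\<dots> = ennreal K" by (rule Liminf_const) simp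
  finally have le: "(\<integral>\<^sup>+x. ennreal (g x) \<partial>M) \<le> ennreal K" .
  then show int: "integrable M g"
    using gnn by (intro integrableI_nonneg) (auto intro: le_less_trans)
  have "ennreal (integral\<^sup>L M g) \<le> ennreal K"
    using le nn_integral_eq_integral[OF int gnn] by simp
  then show "integral\<^sup>L M g \<le> K" using K0 by simp
qed

text \<open>The Riesz-Fischer argument. The prescribed rate leaves room for a geometric weight that
  makes the sequence converge almost everywhere, and Fatou's lemma in the other index yields
  convergence in L^2.\<close>

lemma L2_Cauchy_limit:
  fixes H :: "nat \<Rightarrow> 'a \<Rightarrow> real"
  assumes H[measurable]: "\<And>n. H n \<in> borel_measurable M"
    and int: "\<And>m n. integrable M (\<lambda>x. (H m x - H n x)\<^sup>2)"
    and Cauchy: "\<And>m n. n \<le> m \<Longrightarrow> (\<integral>x. (H m x - H n x)\<^sup>2 \<partial>M) \<le> 8 * (1/8) ^ n"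
  shows "\<exists>h\<in>borel_measurable M. (AE x in M. (\<lambda>n. H n x) \<longlonglongrightarrow> h x) \<and>
    (\<forall>n. integrable M (\<lambda>x. (H n x - h x)\<^sup>2)) \<and> (\<lambda>n. \<integral>x. (H n x - h x)\<^sup>2 \<partial>M) \<longlonglongrightarrow> 0"
proof -
  \<comment> \<open>The integrals of \<open>a n\<close> are at most 8/2^n, so the series is finite
    almost everywhere; bounded terms then force increments of order 2^(-n).\<close>
  define a where "a n x = 4 ^ n * (H (Suc n) x - H n x)\<^sup>2" for n x
  have [measurable]: "a n \<in> borel_measurable M" for n unfolding a_def by measurable
  have "(\<integral>\<^sup>+x. ennreal (a n x) \<partial>M) \<le> ennreal (8 * (1/2) ^ n)" for n
  proof -
    have "(\<integral>\<^sup>+x. ennreal (a n x) \<partial>M) = ennreal (\<integral>x. a n x \<partial>M)"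
      using int by (intro nn_integral_eq_integral) (auto simp: a_def)
    also have "(\<integral>x. a n x \<partial>M) \<le> 4 ^ n * (8 * (1/8) ^ n)"
      unfolding a_def using Cauchy[of n "Suc n"] by simp
    also have "4 ^ n * (8 * (1/8) ^ n) = 8 * (1/2 :: real) ^ n"
      using power_mult_distrib[of "4::real" "1/8" n] by simp
    finally show ?thesis by (simp add: ennreal_leI)
  qed
  then have "(\<Sum>n. \<integral>\<^sup>+x. ennreal (a n x) \<partial>M) \<le> (\<Sum>n. ennreal (8 * (1/2) ^ n))"
    by (intro suminf_le) auto
  also have "\<dots> < top"
    by (subst suminf_ennreal2) (auto intro!: summable_mult summable_geometric)
  finally have "(\<integral>\<^sup>+x. (\<Sum>n. ennreal (a n x)) \<partial>M) \<noteq> top"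
    by (subst nn_integral_suminf) auto
  then have "AE x in M. (\<Sum>n. ennreal (a n x)) \<noteq> top"
    using nn_integral_PInf_AE[of "\<lambda>x. \<Sum>n. ennreal (a n x)" M] by simp
  then have conv: "AE x in M. convergent (\<lambda>n. H n x)"
  proof eventually_elim
    case (elim x)
    have nn: "0 \<le> a n x" for n by (simp add: a_def)
    have "summable (\<lambda>n. a n x)"
      by (rule summable_suminf_not_top[OF nn elim])
    then have "Bseq (\<lambda>n. a n x)" using summable_LIMSEQ_zero convergent_imp_Bseq convergentI by blast
    then obtain S where S: "S > 0" "\<And>n. norm (a n x) \<le> S" by (auto simp: Bseq_def)
    have "norm (H (Suc n) x - H n x) \<le> sqrt S * (1/2) ^ n" for n
    proof -
      have "sqrt (a n x) \<le> sqrt S" using S(2)[of n] nn[of n] by simp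
      moreover have "sqrt (a n x) = 2 ^ n * \<bar>H (Suc n) x - H n x\<bar>"
      proof -
        have "(4::real) ^ n = (2 ^ n)\<^sup>2" by (simp add: power_mult[symmetric] power2_eq_square power_mult_distrib[symmetric])
        then show ?thesis by (simp add: a_def real_sqrt_mult)
      qed
      ultimately show ?thesis by (simp add: power_divide field_simps)
    qed
    moreover have "summable (\<lambda>n. sqrt S * (1/2 :: real) ^ n)"
      by (rule summable_mult[OF summable_geometric]) simp
    ultimately have "summable (\<lambda>n. H (Suc n) x - H n x)"
      using summable_comparison_test'[of "\<lambda>n. sqrt S * (1/2) ^ n" 0 "\<lambda>n. H (Suc n) x - H n x"] by blast
    then have "convergent (\<lambda>n. \<Sum>i<n. H (Suc i) x - H i x)"
      by (simp add: summable_iff_convergent)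
    then have "convergent (\<lambda>n. H n x - H 0 x)"
      using sum_lessThan_telescope[of "\<lambda>n. H n x"] by simp
    then have "convergent (\<lambda>n. (H n x - H 0 x) + H 0 x)"
      by (intro convergent_add convergent_const)
    then show ?case by simp
  qed
  define h where "h x = lim (\<lambda>n. H n x)" for x
  have [measurable]: "h \<in> borel_measurable M" unfolding h_def by measurable
  have lim: "AE x in M. (\<lambda>n. H n x) \<longlonglongrightarrow> h x"
    using conv by eventually_elim (simp add: h_def convergent_LIMSEQ_iff)
  have fat: "integrable M (\<lambda>x. (H n x - h x)\<^sup>2)" "(\<integral>x. (H n x - h x)\<^sup>2 \<partial>M) \<le> 8 * (1/8) ^ n" for n
  proof -
    have l: "AE x in M. (\<lambda>m. (H (m + n) x - H n x)\<^sup>2) \<longlonglongrightarrow> (H n x - h x)\<^sup>2"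
      using lim
    proof eventually_elim
      case (elim x)
      have "(\<lambda>m. (H (m + n) x - H n x)\<^sup>2) \<longlonglongrightarrow> (h x - H n x)\<^sup>2"
        by (intro tendsto_intros LIMSEQ_ignore_initial_segment[OF elim])
      then show ?case by (simp add: power2_commute)
    qed
    show "integrable M (\<lambda>x. (H n x - h x)\<^sup>2)" "(\<integral>x. (H n x - h x)\<^sup>2 \<partial>M) \<le> 8 * (1/8) ^ n"
      using Fatou_bound[of M "\<lambda>m x. (H (m + n) x - H n x)\<^sup>2" "8 * (1/8) ^ n", OF int _ Cauchy l] by auto
  qed
  have "(\<lambda>n. \<integral>x. (H n x - h x)\<^sup>2 \<partial>M) \<longlonglongrightarrow> 0"
  proof (rule tendsto_sandwich[OF _ _ tendsto_const])
    show "(\<lambda>n. 8 * (1/8) ^ n) \<longlonglongrightarrow> (0::real)"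
      by (rule tendsto_mult_right_zero[OF LIMSEQ_power_zero]) simp
  qed (use fat(2) in auto)
  then show ?thesis using lim fat(1) by (intro bexI[of _ h]) auto
qed

text \<open>A substitute for weak compactness in \<open>L\<^sup>2\<close>: almost norm-minimal elements of a decreasing
  sequence of midpoint-convex sets form a Cauchy sequence by the parallelogram law.\<close>

lemma midpoint_convex_L2_limit:
  fixes C :: "nat \<Rightarrow> ('a \<Rightarrow> real) set"
  assumes dec: "\<And>m n. m \<le> n \<Longrightarrow> C n \<subseteq> C m"
    and meas: "\<And>n h. h \<in> C n \<Longrightarrow> h \<in> borel_measurable M"
    and int: "\<And>n h. h \<in> C n \<Longrightarrow> integrable M (\<lambda>x. (h x)\<^sup>2)"
    and mid: "\<And>n h k. h \<in> C n \<Longrightarrow> k \<in> C n \<Longrightarrow> (\<lambda>x. (h x + k x) / 2) \<in> C n"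
    and K: "\<And>n. \<exists>h\<in>C n. (\<integral>x. (h x)\<^sup>2 \<partial>M) \<le> K"
  shows "\<exists>H h. (\<forall>n. H n \<in> C n) \<and> h \<in> borel_measurable M \<and> integrable M (\<lambda>x. (h x)\<^sup>2) \<and>
    (\<integral>x. (h x)\<^sup>2 \<partial>M) \<le> K \<and> (\<forall>n. integrable M (\<lambda>x. (H n x - h x)\<^sup>2)) \<and>
    (\<lambda>n. \<integral>x. (H n x - h x)\<^sup>2 \<partial>M) \<longlonglongrightarrow> 0"
proof -
  define N where "N h = (\<integral>x. (h x)\<^sup>2 \<partial>M)" for h :: "'a \<Rightarrow> real"
  have N0: "0 \<le> N h" for h unfolding N_def by simp
  define d where "d n = Inf (N ` C n)" for n
  have bdd: "bdd_below (N ` C n)" for n using N0 by (intro bdd_belowI2)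
  have ne: "C n \<noteq> {}" for n using K[of n] by auto
  have dle: "d n \<le> N h" if "h \<in> C n" for n h
    unfolding d_def using that bdd by (intro cInf_lower) auto
  have dK: "d n \<le> K" for n
    using K[of n] dle[of _ n] unfolding N_def by (meson order_trans)
  have dmono: "d m \<le> d n" if "m \<le> n" for m n
    unfolding d_def using dec[OF that] ne bdd by (intro cInf_superset_mono) auto
  define D where "D = (SUP n. d n)"
  have bddD: "bdd_above (range d)" using dK by (intro bdd_aboveI2)
  have dD: "d n \<le> D" for n unfolding D_def using bddD by (intro cSUP_upper) auto
  have "\<exists>n. D - (1/8) ^ k < d n" for k
    using less_cSUP_iff[OF _ bddD, of "D - (1/8) ^ k"] unfolding D_def by auto
  then obtain n where n: "\<And>k. D - (1/8) ^ k < d (n k)" by metis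
  \<comment> \<open>Monotone in \<open>k\<close>, at least \<open>k\<close>, and late enough for the
    infimum \<open>d\<close> to be within (1/8)^k of its limit \<open>D\<close>.\<close>
  define n' where "n' k = k + sum n {..k}" for k
  have n'_ge: "k \<le> n' k" "n k \<le> n' k" for k
    unfolding n'_def by (auto intro!: trans_le_add2 member_le_sum)
  have n'_mono: "n' k \<le> n' m" if "k \<le> m" for k m
    unfolding n'_def using that by (intro add_mono sum_mono2) auto
  have n': "D - (1/8) ^ k < d (n' k)" for k
    using n[of k] dmono[OF n'_ge(2)[of k]] by simp
  \<comment> \<open>If the nearly minimal element exceeds the bound \<open>K\<close>, the element
    given by the hypothesis is smaller still and has both properties.\<close>
  have "\<exists>h\<in>C (n' k). N h \<le> K \<and> N h < d (n' k) + (1/8) ^ k" for k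
  proof -
    obtain h1 where h1: "h1 \<in> C (n' k)" "N h1 < d (n' k) + (1/8) ^ k"
      using cInf_lessD[of "N ` C (n' k)" "d (n' k) + (1/8) ^ k"] ne unfolding d_def by auto
    obtain h2 where h2: "h2 \<in> C (n' k)" "N h2 \<le> K" using K[of "n' k"] unfolding N_def by auto
    show ?thesis using h1 h2 by (cases "N h1 \<le> K") force+
  qed
  then obtain H where H: "\<And>k. H k \<in> C (n' k)" "\<And>k. N (H k) \<le> K" "\<And>k. N (H k) < d (n' k) + (1/8) ^ k"
    by metis
  have HC: "H k \<in> C k" for k using H(1) dec[OF n'_ge(1)] by blast
  have [measurable]: "H k \<in> borel_measurable M" for k using meas[OF HC] .
  have par: "integrable M (\<lambda>x. (H m x - H k x)\<^sup>2)"
    "(\<integral>x. (H m x - H k x)\<^sup>2 \<partial>M) = 2 * N (H m) + 2 * N (H k) - 4 * N (\<lambda>x. (H m x + H k x) / 2)" for m k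
  proof -
    have eq: "(H m x - H k x)\<^sup>2 = 2 * (H m x)\<^sup>2 + 2 * (H k x)\<^sup>2 - 4 * ((H m x + H k x) / 2)\<^sup>2" for x
      by (simp add: power2_eq_square field_simps)
    have "H m \<in> C 0" "H k \<in> C 0" using HC dec by blast+
    then have i: "integrable M (\<lambda>x. (H m x)\<^sup>2)" "integrable M (\<lambda>x. (H k x)\<^sup>2)"
      "integrable M (\<lambda>x. ((H m x + H k x) / 2)\<^sup>2)"
      using int[OF mid] int by blast+
    show "integrable M (\<lambda>x. (H m x - H k x)\<^sup>2)" unfolding eq using i by auto
    show "(\<integral>x. (H m x - H k x)\<^sup>2 \<partial>M) = 2 * N (H m) + 2 * N (H k) - 4 * N (\<lambda>x. (H m x + H k x) / 2)"
      unfolding eq N_def using i by simp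
  qed
  \<comment> \<open>The midpoint has squared norm above D - (1/8)^k and both elements lie below D +
    (1/8)^k, so the parallelogram law gives the factor 2 + 2 + 4 = 8.\<close>
  have "(\<integral>x. (H m x - H k x)\<^sup>2 \<partial>M) \<le> 8 * (1/8) ^ k" if km: "k \<le> m" for m k
  proof -
    have "H m \<in> C (n' k)" using H(1) dec[OF n'_mono[OF km]] by blast
    then have "d (n' k) \<le> N (\<lambda>x. (H m x + H k x) / 2)"
      using H(1) by (intro dle mid)
    moreover have "(1/8 :: real) ^ m \<le> (1/8) ^ k" using km by (intro power_decreasing) auto
    ultimately show ?thesis
      unfolding par(2) using n'[of k] H(3)[of k] H(3)[of m] dD[of "n' k"] dD[of "n' m"] by linarith
  qed
  from L2_Cauchy_limit[OF _ par(1) this]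
  obtain h where h: "h \<in> borel_measurable M" "AE x in M. (\<lambda>n. H n x) \<longlonglongrightarrow> h x"
    "\<And>n. integrable M (\<lambda>x. (H n x - h x)\<^sup>2)" "(\<lambda>n. \<integral>x. (H n x - h x)\<^sup>2 \<partial>M) \<longlonglongrightarrow> 0"
    by auto
  have "AE x in M. (\<lambda>n. (H n x)\<^sup>2) \<longlonglongrightarrow> (h x)\<^sup>2"
    using h(2) by eventually_elim (intro tendsto_intros)
  then have "integrable M (\<lambda>x. (h x)\<^sup>2)" "(\<integral>x. (h x)\<^sup>2 \<partial>M) \<le> K"
    using Fatou_bound[of M "\<lambda>n x. (H n x)\<^sup>2" K "\<lambda>x. (h x)\<^sup>2"] int[OF HC] H(2) h(1) unfolding N_def by auto
  then show ?thesis using HC h by blast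
qed

section \<open>Weak derivatives of pointwise limits\<close>

lemma set_integral_L1_le_L2:
  fixes f :: "real \<Rightarrow> real"
  assumes [measurable]: "f \<in> borel_measurable borel" and f2: "set_integrable lborel {a..b} (\<lambda>x. (f x)\<^sup>2)"
  shows "set_integrable lborel {a..b} f"
    and "a \<le> b \<Longrightarrow> \<theta> > 0 \<Longrightarrow> \<bar>LINT x:{a..b}|lborel. f x\<bar> \<le> \<theta> * (b - a) + (LINT x:{a..b}|lborel. (f x)\<^sup>2) / \<theta>"
proof -
  have c: "set_integrable lborel {a..b} (\<lambda>x. \<theta>)" for \<theta> :: real
    by (rule borel_integrable_atLeastAtMost'[OF continuous_on_const])
  have le: "\<bar>f x\<bar> \<le> \<theta> + (f x)\<^sup>2 / \<theta>" if "\<theta> > 0" for \<theta> x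
    using weighted_amgm[OF that, of 1 "f x"] that by (simp add: abs_if split: if_splits)
  show int: "set_integrable lborel {a..b} f"
    by (rule set_integrable_bound[OF set_integral_add(1)[OF c[of 1] f2]])
      (use le[of 1] in \<open>auto simp: set_borel_measurable_def\<close>)
  assume "a \<le> b" "\<theta> > 0"
  have "\<bar>LINT x:{a..b}|lborel. f x\<bar> \<le> (LINT x:{a..b}|lborel. \<bar>f x\<bar>)"
    unfolding set_lebesgue_integral_def by (rule order_trans[OF integral_abs_bound]) (simp add: abs_mult)
  also have "\<dots> \<le> (LINT x:{a..b}|lborel. \<theta> + (f x)\<^sup>2 / \<theta>)"
    by (intro set_integral_mono set_integrable_abs int set_integral_add(1) c) (use f2 le[OF \<open>\<theta> > 0\<close>] in auto)
  also have "\<dots> = (LINT x:{a..b}|lborel. \<theta>) + (LINT x:{a..b}|lborel. (f x)\<^sup>2) / \<theta>"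
    using f2 c by (subst set_integral_add(2)) auto
  also have "(LINT x:{a..b}|lborel. \<theta>) = \<theta> * (b - a)"
    using \<open>a \<le> b\<close> by (simp add: set_lebesgue_integral_def mult.commute)
  finally show "\<bar>LINT x:{a..b}|lborel. f x\<bar> \<le> \<theta> * (b - a) + (LINT x:{a..b}|lborel. (f x)\<^sup>2) / \<theta>" .
qed

text \<open>Covers the half-line and the bounded edge at once, both with base point 0, for the limit
  lemmas below.\<close>

definition edge :: "real set \<Rightarrow> bool" where
  "edge I \<longleftrightarrow> I \<in> sets borel \<and> 0 \<in> I \<and> (\<forall>x\<in>I. 0 \<le> x \<and> {0..x} \<subseteq> I)"

lemma edge_halfline: "edge {0..}" and edge_segment: "0 \<le> l \<Longrightarrow> edge {0..l}"
  unfolding edge_def by auto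

lemma integral_indicator_square:
  fixes g :: "real \<Rightarrow> real"
  shows "integrable lborel (\<lambda>x. (indicator I x * g x)\<^sup>2) \<longleftrightarrow> set_integrable lborel I (\<lambda>x. (g x)\<^sup>2)"
    and "(\<integral>x. (indicator I x * g x)\<^sup>2 \<partial>lborel) = (LINT x:I|lborel. (g x)\<^sup>2)"
proof -
  have "(indicator I x * g x)\<^sup>2 = indicator I x *\<^sub>R (g x)\<^sup>2" for x by (simp add: indicator_def)
  then show "integrable lborel (\<lambda>x. (indicator I x * g x)\<^sup>2) \<longleftrightarrow> set_integrable lborel I (\<lambda>x. (g x)\<^sup>2)"
    "(\<integral>x. (indicator I x * g x)\<^sup>2 \<partial>lborel) = (LINT x:I|lborel. (g x)\<^sup>2)"
    unfolding set_integrable_def set_lebesgue_integral_def by simp_all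
qed

text \<open>The sets \<open>C n\<close> contain the derivatives \<open>g k\<close> with k \<ge> n,
  cut off outside \<open>I\<close>, and are midpoint convex since their constraints are affine in
  \<open>h\<close>. Elements \<open>H n\<close> of \<open>C n\<close> have increments squeezed
  together with those of \<open>u\<close>, so these converge to the increments of \<open>v\<close>;
  L^2 convergence identifies them with the increments of the limit.\<close>

lemma weak_derivative_of_limit:
  fixes u g :: "nat \<Rightarrow> real \<Rightarrow> real"
  assumes I: "edge I" and g[measurable]: "\<And>n. g n \<in> borel_measurable borel"
    and ig: "\<And>n. set_integrable lborel I (\<lambda>x. (g n x)\<^sup>2)" and K: "\<And>n. (LINT x:I|lborel. (g n x)\<^sup>2) \<le> K"
    and u: "\<And>n x. x \<in> I \<Longrightarrow> u n x = u n 0 + (LINT t:{0..x}|lborel. g n t)"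
    and lim: "\<And>x. x \<in> I \<Longrightarrow> (\<lambda>n. u n x) \<longlonglongrightarrow> v x"
  shows "\<exists>h\<in>borel_measurable borel. set_integrable lborel I (\<lambda>x. (h x)\<^sup>2) \<and> (LINT x:I|lborel. (h x)\<^sup>2) \<le> K \<and>
    (\<forall>x\<in>I. set_integrable lborel {0..x} h \<and> v x = v 0 + (LINT t:{0..x}|lborel. h t))"
proof -
  have Iborel[measurable]: "I \<in> sets borel" and I0: "0 \<in> I" and Ix: "\<And>x. x \<in> I \<Longrightarrow> 0 \<le> x" "\<And>x. x \<in> I \<Longrightarrow> {0..x} \<subseteq> I"
    using I unfolding edge_def by auto
  \<comment> \<open>Quantifying over all bounds \<open>b\<close> confines the integral of
    \<open>h\<close> to the closed interval spanned by the increments of \<open>u k\<close>,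
    \<open>k \<ge> n\<close>.\<close>
  define C where "C n = {h \<in> borel_measurable borel. integrable lborel (\<lambda>x. (h x)\<^sup>2) \<and>
     (\<forall>x\<in>I. \<forall>b. (\<forall>k\<ge>n. u k x - u k 0 \<le> b) \<longrightarrow> (LINT t:{0..x}|lborel. h t) \<le> b) \<and>
     (\<forall>x\<in>I. \<forall>b. (\<forall>k\<ge>n. b \<le> u k x - u k 0) \<longrightarrow> b \<le> (LINT t:{0..x}|lborel. h t))}" for n
  have L1: "set_integrable lborel {0..x} h" if "h \<in> borel_measurable borel" "integrable lborel (\<lambda>x. (h x)\<^sup>2)" for h :: "real \<Rightarrow> real" and x
  proof (rule set_integral_L1_le_L2(1)[OF that(1)])
    show "set_integrable lborel {0..x} (\<lambda>x. (h x)\<^sup>2)"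
      by (rule set_integrable_subset[of _ UNIV]) (use that in \<open>auto simp: integrable_lborel_UNIV\<close>)
  qed
  have "\<exists>H h. (\<forall>n. H n \<in> C n) \<and> h \<in> borel_measurable lborel \<and> integrable lborel (\<lambda>x. (h x)\<^sup>2) \<and>
    (\<integral>x. (h x)\<^sup>2 \<partial>lborel) \<le> K \<and> (\<forall>n. integrable lborel (\<lambda>x. (H n x - h x)\<^sup>2)) \<and>
    (\<lambda>n. \<integral>x. (H n x - h x)\<^sup>2 \<partial>lborel) \<longlonglongrightarrow> 0"
  proof (rule midpoint_convex_L2_limit)
    show "C n \<subseteq> C m" if "m \<le> n" for m n
    proof
      fix h assume h: "h \<in> C n"
      have "(LINT t:{0..x}|lborel. h t) \<le> b" if "x \<in> I" "\<forall>k\<ge>m. u k x - u k 0 \<le> b" for x b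
        using h that \<open>m \<le> n\<close> unfolding C_def by auto
      moreover have "b \<le> (LINT t:{0..x}|lborel. h t)" if "x \<in> I" "\<forall>k\<ge>m. b \<le> u k x - u k 0" for x b
        using h that \<open>m \<le> n\<close> unfolding C_def by auto
      ultimately show "h \<in> C m" using h unfolding C_def by auto
    qed
    show "h \<in> borel_measurable lborel" "integrable lborel (\<lambda>x. (h x)\<^sup>2)" if "h \<in> C n" for n h
      using that unfolding C_def by auto
    show "(\<lambda>x. (h x + k x) / 2) \<in> C n" if h: "h \<in> C n" "k \<in> C n" for n h k
    proof -
      have [measurable]: "h \<in> borel_measurable borel" "k \<in> borel_measurable borel"
        and i: "integrable lborel (\<lambda>x. (h x)\<^sup>2)" "integrable lborel (\<lambda>x. (k x)\<^sup>2)"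
        using h unfolding C_def by auto
      have "integrable lborel (\<lambda>x. ((h x + k x) / 2)\<^sup>2)"
      proof (rule Bochner_Integration.integrable_bound[OF Bochner_Integration.integrable_add[OF i]])
        have "((a + b) / 2)\<^sup>2 \<le> a\<^sup>2 + b\<^sup>2" for a b :: real
        proof -
          have "((a + b) / 2)\<^sup>2 = (a\<^sup>2 + b\<^sup>2 + 2 * a * b) / 4" by (simp add: power2_sum power_divide)
          also have "\<dots> \<le> ((a\<^sup>2 + b\<^sup>2) + (a\<^sup>2 + b\<^sup>2)) / 4"
            using sum_squares_bound[of a b] by (intro divide_right_mono add_left_mono) auto
          also have "\<dots> \<le> a\<^sup>2 + b\<^sup>2" by simp
          finally show ?thesis .
        qed
        then show "AE x in lborel. norm (((h x + k x) / 2)\<^sup>2) \<le> norm ((h x)\<^sup>2 + (k x)\<^sup>2)"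
          by (intro AE_I2) simp
      qed measurable
      moreover have avg: "(LINT t:{0..x}|lborel. (h t + k t) / 2) = ((LINT t:{0..x}|lborel. h t) + (LINT t:{0..x}|lborel. k t)) / 2" for x
        using L1[OF _ i(1)] L1[OF _ i(2)] by simp
      have "(LINT t:{0..x}|lborel. (h t + k t) / 2) \<le> b" if "x \<in> I" "\<forall>j\<ge>n. u j x - u j 0 \<le> b" for x b
      proof -
        have "(LINT t:{0..x}|lborel. h t) \<le> b" "(LINT t:{0..x}|lborel. k t) \<le> b"
          using h that unfolding C_def by blast+
        then show ?thesis unfolding avg by simp
      qed
      moreover have "b \<le> (LINT t:{0..x}|lborel. (h t + k t) / 2)" if "x \<in> I" "\<forall>j\<ge>n. b \<le> u j x - u j 0" for x b
      proof -
        have "b \<le> (LINT t:{0..x}|lborel. h t)" "b \<le> (LINT t:{0..x}|lborel. k t)"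
          using h that unfolding C_def by blast+
        then show ?thesis unfolding avg by simp
      qed
      moreover have "(\<lambda>x. (h x + k x) / 2) \<in> borel_measurable borel" by measurable
      ultimately show ?thesis unfolding C_def by blast
    qed
    show "\<exists>h\<in>C n. (\<integral>x. (h x)\<^sup>2 \<partial>lborel) \<le> K" for n
    proof (rule bexI)
      show "(\<integral>x. (indicator I x * g n x)\<^sup>2 \<partial>lborel) \<le> K"
        unfolding integral_indicator_square using K .
      have "(LINT t:{0..x}|lborel. indicator I t * g n t) = u n x - u n 0" if "x \<in> I" for x
      proof -
        have "(LINT t:{0..x}|lborel. indicator I t * g n t) = (LINT t:{0..x}|lborel. g n t)"
          using Ix[OF that] by (intro set_lebesgue_integral_cong) auto
        then show ?thesis using u[OF that, of n] by simp
      qed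
      then show "(\<lambda>x. indicator I x * g n x) \<in> C n"
        unfolding C_def using ig by (auto simp: integral_indicator_square)
    qed
  qed
  then obtain H h where HC: "\<And>n. H n \<in> C n" and h[measurable]: "h \<in> borel_measurable borel"
    and ih: "integrable lborel (\<lambda>x. (h x)\<^sup>2)" and hK: "(\<integral>x. (h x)\<^sup>2 \<partial>lborel) \<le> K"
    and iHh: "\<And>n. integrable lborel (\<lambda>x. (H n x - h x)\<^sup>2)"
    and conv: "(\<lambda>n. \<integral>x. (H n x - h x)\<^sup>2 \<partial>lborel) \<longlonglongrightarrow> 0"
    by auto
  have Hm[measurable]: "H n \<in> borel_measurable borel" and iH: "integrable lborel (\<lambda>x. (H n x)\<^sup>2)" for n
    using HC[of n] unfolding C_def by auto
  have ihU: "set_integrable lborel UNIV (\<lambda>x. (h x)\<^sup>2)" using ih by (simp add: integrable_lborel_UNIV)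
  have ihI: "set_integrable lborel I (\<lambda>x. (h x)\<^sup>2)"
    by (rule set_integrable_subset[OF ihU]) auto
  have "(LINT x:I|lborel. (h x)\<^sup>2) \<le> (LINT x:UNIV|lborel. (h x)\<^sup>2)"
    by (rule set_integral_mono_set[OF ihU]) auto
  then have hIK: "(LINT x:I|lborel. (h x)\<^sup>2) \<le> K" using hK by (simp add: set_integral_UNIV)
  have "v x = v 0 + (LINT t:{0..x}|lborel. h t)" if x: "x \<in> I" for x
  proof -
    have 1: "(\<lambda>n. LINT t:{0..x}|lborel. H n t) \<longlonglongrightarrow> v x - v 0"
    proof (rule LIMSEQ_I)
      fix e :: real assume e: "e > 0"
      have "(\<lambda>k. u k x - u k 0) \<longlonglongrightarrow> v x - v 0"
        by (intro tendsto_intros lim x I0)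
      from LIMSEQ_D[OF this, of "e/2"] e obtain N where N: "\<And>k. k \<ge> N \<Longrightarrow> \<bar>u k x - u k 0 - (v x - v 0)\<bar> < e/2" by auto
      have "\<bar>(LINT t:{0..x}|lborel. H n t) - (v x - v 0)\<bar> < e" if "n \<ge> N" for n
      proof -
        have "u k x - u k 0 \<le> v x - v 0 + e/2 \<and> v x - v 0 - e/2 \<le> u k x - u k 0" if "k \<ge> n" for k
          using N[of k] that \<open>n \<ge> N\<close> by linarith
        then have up: "\<forall>k\<ge>n. u k x - u k 0 \<le> v x - v 0 + e/2" and lo: "\<forall>k\<ge>n. v x - v 0 - e/2 \<le> u k x - u k 0"
          by blast+
        have "(LINT t:{0..x}|lborel. H n t) \<le> v x - v 0 + e/2" "v x - v 0 - e/2 \<le> (LINT t:{0..x}|lborel. H n t)"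
          using HC[of n] x up lo unfolding C_def by blast+
        then show ?thesis using e by (simp add: abs_less_iff)
      qed
      then show "\<exists>N. \<forall>n\<ge>N. norm ((LINT t:{0..x}|lborel. H n t) - (v x - v 0)) < e" by auto
    qed
    define s where "s n = (\<integral>x. (H n x - h x)\<^sup>2 \<partial>lborel)" for n
    have s0: "0 \<le> s n" for n unfolding s_def by simp
    have bound: "\<bar>(LINT t:{0..x}|lborel. H n t) - (LINT t:{0..x}|lborel. h t)\<bar> \<le> (sqrt (s n) + 1 / Suc n) * x + sqrt (s n)" for n
    proof -
      \<comment> \<open>\<open>sqrt (s n)\<close> is the balancing weight; the summand
        \<open>1 / Suc n\<close> keeps it positive when \<open>s n\<close> vanishes.\<close>
      define \<theta> where "\<theta> = sqrt (s n) + 1 / Suc n"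
      have th: "\<theta> > 0" using s0[of n] unfolding \<theta>_def by (intro add_nonneg_pos) auto
      have iU: "set_integrable lborel UNIV (\<lambda>x. (H n x - h x)\<^sup>2)" using iHh by (simp add: integrable_lborel_UNIV)
      have i0: "set_integrable lborel {0..x} (\<lambda>x. (H n x - h x)\<^sup>2)"
        by (rule set_integrable_subset[OF iU]) auto
      have "(LINT t:{0..x}|lborel. H n t) - (LINT t:{0..x}|lborel. h t) = (LINT t:{0..x}|lborel. H n t - h t)"
        using L1[OF Hm iH] L1[OF h ih] by simp
      also have "\<bar>\<dots>\<bar> \<le> \<theta> * (x - 0) + (LINT t:{0..x}|lborel. (H n t - h t)\<^sup>2) / \<theta>"
        by (rule set_integral_L1_le_L2(2)[OF _ i0]) (use Ix x th in auto)
      also have "(LINT t:{0..x}|lborel. (H n t - h t)\<^sup>2) \<le> s n"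
        using set_integral_mono_set[OF iU, of "{0..x}"] by (simp add: s_def set_integral_UNIV)
      also have "s n / \<theta> \<le> sqrt (s n)"
      proof -
        have "sqrt (s n) * sqrt (s n) \<le> sqrt (s n) * \<theta>"
          using s0 by (intro mult_left_mono) (auto simp: \<theta>_def)
        then show ?thesis using th s0[of n] by (simp add: field_simps)
      qed
      finally show ?thesis using th unfolding \<theta>_def[symmetric] by (simp add: divide_right_mono)
    qed
    have s: "s \<longlonglongrightarrow> 0" using conv unfolding s_def .
    have l0: "(\<lambda>n. (sqrt (s n) + 1 / Suc n) * x + sqrt (s n)) \<longlonglongrightarrow> (sqrt 0 + 0) * x + sqrt 0"
      by (intro tendsto_intros s LIMSEQ_Suc[OF lim_1_over_n])
    have "(\<lambda>n. (LINT t:{0..x}|lborel. H n t) - (LINT t:{0..x}|lborel. h t)) \<longlonglongrightarrow> 0"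
    proof (rule Lim_null_comparison)
      show "\<forall>\<^sub>F n in sequentially. norm ((LINT t:{0..x}|lborel. H n t) - (LINT t:{0..x}|lborel. h t))
          \<le> (sqrt (s n) + 1 / Suc n) * x + sqrt (s n)"
        unfolding real_norm_def by (rule always_eventually, rule allI, rule bound)
    qed (use l0 in simp)
    then have "(\<lambda>n. LINT t:{0..x}|lborel. H n t) \<longlonglongrightarrow> (LINT t:{0..x}|lborel. h t)"
      by (simp add: LIM_zero_iff)
    with 1 have "v x - v 0 = (LINT t:{0..x}|lborel. h t)" by (rule LIMSEQ_unique)
    then show ?thesis by simp
  qed
  then show ?thesis using h ihI hIK L1[OF h ih] by blast
qed

text \<open>The rays \<open>{..a}\<close> form an intersection-stable generator of the Borel sets.
  On them the integral is 0 for negative \<open>a\<close> and otherwise reduces to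
  \<open>{0..min a R}\<close>; Dynkin induction extends the vanishing to all Borel sets.\<close>

lemma AE_zero_of_integral_zero:
  fixes d :: "real \<Rightarrow> real"
  assumes d: "integrable lborel d" and out: "\<And>x. x \<notin> {0..R} \<Longrightarrow> d x = 0"
    and zero: "\<And>x. x \<in> {0..R} \<Longrightarrow> (LINT t:{0..x}|lborel. d t) = 0" and R: "0 \<le> R"
  shows "AE x in lborel. d x = 0"
proof (rule density_unique_real[OF d])
  show "integrable lborel (\<lambda>_::real. 0::real)" by simp
next
  fix A :: "real set" assume "A \<in> sets lborel"
  then have A: "A \<in> sigma_sets UNIV (range (\<lambda>a. {..a}))"
    by (metis borel_eq_atMost sets_lborel sets_measure_of top_greatest Pow_UNIV)
  have seti: "set_integrable lborel A d" if "A \<in> sets lborel" for A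
    unfolding set_integrable_def using that d by (rule integrable_mult_indicator)
  have stable: "Int_stable (range (\<lambda>a::real. {..a}))" by (auto simp: Int_stable_def)
  have sub: "range (\<lambda>a::real. {..a}) \<subseteq> Pow UNIV" by simp
  have "(LINT t:A|lborel. d t) = 0" using stable sub A
  proof (induction rule: sigma_sets_induct_disjoint)
    case (basic A)
    then obtain a where A: "A = {..a}" by auto
    have eq: "indicator {..a} t *\<^sub>R d t = (if a < 0 then 0 else indicator {0..min a R} t *\<^sub>R d t)" for t
      using out[of t] by (auto simp: indicator_def)
    show ?case
      using zero[of "min a R"] R unfolding A set_lebesgue_integral_def eq by (cases "a < 0") auto
  next
    case empty
    show ?case by (simp add: set_lebesgue_integral_def)
  next
    case (compl A)
    then have "A \<in> sets lborel"
      by (metis borel_eq_atMost sets_lborel sets_measure_of top_greatest Pow_UNIV)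
    then have i: "set_integrable lborel A d" "set_integrable lborel (UNIV - A) d"
      by (auto intro!: seti)
    have "(LINT t:UNIV|lborel. d t) = (LINT t:A \<union> (UNIV - A)|lborel. d t)" by simp
    also have "\<dots> = (LINT t:A|lborel. d t) + (LINT t:UNIV - A|lborel. d t)"
      by (rule set_integral_Un[OF _ i]) auto
    finally have "(LINT t:UNIV|lborel. d t) = (LINT t:UNIV - A|lborel. d t)" using compl by simp
    moreover have "(LINT t:UNIV|lborel. d t) = (LINT t:{0..R}|lborel. d t)"
      unfolding set_lebesgue_integral_def using out by (intro Bochner_Integration.integral_cong) (auto simp: indicator_def)
    ultimately show ?case using zero[of R] R by simp
  next
    case (union A)
    then have m: "A i \<in> sets lborel" for i
      by (metis borel_eq_atMost sets_lborel sets_measure_of top_greatest Pow_UNIV range_subsetD)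
    have "(LINT t:(\<Union>i. A i)|lborel. d t) = (\<Sum>i. (LINT t:A i|lborel. d t))"
    proof (rule lebesgue_integral_countable_add)
      show "A i \<inter> A j = {}" if "i \<noteq> j" for i j
        using union(1) that by (auto simp: disjoint_family_on_def)
      show "set_integrable lborel (\<Union>i. A i) d"
        using m by (intro seti) auto
    qed (use m in auto)
    then show ?case using union by simp
  qed
  then show "(LINT t:A|lborel. d t) = (LINT t:A|lborel. 0)" by simp
qed

text \<open>Compares a weak derivative obtained by a limit on \<open>{0..R}\<close> with one fixed
  beforehand: equal primitives force equality almost everywhere.\<close>

lemma weak_derivative_unique:
  fixes g h :: "real \<Rightarrow> real"
  assumes g: "set_integrable lborel {0..R} g" and h: "set_integrable lborel {0..R} h" and R: "0 \<le> R"
    and [measurable]: "g \<in> borel_measurable borel" "h \<in> borel_measurable borel"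
    and eq: "\<And>x. x \<in> {0..R} \<Longrightarrow> (LINT t:{0..x}|lborel. g t) = (LINT t:{0..x}|lborel. h t)"
  shows "(LINT t:{0..R}|lborel. (g t)\<^sup>2) = (LINT t:{0..R}|lborel. (h t)\<^sup>2)"
proof -
  have "AE x in lborel. indicator {0..R} x *\<^sub>R (g x - h x) = 0"
  proof (rule AE_zero_of_integral_zero[OF _ _ _ R])
    show "integrable lborel (\<lambda>x. indicator {0..R} x *\<^sub>R (g x - h x))"
      using set_integral_diff(1)[OF g h] unfolding set_integrable_def .
    show "(LINT t:{0..x}|lborel. indicator {0..R} t *\<^sub>R (g t - h t)) = 0" if x: "x \<in> {0..R}" for x
    proof -
      have "(LINT t:{0..x}|lborel. indicator {0..R} t *\<^sub>R (g t - h t)) = (LINT t:{0..x}|lborel. g t - h t)"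
        using x by (intro set_lebesgue_integral_cong) auto
      also have "\<dots> = (LINT t:{0..x}|lborel. g t) - (LINT t:{0..x}|lborel. h t)"
        by (intro set_integral_diff(2) set_integrable_subset[OF g] set_integrable_subset[OF h]) (use x in auto)
      finally show ?thesis using eq[OF x] by simp
    qed
  qed auto
  then have "AE x in lborel. x \<in> {0..R} \<longrightarrow> (g x)\<^sup>2 = (h x)\<^sup>2"
    by eventually_elim (auto simp: indicator_def split: if_splits)
  then show ?thesis
    by (intro set_lebesgue_integral_cong_AE) auto
qed

text \<open>A subsequence whose kinetic integrals stay lower by \<open>e\<close> would produce
  another weak derivative of \<open>v\<close> with a smaller kinetic integral, against
  uniqueness.\<close>

lemma kinetic_lsc:
  fixes u g :: "nat \<Rightarrow> real \<Rightarrow> real"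
  assumes R: "0 \<le> R" and g: "\<And>n. g n \<in> borel_measurable borel"
    and ig: "\<And>n. set_integrable lborel {0..R} (\<lambda>x. (g n x)\<^sup>2)"
    and u: "\<And>n x. x \<in> {0..R} \<Longrightarrow> u n x = u n 0 + (LINT t:{0..x}|lborel. g n t)"
    and lim: "\<And>x. x \<in> {0..R} \<Longrightarrow> (\<lambda>n. u n x) \<longlonglongrightarrow> v x"
    and h: "h \<in> borel_measurable borel" "set_integrable lborel {0..R} h"
    and v: "\<And>x. x \<in> {0..R} \<Longrightarrow> v x = v 0 + (LINT t:{0..x}|lborel. h t)" and e: "e > 0"
  shows "eventually (\<lambda>n. (LINT t:{0..R}|lborel. (h t)\<^sup>2) - e \<le> (LINT t:{0..R}|lborel. (g n t)\<^sup>2)) sequentially"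
proof (rule ccontr)
  assume "\<not> ?thesis"
  then obtain r :: "nat \<Rightarrow> nat" where r: "strict_mono r"
    "\<And>n. (LINT t:{0..R}|lborel. (g (r n) t)\<^sup>2) < (LINT t:{0..R}|lborel. (h t)\<^sup>2) - e"
    using not_eventually_sequentiallyD[of "\<lambda>n. (LINT t:{0..R}|lborel. (h t)\<^sup>2) - e \<le> (LINT t:{0..R}|lborel. (g n t)\<^sup>2)"]
    by (auto simp: not_le)
  have "\<exists>k\<in>borel_measurable borel. set_integrable lborel {0..R} (\<lambda>x. (k x)\<^sup>2) \<and>
      (LINT x:{0..R}|lborel. (k x)\<^sup>2) \<le> (LINT t:{0..R}|lborel. (h t)\<^sup>2) - e \<and>
    (\<forall>x\<in>{0..R}. set_integrable lborel {0..x} k \<and> v x = v 0 + (LINT t:{0..x}|lborel. k t))"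
  proof (rule weak_derivative_of_limit[OF edge_segment[OF R], where u="\<lambda>n. u (r n)" and g="\<lambda>n. g (r n)"])
    show "(\<lambda>n. u (r n) x) \<longlonglongrightarrow> v x" if "x \<in> {0..R}" for x
      using LIMSEQ_subseq_LIMSEQ[OF lim[OF that] r(1)] by (simp add: o_def)
    show "(LINT x:{0..R}|lborel. (g (r n) x)\<^sup>2) \<le> (LINT t:{0..R}|lborel. (h t)\<^sup>2) - e" for n
      using r(2) by (rule less_imp_le)
    show "u (r n) x = u (r n) 0 + (LINT t:{0..x}|lborel. g (r n) t)" if "x \<in> {0..R}" for n x
      using that by (rule u)
  qed (use g ig in auto)
  then obtain k where k: "k \<in> borel_measurable borel" "(LINT x:{0..R}|lborel. (k x)\<^sup>2) \<le> (LINT t:{0..R}|lborel. (h t)\<^sup>2) - e"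
    "\<And>x. x \<in> {0..R} \<Longrightarrow> set_integrable lborel {0..x} k \<and> v x = v 0 + (LINT t:{0..x}|lborel. k t)" by blast
  have "(LINT t:{0..R}|lborel. (k t)\<^sup>2) = (LINT t:{0..R}|lborel. (h t)\<^sup>2)"
  proof (rule weak_derivative_unique[OF _ h(2) R k(1) h(1)])
    show "set_integrable lborel {0..R} k" using k(3)[of R] R by simp
    show "(LINT t:{0..x}|lborel. k t) = (LINT t:{0..x}|lborel. h t)" if "x \<in> {0..R}" for x
      using k(3)[OF that] v[OF that] by linarith
  qed
  then show False using k(2) e by simp
qed

text \<open>A diagonal sequence converges at the rational points of \<open>I\<close>; the bound on
  the kinetic integrals gives equicontinuity, which extends convergence to all of
  \<open>I\<close>.\<close>

lemma pointwise_convergent_subsequence: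
  fixes u g :: "nat \<Rightarrow> real \<Rightarrow> real"
  assumes I: "edge I" and u: "\<And>n. H1_on I 0 (u n) (g n)"
    and K: "\<And>n. (LINT x:I|lborel. (g n x)\<^sup>2) \<le> K" and B: "\<And>n x. x \<in> I \<Longrightarrow> \<bar>u n x\<bar> \<le> B"
  shows "\<exists>r v. strict_mono (r :: nat \<Rightarrow> nat) \<and> (\<forall>x\<in>I. (\<lambda>n. u (r n) x) \<longlonglongrightarrow> v x)"
proof -
  have I0: "0 \<in> I" and Ix: "\<And>x. x \<in> I \<Longrightarrow> 0 \<le> x" "\<And>x. x \<in> I \<Longrightarrow> {0..x} \<subseteq> I"
    using I unfolding edge_def by auto
  have "countable (I \<inter> \<rat>)" using countable_rat by (rule countable_subset[rotated]) auto
  then obtain r :: "nat \<Rightarrow> nat" where r: "strict_mono r" "\<And>x. x \<in> I \<inter> \<rat> \<Longrightarrow> \<exists>l. (\<lambda>n. u (r n) x) \<longlonglongrightarrow> l"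
    using function_convergent_subsequence[of "I \<inter> \<rat>" u B] B by auto
  have K0: "0 \<le> K" using K[of 0] set_integral_nonneg'[of I "\<lambda>x. (g 0 x)\<^sup>2"] by auto
  have equi: "\<bar>u n x - u n q\<bar> \<le> \<theta> * (x - q) + K / \<theta>" if "x \<in> I" "0 \<le> q" "q \<le> x" "\<theta> > 0" for n x q \<theta>
  proof -
    have ad: "antideriv_on I (u n) (g n)" by (rule H1_on_antideriv[OF u]) (use Ix in auto)
    have "q \<in> I" using Ix(2)[OF that(1)] that by auto
    then have "u n x - u n q = (LINT t:{q..x}|lborel. g n t)"
      using ad[unfolded antideriv_on_def, rule_format, of q x] that by auto
    also have "\<bar>\<dots>\<bar> \<le> \<theta> * (x - q) + (LINT t:{q..x}|lborel. (g n t)\<^sup>2) / \<theta>"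
    proof (rule set_integral_L1_le_L2(2))
      show "set_integrable lborel {q..x} (\<lambda>t. (g n t)\<^sup>2)"
        by (rule set_integrable_subset[OF H1_onD(2)[OF u]]) (use Ix(2)[OF that(1)] that in auto)
    qed (use H1_onD(3)[OF u] that in auto)
    also have "(LINT t:{q..x}|lborel. (g n t)\<^sup>2) \<le> (LINT t:I|lborel. (g n t)\<^sup>2)"
      by (rule set_integral_mono_set[OF H1_onD(2)[OF u]]) (use Ix(2)[OF that(1)] that in auto)
    also note K
    finally show ?thesis using that by (simp add: divide_right_mono)
  qed
  have "convergent (\<lambda>n. u (r n) x)" if x: "x \<in> I" for x
  proof (rule Cauchy_convergent, rule metric_CauchyI)
    fix e :: real assume e: "e > 0"
    \<comment> \<open>Pushes \<open>K / \<theta>\<close> below e/6; \<open>K + 1\<close> keeps the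
      weight positive when \<open>K = 0\<close>. The rational \<open>q\<close> is then taken so
      close to \<open>x\<close> that the other term is at most e/6 too.\<close>
    define \<theta> where "\<theta> = 6 * (K + 1) / e"
    have th: "\<theta> > 0" using e K0 by (simp add: \<theta>_def)
    have Kth: "K / \<theta> < e / 6"
      using th e K0 by (simp add: \<theta>_def field_simps)
    obtain q where q: "q \<in> \<rat>" "0 \<le> q" "q \<le> x" "\<theta> * (x - q) \<le> e / 6"
    proof (cases "x = 0")
      case True
      then show ?thesis using that[of 0] e by auto
    next
      case False
      then have "max 0 (x - e / (6 * \<theta>)) < x" using Ix(1)[OF x] e th by auto
      then obtain q where q: "q \<in> \<rat>" "max 0 (x - e / (6 * \<theta>)) < q" "q < x"
        using Rats_dense_in_real by blast
      then have "x - q \<le> e / (6 * \<theta>)" by simp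
      then have "\<theta> * (x - q) \<le> \<theta> * (e / (6 * \<theta>))" using th by (intro mult_left_mono) auto
      then show ?thesis using that[of q] q th by auto
    qed
    have near: "\<bar>u n x - u n q\<bar> < e / 3" for n
      using equi[OF x q(2,3) th, of n] q(4) Kth by linarith
    have "q \<in> I \<inter> \<rat>" using Ix(2)[OF x] q by auto
    then have "Cauchy (\<lambda>n. u (r n) q)" using r(2) LIMSEQ_imp_Cauchy by blast
    then obtain N where N: "\<And>m n. m \<ge> N \<Longrightarrow> n \<ge> N \<Longrightarrow> dist (u (r m) q) (u (r n) q) < e / 3"
      using e unfolding Cauchy_def by (metis divide_pos_pos zero_less_numeral)
    have "dist (u (r m) x) (u (r n) x) < e" if "m \<ge> N" "n \<ge> N" for m n
      using N[OF that] near[of "r m"] near[of "r n"] unfolding dist_real_def by linarith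
    then show "\<exists>N. \<forall>m\<ge>N. \<forall>n\<ge>N. dist (u (r m) x) (u (r n) x) < e" by blast
  qed
  then show ?thesis
    using r(1) by (intro exI[of _ r] exI[of _ "\<lambda>x. lim (\<lambda>n. u (r n) x)"]) (auto simp: convergent_LIMSEQ_iff)
qed

lemma H1_on_limit:
  fixes u g :: "nat \<Rightarrow> real \<Rightarrow> real"
  assumes I: "edge I" and u: "\<And>n. H1_on I 0 (u n) (g n)"
    and K: "\<And>n. (LINT x:I|lborel. (g n x)\<^sup>2) \<le> K" and m: "\<And>n. (LINT x:I|lborel. (u n x)\<^sup>2) \<le> m"
    and lim: "\<And>x. x \<in> I \<Longrightarrow> (\<lambda>n. u n x) \<longlonglongrightarrow> v x"
  shows "\<exists>h. H1_on I 0 v h"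
proof -
  have ueq: "u n x = u n 0 + (LINT t:{0..x}|lborel. g n t)" if "x \<in> I" for n x
    using u[of n] that unfolding H1_on_def by blast
  obtain h where h: "h \<in> borel_measurable borel" "set_integrable lborel I (\<lambda>x. (h x)\<^sup>2)"
    "\<forall>x\<in>I. set_integrable lborel {0..x} h \<and> v x = v 0 + (LINT t:{0..x}|lborel. h t)"
    using weak_derivative_of_limit[OF I H1_onD(3)[OF u] H1_onD(2)[OF u] K ueq lim] by blast
  have iu: "integrable lborel (\<lambda>x. indicator I x *\<^sub>R (u n x)\<^sup>2)" for n
    using H1_onD(1)[OF u[of n]] unfolding set_integrable_def .
  have l: "(\<lambda>n. indicator I x *\<^sub>R (u n x)\<^sup>2) \<longlonglongrightarrow> indicator I x *\<^sub>R (v x)\<^sup>2" for x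
    using lim[of x] by (cases "x \<in> I") (auto intro!: tendsto_intros)
  have "integrable lborel (\<lambda>x. indicator I x *\<^sub>R (v x)\<^sup>2)"
  proof (rule Fatou_bound(1)[where f="\<lambda>n x. indicator I x *\<^sub>R (u n x)\<^sup>2", OF iu])
    show "(\<lambda>x. indicator I x *\<^sub>R (v x)\<^sup>2) \<in> borel_measurable lborel"
      by (rule borel_measurable_LIMSEQ_real[OF l]) (use iu in auto)
    show "(\<integral>x. indicator I x *\<^sub>R (u n x)\<^sup>2 \<partial>lborel) \<le> m" for n
      using m[of n] unfolding set_lebesgue_integral_def .
  qed (use l in auto)
  then show ?thesis
    using h unfolding H1_on_def set_integrable_def[of _ _ "\<lambda>x. (v x)\<^sup>2"] by blast
qed

section \<open>Escaping mass and existence of a ground state\<close>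

lemma E_pendant_eq_energy_on:
  "E_pendant p l (u1, u2, u3) (g1, g2, g3) =
     energy_on p {0..} u1 g1 + energy_on p {0..} u2 g2 + energy_on p {0..l} u3 g3"
  unfolding E_pendant_def energy_on_def by (simp add: algebra_simps)

lemma H1_on_subset:
  assumes "H1_on I a u g" "J \<subseteq> I" "J \<in> sets borel"
  shows "H1_on J a u g"
proof -
  have "set_integrable lborel J (\<lambda>x. (u x)\<^sup>2)" "set_integrable lborel J (\<lambda>x. (g x)\<^sup>2)"
    by (rule set_integrable_subset[OF H1_onD(1)[OF assms(1)]] set_integrable_subset[OF H1_onD(2)[OF assms(1)]];
        use assms in simp)+
  then show ?thesis using assms unfolding H1_on_def by blast
qed

lemma H1_on_scale:
  assumes "H1_on I a u g"
  shows "H1_on I a (\<lambda>x. t * u x) (\<lambda>x. t * g x)"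
  unfolding H1_on_def
proof (intro conjI ballI)
  show "(\<lambda>x. t * g x) \<in> borel_measurable borel" using H1_onD(3)[OF assms] by simp
  show "set_integrable lborel I (\<lambda>x. (t * u x)\<^sup>2)" "set_integrable lborel I (\<lambda>x. (t * g x)\<^sup>2)"
    unfolding power_mult_distrib using H1_onD(1,2)[OF assms] by auto
  fix x assume "x \<in> I"
  then have x: "set_integrable lborel {a..x} g" "u x = u a + (LINT t:{a..x}|lborel. g t)"
    using assms unfolding H1_on_def by blast+
  show "set_integrable lborel {a..x} (\<lambda>x. t * g x)" using x by auto
  show "t * u x = t * u a + (LINT s:{a..x}|lborel. t * g s)"
    unfolding x(2) set_integral_mult_right distrib_left ..
qed

text \<open>The power term enters with a minus sign and is multiplied by t^p, which is at least
  t^2.\<close>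

lemma energy_on_scale_le:
  assumes "1 \<le> t" "2 < p"
  shows "energy_on p S (\<lambda>x. t * u x) (\<lambda>x. t * g x) \<le> t\<^sup>2 * energy_on p S u g"
proof -
  define L where "L = (LINT x:S|lborel. \<bar>u x\<bar> powr p)"
  have L: "0 \<le> L" unfolding L_def by (rule set_integral_nonneg') simp
  have "t powr 2 \<le> t powr p" using assms by (intro powr_mono) auto
  then have "t\<^sup>2 * L \<le> t powr p * L" using L assms by (intro mult_right_mono) auto
  then have "(1/p) * (t\<^sup>2 * L) \<le> (1/p) * (t powr p * L)" using assms by (intro mult_left_mono) auto
  moreover have "energy_on p S (\<lambda>x. t * u x) (\<lambda>x. t * g x) = (1/2) * (t\<^sup>2 * (LINT x:S|lborel. (g x)\<^sup>2)) - (1/p) * (t powr p * L)"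
    unfolding energy_on_def L_def using assms by (simp add: power_mult_distrib abs_mult powr_mult)
  moreover have "t\<^sup>2 * energy_on p S u g = (1/2) * (t\<^sup>2 * (LINT x:S|lborel. (g x)\<^sup>2)) - (1/p) * (t\<^sup>2 * L)"
    unfolding energy_on_def L_def by (simp add: algebra_simps)
  ultimately show ?thesis by linarith
qed

text \<open>Every point of the tail can be reached from \<open>R\<close>, so
  \<open>\<bar>u R\<bar>\<close> serves as the boundary value \<open>d\<close>; the other end is
  taken far out, where \<open>u\<close> is small.\<close>

lemma tail_energy_bound:
  assumes p: "2 < p" and u: "H1_on {0..} 0 u g" and R: "0 \<le> R" and B: "\<And>x. 0 \<le> x \<Longrightarrow> \<bar>u x\<bar> \<le> B"
    and mu: "0 < \<mu>" "(LINT x:{0..}|lborel. (u x)\<^sup>2) \<le> \<mu>"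
    and c: "\<And>M. 0 \<le> M \<Longrightarrow> c \<le> 2 * calib p 1 * M powr ((p + 2) / 2) - \<mu> * M powr (p - 2) / p"
  shows "(LINT x:{R..}|lborel. (u x)\<^sup>2) / \<mu> * c - sqrt (2 / p) / 2 * B powr ((p - 2) / 2) * (u R)\<^sup>2
    \<le> energy_on p {R..} u g"
proof -
  have iu: "set_integrable lborel {R..} (\<lambda>x. (u x)\<^sup>2)" and ig: "set_integrable lborel {R..} (\<lambda>x. (g x)\<^sup>2)"
    by (rule set_integrable_subset[OF H1_onD(1)[OF u]] set_integrable_subset[OF H1_onD(2)[OF u]]; use R in auto)+
  have ad: "antideriv_on {R..} u g"
    by (rule antideriv_on_subset[OF H1_on_antideriv[OF u]]) (use R in auto)
  have "(LINT x:{R..}|lborel. (u x)\<^sup>2) \<le> (LINT x:{0..}|lborel. (u x)\<^sup>2)"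
    by (rule set_integral_mono_set[OF H1_onD(1)[OF u]]) (use R in auto)
  with mu have mR: "(LINT x:{R..}|lborel. (u x)\<^sup>2) \<le> \<mu>" by simp
  have "(LINT x:{R..}|lborel. (u x)\<^sup>2) / \<mu> * c - sqrt (2 / p) / 2 * B powr ((p - 2) / 2) * \<bar>u R\<bar>\<^sup>2
    \<le> energy_on p {R..} u g"
  proof (rule energy_lower_bound[OF p _ _ ad iu ig])
    fix x0 e :: real assume x0: "x0 \<in> {R..}" and e: "e > 0"
    obtain y where y: "y \<ge> x0" "(u y)\<^sup>2 < e\<^sup>2"
      using exists_small_value[OF iu, of "e\<^sup>2" x0] e by auto
    then have "\<bar>u y\<bar> \<le> e" using e abs_le_square_iff[of "u y" e] by auto
    then show "\<exists>y1 y2. y1 \<le> x0 \<and> x0 \<le> y2 \<and> {y1..y2} \<subseteq> {R..} \<and> \<bar>u y1\<bar> \<le> \<bar>u R\<bar> + e \<and> \<bar>u y2\<bar> \<le> e"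
      using x0 y(1) e by (intro exI[of _ R] exI[of _ y]) auto
  qed (use mu mR c B R in auto)
  then show ?thesis by simp
qed

text \<open>The half-line bound with weight 1 dominates the square at \<open>x\<close> by the tails
  of two convergent integrals.\<close>

lemma H1_halfline_tendsto_0:
  assumes u: "H1_on {0..} 0 u g"
  shows "((\<lambda>x. (u x)\<^sup>2) \<longlongrightarrow> 0) at_top"
proof (rule tendsto_sandwich[OF _ _ tendsto_const])
  define m k where "m x = (LINT t:{0..x}|lborel. (u t)\<^sup>2)" and "k x = (LINT t:{0..x}|lborel. (g t)\<^sup>2)" for x
  define m0 k0 where "m0 = (LINT t:{0..}|lborel. (u t)\<^sup>2)" and "k0 = (LINT t:{0..}|lborel. (g t)\<^sup>2)"
  note iu = H1_onD(1)[OF u] and ig = H1_onD(2)[OF u]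
  have "(u x)\<^sup>2 \<le> (m0 - m x) + (k0 - k x)" if x: "0 \<le> x" for x
  proof -
    have "(u x)\<^sup>2 \<le> 1 * (LINT t:{x..}|lborel. (u t)\<^sup>2) + (LINT t:{x..}|lborel. (g t)\<^sup>2) / 1"
    proof (rule square_bound_halfline)
      show "antideriv_on {x..} u g"
        by (rule antideriv_on_subset[OF H1_on_antideriv[OF u]]) (use x in auto)
      show "set_integrable lborel {x..} (\<lambda>t. (u t)\<^sup>2)" "set_integrable lborel {x..} (\<lambda>t. (g t)\<^sup>2)"
        by (rule set_integrable_subset[OF iu] set_integrable_subset[OF ig]; use x in auto)+
    qed simp
    then show ?thesis
      using set_integral_atLeast_split[OF iu x] set_integral_atLeast_split[OF ig x]
      unfolding m_def k_def m0_def k0_def by simp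
  qed
  then show "eventually (\<lambda>x. (u x)\<^sup>2 \<le> (m0 - m x) + (k0 - k x)) at_top"
    by (auto simp: eventually_at_top_linorder)
  have "((\<lambda>x. (m0 - m x) + (k0 - k x)) \<longlongrightarrow> (m0 - m0) + (k0 - k0)) at_top"
    unfolding m_def k_def m0_def k0_def
    by (intro tendsto_intros tendsto_set_lebesgue_integral_at_top iu ig) auto
  then show "((\<lambda>x. (m0 - m x) + (k0 - k x)) \<longlongrightarrow> 0) at_top" by simp
qed auto

section \<open>Convergence on a bounded core\<close>

lemma set_integral_bounded_convergence:
  fixes f :: "nat \<Rightarrow> real \<Rightarrow> real"
  assumes f: "\<And>n. set_integrable lborel {0..R} (f n)" and h: "set_integrable lborel {0..R} h"
    and B: "\<And>n x. x \<in> {0..R} \<Longrightarrow> \<bar>f n x\<bar> \<le> B" and lim: "\<And>x. x \<in> {0..R} \<Longrightarrow> (\<lambda>n. f n x) \<longlonglongrightarrow> h x"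
  shows "(\<lambda>n. LINT x:{0..R}|lborel. f n x) \<longlonglongrightarrow> (LINT x:{0..R}|lborel. h x)"
  unfolding set_lebesgue_integral_def
proof (rule integral_dominated_convergence[where w="\<lambda>x. indicator {0..R} x *\<^sub>R B"])
  show "integrable lborel (\<lambda>x. indicator {0..R} x *\<^sub>R B)"
    using borel_integrable_atLeastAtMost'[OF continuous_on_const, of 0 R B] unfolding set_integrable_def .
  show "AE x in lborel. (\<lambda>n. indicator {0..R} x *\<^sub>R f n x) \<longlonglongrightarrow> indicator {0..R} x *\<^sub>R h x"
    using lim by (intro AE_I2) (auto simp: indicator_def)
  show "AE x in lborel. norm (indicator {0..R} x *\<^sub>R f n x) \<le> indicator {0..R} x *\<^sub>R B" for n
    using B by (intro AE_I2) (auto simp: indicator_def)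
qed (use f h in \<open>auto simp: set_integrable_def\<close>)

text \<open>The uniform bound \<open>B\<close> allows dominated convergence for mass and L^p norm.
  The kinetic part is only lower semicontinuous, so energies are compared from one side.\<close>

lemma core_limits:
  fixes u g :: "nat \<Rightarrow> real \<Rightarrow> real"
  assumes p: "2 < p" and R: "0 \<le> R" and u: "\<And>n. H1_on {0..R} 0 (u n) (g n)" and v: "H1_on {0..R} 0 v h"
    and B: "\<And>n x. x \<in> {0..R} \<Longrightarrow> \<bar>u n x\<bar> \<le> B" and lim: "\<And>x. x \<in> {0..R} \<Longrightarrow> (\<lambda>n. u n x) \<longlonglongrightarrow> v x"
  shows "(\<lambda>n. LINT x:{0..R}|lborel. (u n x)\<^sup>2) \<longlonglongrightarrow> (LINT x:{0..R}|lborel. (v x)\<^sup>2)"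
    and "e > 0 \<Longrightarrow> eventually (\<lambda>n. energy_on p {0..R} v h - e \<le> energy_on p {0..R} (u n) (g n)) sequentially"
proof -
  have vB: "\<bar>v x\<bar> \<le> B" if "x \<in> {0..R}" for x
    by (rule LIMSEQ_le_const2[OF tendsto_rabs[OF lim[OF that]]]) (use B[OF that] in auto)
  show "(\<lambda>n. LINT x:{0..R}|lborel. (u n x)\<^sup>2) \<longlonglongrightarrow> (LINT x:{0..R}|lborel. (v x)\<^sup>2)"
  proof (rule set_integral_bounded_convergence[where B="B\<^sup>2"])
    show "set_integrable lborel {0..R} (\<lambda>x. (u n x)\<^sup>2)" "set_integrable lborel {0..R} (\<lambda>x. (v x)\<^sup>2)" for n
      using H1_onD(1)[OF u] H1_onD(1)[OF v] by auto
    show "\<bar>(u n x)\<^sup>2\<bar> \<le> B\<^sup>2" if "x \<in> {0..R}" for n x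
      using power_mono[OF B[OF that, of n] abs_ge_zero, of 2] by simp
    show "(\<lambda>n. (u n x)\<^sup>2) \<longlonglongrightarrow> (v x)\<^sup>2" if "x \<in> {0..R}" for x
      by (intro tendsto_intros lim that)
  qed
  have L: "(\<lambda>n. LINT x:{0..R}|lborel. \<bar>u n x\<bar> powr p) \<longlonglongrightarrow> (LINT x:{0..R}|lborel. \<bar>v x\<bar> powr p)"
  proof (rule set_integral_bounded_convergence[where B="B powr p"])
    show "set_integrable lborel {0..R} (\<lambda>x. \<bar>u n x\<bar> powr p)" for n
      by (rule set_integrable_abs_powr(1)[OF H1_onD(1)[OF u]]) (use B p in auto)
    show "set_integrable lborel {0..R} (\<lambda>x. \<bar>v x\<bar> powr p)"
      by (rule set_integrable_abs_powr(1)[OF H1_onD(1)[OF v]]) (use vB p in auto)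
    show "\<bar>\<bar>u n x\<bar> powr p\<bar> \<le> B powr p" if "x \<in> {0..R}" for n x
      using B[OF that] p by (simp add: powr_mono2)
    show "(\<lambda>n. \<bar>u n x\<bar> powr p) \<longlonglongrightarrow> \<bar>v x\<bar> powr p" if "x \<in> {0..R}" for x
      by (rule tendsto_powr2[OF tendsto_rabs[OF lim[OF that]] tendsto_const]) (use p in auto)
  qed
  assume e: "e > 0"
  have "eventually (\<lambda>n. (LINT t:{0..R}|lborel. (h t)\<^sup>2) - e \<le> (LINT t:{0..R}|lborel. (g n t)\<^sup>2)) sequentially"
  proof (rule kinetic_lsc[OF R H1_onD(3)[OF u] H1_onD(2)[OF u] _ lim H1_onD(3)[OF v] _ _ e])
    show "u n x = u n 0 + (LINT t:{0..x}|lborel. g n t)" if "x \<in> {0..R}" for n x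
      using u[of n] that unfolding H1_on_def by blast
    show "v x = v 0 + (LINT t:{0..x}|lborel. h t)" if "x \<in> {0..R}" for x
      using v that unfolding H1_on_def by blast
    show "set_integrable lborel {0..R} h"
      using v R unfolding H1_on_def by auto
  qed
  moreover have "eventually (\<lambda>n. (LINT x:{0..R}|lborel. \<bar>u n x\<bar> powr p) < (LINT x:{0..R}|lborel. \<bar>v x\<bar> powr p) + p * (e / 2)) sequentially"
    using e p by (intro order_tendstoD(2)[OF L]) simp
  ultimately show "eventually (\<lambda>n. energy_on p {0..R} v h - e \<le> energy_on p {0..R} (u n) (g n)) sequentially"
  proof eventually_elim
    case (elim n)
    have "(1/p) * (LINT x:{0..R}|lborel. \<bar>u n x\<bar> powr p) \<le> (1/p) * ((LINT x:{0..R}|lborel. \<bar>v x\<bar> powr p) + p * (e / 2))"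
      using elim(2) p by (intro mult_left_mono) auto
    also have "\<dots> = (1/p) * (LINT x:{0..R}|lborel. \<bar>v x\<bar> powr p) + e / 2" using p by (simp add: distrib_left)
    finally show ?case using elim(1) unfolding energy_on_def by (simp add: field_simps)
  qed
qed

lemma energy_on_split:
  assumes p: "2 < p" and u: "H1_on {0..} 0 u g" and R: "0 \<le> R" and B: "\<And>x. 0 \<le> x \<Longrightarrow> \<bar>u x\<bar> \<le> B"
  shows "energy_on p {0..} u g = energy_on p {0..R} u g + energy_on p {R..} u g"
proof -
  have "set_integrable lborel {0..} (\<lambda>x. \<bar>u x\<bar> powr p)"
    by (rule set_integrable_abs_powr(1)[OF H1_onD(1)[OF u]]) (use B p in auto)
  then show ?thesis
    unfolding energy_on_def
    using set_integral_atLeast_split[OF H1_onD(2)[OF u] R] set_integral_atLeast_split[OF _ R, of "\<lambda>x. \<bar>u x\<bar> powr p"]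
    by (simp add: algebra_simps)
qed

lemma energy_on_tendsto:
  assumes p: "2 < p" and u: "H1_on {0..} 0 u g" and B: "\<And>x. 0 \<le> x \<Longrightarrow> \<bar>u x\<bar> \<le> B"
  shows "((\<lambda>R. energy_on p {0..R} u g) \<longlongrightarrow> energy_on p {0..} u g) at_top"
proof -
  have "set_integrable lborel {0..} (\<lambda>x. \<bar>u x\<bar> powr p)"
    by (rule set_integrable_abs_powr(1)[OF H1_onD(1)[OF u]]) (use B p in auto)
  then show ?thesis unfolding energy_on_def
    by (intro tendsto_intros tendsto_set_lebesgue_integral_at_top H1_onD(2)[OF u]) auto
qed

section \<open>Limits of bounded sequences on the graph\<close>

lemma pendant_limit_exists:
  fixes U1 U2 U3 G1 G2 G3 :: "nat \<Rightarrow> real \<Rightarrow> real"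
  assumes l: "0 < l"
    and H: "\<And>n. H1_mu_pendant l \<mu> (U1 n, U2 n, U3 n) (G1 n, G2 n, G3 n)"
    and K: "\<And>n. kinetic_pendant l (G1 n, G2 n, G3 n) \<le> K"
  shows "\<exists>r v1 v2 v3 h1 h2 h3. strict_mono (r :: nat \<Rightarrow> nat) \<and> H1_pendant l (v1, v2, v3) (h1, h2, h3) \<and>
    (\<forall>x\<ge>0. (\<lambda>n. U1 (r n) x) \<longlonglongrightarrow> v1 x) \<and> (\<forall>x\<ge>0. (\<lambda>n. U2 (r n) x) \<longlonglongrightarrow> v2 x) \<and>
    (\<forall>x\<in>{0..l}. (\<lambda>n. U3 (r n) x) \<longlonglongrightarrow> v3 x)"
proof -
  have H1: "H1_on {0..} 0 (U1 n) (G1 n)" and H2: "H1_on {0..} 0 (U2 n) (G2 n)" and H3: "H1_on {0..l} 0 (U3 n) (G3 n)"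
    and v: "U1 n 0 = U2 n 0" "U2 n 0 = U3 n 0" for n
    using H[of n] unfolding H1_mu_pendant_def H1_pendant_def by auto
  have nn: "0 \<le> (LINT x:S|lborel. (f x)\<^sup>2)" for S and f :: "real \<Rightarrow> real"
    by (rule set_integral_nonneg') simp
  have mass: "(LINT x:{0..}|lborel. (U1 n x)\<^sup>2) + (LINT x:{0..}|lborel. (U2 n x)\<^sup>2) + (LINT x:{0..l}|lborel. (U3 n x)\<^sup>2) = \<mu>" for n
    using H[of n] unfolding H1_mu_pendant_def mass_pendant_def by auto
  have m: "(LINT x:{0..}|lborel. (U1 n x)\<^sup>2) \<le> \<mu>" "(LINT x:{0..}|lborel. (U2 n x)\<^sup>2) \<le> \<mu>" "(LINT x:{0..l}|lborel. (U3 n x)\<^sup>2) \<le> \<mu>" for n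
    using mass[of n] nn[of "{0..}" "U1 n"] nn[of "{0..}" "U2 n"] nn[of "{0..l}" "U3 n"] by linarith+
  have k: "(LINT x:{0..}|lborel. (G1 n x)\<^sup>2) \<le> K" "(LINT x:{0..}|lborel. (G2 n x)\<^sup>2) \<le> K" "(LINT x:{0..l}|lborel. (G3 n x)\<^sup>2) \<le> K" for n
    using K[of n] nn[of "{0..}" "G1 n"] nn[of "{0..}" "G2 n"] nn[of "{0..l}" "G3 n"]
    unfolding kinetic_pendant_def prod.case by linarith+
  define B where "B = sqrt (1 * \<mu> + K / 1)"
  have Bb: "\<bar>x\<bar> \<le> B" if "x\<^sup>2 \<le> 1 * \<mu> + kinetic_pendant l (G1 n, G2 n, G3 n) / 1" for x n
  proof -
    have "x\<^sup>2 \<le> 1 * \<mu> + K / 1" using that K[of n] by simp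
    from real_sqrt_le_mono[OF this] show ?thesis by (simp add: B_def)
  qed
  have B: "x \<in> {0..} \<Longrightarrow> \<bar>U1 n x\<bar> \<le> B" "x \<in> {0..} \<Longrightarrow> \<bar>U2 n x\<bar> \<le> B" "x \<in> {0..l} \<Longrightarrow> \<bar>U3 n x\<bar> \<le> B" for n x
    using pendant_sup_bound[OF H[of n] zero_less_one l, of x, THEN Bb] by auto
  have "\<exists>r v. strict_mono (r :: nat \<Rightarrow> nat) \<and> (\<forall>x\<in>{0..}. (\<lambda>n. U1 (r n) x) \<longlonglongrightarrow> v x)"
    by (rule pointwise_convergent_subsequence[OF edge_halfline H1 k(1) B(1)])
  then obtain r1 v1 where r1: "strict_mono (r1 :: nat \<Rightarrow> nat)" "\<forall>x\<in>{0..}. (\<lambda>n. U1 (r1 n) x) \<longlonglongrightarrow> v1 x"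
    by blast
  have "\<exists>r v. strict_mono (r :: nat \<Rightarrow> nat) \<and> (\<forall>x\<in>{0..}. (\<lambda>n. U2 (r1 (r n)) x) \<longlonglongrightarrow> v x)"
    by (rule pointwise_convergent_subsequence[where u="\<lambda>n. U2 (r1 n)", OF edge_halfline H2 k(2) B(2)])
  then obtain r2 v2 where r2: "strict_mono (r2 :: nat \<Rightarrow> nat)" "\<forall>x\<in>{0..}. (\<lambda>n. U2 (r1 (r2 n)) x) \<longlonglongrightarrow> v2 x"
    by blast
  have "\<exists>r v. strict_mono (r :: nat \<Rightarrow> nat) \<and> (\<forall>x\<in>{0..l}. (\<lambda>n. U3 (r1 (r2 (r n))) x) \<longlonglongrightarrow> v x)"
    by (rule pointwise_convergent_subsequence[where u="\<lambda>n. U3 (r1 (r2 n))", OF edge_segment[OF less_imp_le[OF l]] H3 k(3) B(3)])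
  then obtain r3 v3 where r3: "strict_mono (r3 :: nat \<Rightarrow> nat)" "\<forall>x\<in>{0..l}. (\<lambda>n. U3 (r1 (r2 (r3 n))) x) \<longlonglongrightarrow> v3 x"
    by blast
  \<comment> \<open>One nested extraction per edge; the vertex conditions pass to the pointwise
    limits at 0.\<close>
  define r where "r n = r1 (r2 (r3 n))" for n
  have r: "strict_mono r"
    using strict_mono_o[OF r1(1) strict_mono_o[OF r2(1) r3(1)]] unfolding r_def o_def .
  have L1: "(\<lambda>n. U1 (r n) x) \<longlonglongrightarrow> v1 x" if "0 \<le> x" for x
    using LIMSEQ_subseq_LIMSEQ[OF _ strict_mono_o[OF r2(1) r3(1)], of "\<lambda>n. U1 (r1 n) x"] r1(2) that
    by (simp add: r_def o_def)
  have L2: "(\<lambda>n. U2 (r n) x) \<longlonglongrightarrow> v2 x" if "0 \<le> x" for x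
    using LIMSEQ_subseq_LIMSEQ[OF _ r3(1), of "\<lambda>n. U2 (r1 (r2 n)) x"] r2(2) that
    by (simp add: r_def o_def)
  have L3: "(\<lambda>n. U3 (r n) x) \<longlonglongrightarrow> v3 x" if "x \<in> {0..l}" for x
    using r3(2) that by (simp add: r_def)
  have "\<exists>h. H1_on {0..} 0 v1 h"
    by (rule H1_on_limit[where u="\<lambda>n. U1 (r n)" and g="\<lambda>n. G1 (r n)", OF edge_halfline H1 k(1) m(1)]) (use L1 in auto)
  then obtain h1 where h1: "H1_on {0..} 0 v1 h1" by blast
  have "\<exists>h. H1_on {0..} 0 v2 h"
    by (rule H1_on_limit[where u="\<lambda>n. U2 (r n)" and g="\<lambda>n. G2 (r n)", OF edge_halfline H2 k(2) m(2)]) (use L2 in auto)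
  then obtain h2 where h2: "H1_on {0..} 0 v2 h2" by blast
  have "\<exists>h. H1_on {0..l} 0 v3 h"
    by (rule H1_on_limit[where u="\<lambda>n. U3 (r n)" and g="\<lambda>n. G3 (r n)", OF edge_segment[OF less_imp_le[OF l]] H3 k(3) m(3)]) (use L3 in auto)
  then obtain h3 where h3: "H1_on {0..l} 0 v3 h3" by blast
  have "v1 0 = v2 0" "v2 0 = v3 0"
    using LIMSEQ_unique[OF L1[of 0]] L2[of 0] LIMSEQ_unique[OF L2[of 0]] L3[of 0] l v by auto
  then have "H1_pendant l (v1, v2, v3) (h1, h2, h3)"
    unfolding H1_pendant_def using h1 h2 h3 by simp
  then show ?thesis using r L1 L2 L3 by blast
qed

text \<open>Mass that escapes along the half-lines costs at least its share of the energy level \<open>c\<close>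
  of the line.\<close>

lemma escaping_mass_bound:
  fixes U1 U2 U3 G1 G2 G3 :: "nat \<Rightarrow> real \<Rightarrow> real"
  assumes p: "2 < p" and l: "0 < l" and mu: "0 < \<mu>"
    and H: "\<And>n. H1_mu_pendant l \<mu> (U1 n, U2 n, U3 n) (G1 n, G2 n, G3 n)"
    and B: "\<And>n x. 0 \<le> x \<Longrightarrow> \<bar>U1 n x\<bar> \<le> B" "\<And>n x. 0 \<le> x \<Longrightarrow> \<bar>U2 n x\<bar> \<le> B" "\<And>n x. x \<in> {0..l} \<Longrightarrow> \<bar>U3 n x\<bar> \<le> B"
    and v: "H1_pendant l (v1, v2, v3) (h1, h2, h3)"
    and lim: "\<And>x. 0 \<le> x \<Longrightarrow> (\<lambda>n. U1 n x) \<longlonglongrightarrow> v1 x" "\<And>x. 0 \<le> x \<Longrightarrow> (\<lambda>n. U2 n x) \<longlonglongrightarrow> v2 x"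
      "\<And>x. x \<in> {0..l} \<Longrightarrow> (\<lambda>n. U3 n x) \<longlonglongrightarrow> v3 x"
    and E: "(\<lambda>n. E_pendant p l (U1 n, U2 n, U3 n) (G1 n, G2 n, G3 n)) \<longlonglongrightarrow> E0"
    and c: "\<And>M. 0 \<le> M \<Longrightarrow> c \<le> 2 * calib p 1 * M powr ((p + 2) / 2) - \<mu> * M powr (p - 2) / p"
  defines "m \<equiv> mass_pendant l (v1, v2, v3)"
  shows "m \<le> \<mu>" and "E_pendant p l (v1, v2, v3) (h1, h2, h3) + (\<mu> - m) / \<mu> * c \<le> E0"
proof -
  have H1: "H1_on {0..} 0 (U1 n) (G1 n)" and H2: "H1_on {0..} 0 (U2 n) (G2 n)" and H3: "H1_on {0..l} 0 (U3 n) (G3 n)" for n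
    using H[of n] unfolding H1_mu_pendant_def H1_pendant_def by auto
  have h1: "H1_on {0..} 0 v1 h1" and h2: "H1_on {0..} 0 v2 h2" and h3: "H1_on {0..l} 0 v3 h3"
    using v unfolding H1_pendant_def by auto
  have nn: "0 \<le> (LINT x:S|lborel. (f x)\<^sup>2)" for S and f :: "real \<Rightarrow> real"
    by (rule set_integral_nonneg') simp
  have mass: "(LINT x:{0..}|lborel. (U1 n x)\<^sup>2) + (LINT x:{0..}|lborel. (U2 n x)\<^sup>2) + (LINT x:{0..l}|lborel. (U3 n x)\<^sup>2) = \<mu>" for n
    using H[of n] unfolding H1_mu_pendant_def mass_pendant_def by auto
  have mle: "(LINT x:{0..}|lborel. (U1 n x)\<^sup>2) \<le> \<mu>" "(LINT x:{0..}|lborel. (U2 n x)\<^sup>2) \<le> \<mu>" for n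
    using mass[of n] nn[of "{0..}" "U1 n"] nn[of "{0..}" "U2 n"] nn[of "{0..l}" "U3 n"] by linarith+
  have vB: "\<bar>v1 x\<bar> \<le> B" "\<bar>v2 x\<bar> \<le> B" if "0 \<le> x" for x
    by (rule LIMSEQ_le_const2[OF tendsto_rabs[OF lim(1)[OF that]]] LIMSEQ_le_const2[OF tendsto_rabs[OF lim(2)[OF that]]];
        use B that in blast)+
  \<comment> \<open>The common bound \<open>B\<close> makes this coefficient of the boundary error
    the same for all \<open>n\<close>.\<close>
  define D where "D = sqrt (2 / p) / 2 * B powr ((p - 2) / 2)"
  define core where "core R u1 u2 u3 = (LINT x:{0..R}|lborel. (u1 x)\<^sup>2) + (LINT x:{0..R}|lborel. (u2 x)\<^sup>2) + (LINT x:{0..l}|lborel. (u3 x)\<^sup>2)"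
    for R and u1 u2 u3 :: "real \<Rightarrow> real"
  define Ecore where "Ecore R = energy_on p {0..R} v1 h1 + energy_on p {0..R} v2 h2 + energy_on p {0..l} v3 h3" for R
  have sub: "H1_on {0..R} 0 (U1 n) (G1 n)" "H1_on {0..R} 0 (U2 n) (G2 n)" "H1_on {0..R} 0 v1 h1" "H1_on {0..R} 0 v2 h2" for n R
    using H1_on_subset[OF H1] H1_on_subset[OF H2] H1_on_subset[OF h1] H1_on_subset[OF h2] by auto
  have core_lim: "(\<lambda>n. core R (U1 n) (U2 n) (U3 n)) \<longlonglongrightarrow> core R v1 v2 v3" if R: "0 \<le> R" for R
    unfolding core_def
    by (intro tendsto_add core_limits(1)[where B=B, OF p R sub(1) sub(3)] core_limits(1)[where B=B, OF p R sub(2) sub(4)]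
        core_limits(1)[where B=B, OF p less_imp_le[OF l] H3 h3]) (use B lim in auto)
  have core_le: "core R (U1 n) (U2 n) (U3 n) \<le> \<mu>" if R: "0 \<le> R" for R n
  proof -
    have "(LINT x:{0..R}|lborel. (U1 n x)\<^sup>2) \<le> (LINT x:{0..}|lborel. (U1 n x)\<^sup>2)"
      by (rule set_integral_mono_set[OF H1_onD(1)[OF H1]]) auto
    moreover have "(LINT x:{0..R}|lborel. (U2 n x)\<^sup>2) \<le> (LINT x:{0..}|lborel. (U2 n x)\<^sup>2)"
      by (rule set_integral_mono_set[OF H1_onD(1)[OF H2]]) auto
    ultimately show ?thesis unfolding core_def using mass[of n] by linarith
  qed
  \<comment> \<open>At fixed \<open>R\<close> the limit in \<open>n\<close> replaces the boundary
    errors by those of \<open>v1\<close> and \<open>v2\<close> at \<open>R\<close>; these vanish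
    only in the later limit of large \<open>R\<close>.\<close>
  have step: "Ecore R + (\<mu> - core R v1 v2 v3) / \<mu> * c - D * ((v1 R)\<^sup>2 + (v2 R)\<^sup>2) \<le> E0" if R: "0 \<le> R" for R
  proof (rule field_le_epsilon)
    fix e :: real assume e: "e > 0"
    define a where "a n = Ecore R - e + (\<mu> - core R (U1 n) (U2 n) (U3 n)) / \<mu> * c - D * ((U1 n R)\<^sup>2 + (U2 n R)\<^sup>2)" for n
    have "eventually (\<lambda>n. energy_on p {0..R} v1 h1 - e/3 \<le> energy_on p {0..R} (U1 n) (G1 n)) sequentially"
      by (rule core_limits(2)[where B=B, OF p R sub(1) sub(3)]) (use B lim e in auto)
    moreover have "eventually (\<lambda>n. energy_on p {0..R} v2 h2 - e/3 \<le> energy_on p {0..R} (U2 n) (G2 n)) sequentially"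
      by (rule core_limits(2)[where B=B, OF p R sub(2) sub(4)]) (use B lim e in auto)
    moreover have "eventually (\<lambda>n. energy_on p {0..l} v3 h3 - e/3 \<le> energy_on p {0..l} (U3 n) (G3 n)) sequentially"
      by (rule core_limits(2)[where B=B, OF p less_imp_le[OF l] H3 h3]) (use B lim e in auto)
    ultimately have ev: "eventually (\<lambda>n. a n \<le> E_pendant p l (U1 n, U2 n, U3 n) (G1 n, G2 n, G3 n)) sequentially"
    proof eventually_elim
      case (elim n)
      define t1 t2 where "t1 = (LINT x:{R..}|lborel. (U1 n x)\<^sup>2)" and "t2 = (LINT x:{R..}|lborel. (U2 n x)\<^sup>2)"
      \<comment> \<open>The pendant belongs to the core, so the remaining mass is carried by the two
        tails.\<close>
      have t: "\<mu> - core R (U1 n) (U2 n) (U3 n) = t1 + t2"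
        using set_integral_atLeast_split[OF H1_onD(1)[OF H1[of n]] R] set_integral_atLeast_split[OF H1_onD(1)[OF H2[of n]] R]
          mass[of n] unfolding core_def t1_def t2_def by linarith
      have T1: "t1 / \<mu> * c - D * (U1 n R)\<^sup>2 \<le> energy_on p {R..} (U1 n) (G1 n)"
        unfolding t1_def D_def by (rule tail_energy_bound[OF p H1 R]) (use B mu mle c in auto)
      have T2: "t2 / \<mu> * c - D * (U2 n R)\<^sup>2 \<le> energy_on p {R..} (U2 n) (G2 n)"
        unfolding t2_def D_def by (rule tail_energy_bound[OF p H2 R]) (use B mu mle c in auto)
      have split: "(t1 + t2) / \<mu> * c = t1 / \<mu> * c + t2 / \<mu> * c"
        by (simp add: add_divide_distrib distrib_right)
      have S: "energy_on p {0..} (U1 n) (G1 n) = energy_on p {0..R} (U1 n) (G1 n) + energy_on p {R..} (U1 n) (G1 n)"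
        "energy_on p {0..} (U2 n) (G2 n) = energy_on p {0..R} (U2 n) (G2 n) + energy_on p {R..} (U2 n) (G2 n)"
        using energy_on_split[where B=B, OF p H1 R] energy_on_split[where B=B, OF p H2 R] B by auto
      show ?case
        using elim T1 T2 unfolding a_def t split E_pendant_eq_energy_on S Ecore_def distrib_left by linarith
    qed
    have "a \<longlonglongrightarrow> Ecore R - e + (\<mu> - core R v1 v2 v3) / \<mu> * c - D * ((v1 R)\<^sup>2 + (v2 R)\<^sup>2)"
      unfolding a_def by (intro tendsto_intros core_lim lim R) (use mu in auto)
    from tendsto_le[OF _ E this ev]
    show "Ecore R + (\<mu> - core R v1 v2 v3) / \<mu> * c - D * ((v1 R)\<^sup>2 + (v2 R)\<^sup>2) \<le> E0 + e" by simp
  qed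
  have core_top: "((\<lambda>R. core R v1 v2 v3) \<longlongrightarrow> m) at_top"
    unfolding core_def m_def mass_pendant_def prod.case
    by (intro tendsto_intros tendsto_set_lebesgue_integral_at_top H1_onD(1)[OF h1] H1_onD(1)[OF h2]) auto
  have "core R v1 v2 v3 \<le> \<mu>" if "0 \<le> R" for R
    by (rule LIMSEQ_le_const2[OF core_lim[OF that]]) (use core_le that in auto)
  then have "eventually (\<lambda>R. core R v1 v2 v3 \<le> \<mu>) at_top"
    by (auto simp: eventually_at_top_linorder)
  then show "m \<le> \<mu>" by (intro tendsto_upperbound[OF core_top]) auto
  have "((\<lambda>R. Ecore R + (\<mu> - core R v1 v2 v3) / \<mu> * c - D * ((v1 R)\<^sup>2 + (v2 R)\<^sup>2)) \<longlongrightarrow>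
      (energy_on p {0..} v1 h1 + energy_on p {0..} v2 h2 + energy_on p {0..l} v3 h3) + (\<mu> - m) / \<mu> * c - D * (0 + 0)) at_top"
    unfolding Ecore_def
    by (intro tendsto_intros core_top energy_on_tendsto[OF p h1 vB(1)] energy_on_tendsto[OF p h2 vB(2)]
        H1_halfline_tendsto_0[OF h1] H1_halfline_tendsto_0[OF h2]) (use mu in auto)
  moreover have "eventually (\<lambda>R. Ecore R + (\<mu> - core R v1 v2 v3) / \<mu> * c - D * ((v1 R)\<^sup>2 + (v2 R)\<^sup>2) \<le> E0) at_top"
    using step by (auto simp: eventually_at_top_linorder)
  ultimately have "(energy_on p {0..} v1 h1 + energy_on p {0..} v2 h2 + energy_on p {0..l} v3 h3) + (\<mu> - m) / \<mu> * c - D * (0 + 0) \<le> E0"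
    by (intro tendsto_upperbound) auto
  then show "E_pendant p l (v1, v2, v3) (h1, h2, h3) + (\<mu> - m) / \<mu> * c \<le> E0"
    unfolding E_pendant_eq_energy_on by simp
qed

lemma E_pendant_scale:
  assumes p: "2 < p" and u: "H1_pendant l (u1, u2, u3) (g1, g2, g3)" and m: "0 < mass_pendant l (u1, u2, u3)"
    and mu: "mass_pendant l (u1, u2, u3) \<le> \<mu>"
  shows "\<exists>w k. H1_mu_pendant l \<mu> w k \<and>
    E_pendant p l w k \<le> \<mu> / mass_pendant l (u1, u2, u3) * E_pendant p l (u1, u2, u3) (g1, g2, g3)"
proof -
  define t where "t = sqrt (\<mu> / mass_pendant l (u1, u2, u3))"
  have t2: "t\<^sup>2 = \<mu> / mass_pendant l (u1, u2, u3)" and t1: "1 \<le> t"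
    using m mu by (auto simp: t_def)
  have "H1_mu_pendant l \<mu> (\<lambda>x. t * u1 x, \<lambda>x. t * u2 x, \<lambda>x. t * u3 x) (\<lambda>x. t * g1 x, \<lambda>x. t * g2 x, \<lambda>x. t * g3 x)"
  proof -
    have "mass_pendant l (\<lambda>x. t * u1 x, \<lambda>x. t * u2 x, \<lambda>x. t * u3 x) = t\<^sup>2 * mass_pendant l (u1, u2, u3)"
      unfolding mass_pendant_def by (simp add: power_mult_distrib distrib_left)
    also have "\<dots> = \<mu>" unfolding t2 using m by simp
    finally show ?thesis
      using u unfolding H1_mu_pendant_def H1_pendant_def by (auto intro: H1_on_scale)
  qed
  moreover have "E_pendant p l (\<lambda>x. t * u1 x, \<lambda>x. t * u2 x, \<lambda>x. t * u3 x) (\<lambda>x. t * g1 x, \<lambda>x. t * g2 x, \<lambda>x. t * g3 x)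
      \<le> t\<^sup>2 * E_pendant p l (u1, u2, u3) (g1, g2, g3)"
    unfolding E_pendant_eq_energy_on distrib_left
    by (intro add_mono energy_on_scale_le t1 p)
  ultimately show ?thesis unfolding t2 by blast
qed

lemma ground_state_of_energy_gap:
  assumes p: "2 < p" "p < 6" and mu: "0 < \<mu>" and l: "0 < l"
    and c: "\<And>M. 0 \<le> M \<Longrightarrow> c \<le> 2 * calib p 1 * M powr ((p + 2) / 2) - \<mu> * M powr (p - 2) / p"
    and ex: "\<exists>u g. H1_mu_pendant l \<mu> u g \<and> E_pendant p l u g < c"
  shows "Inf {E_pendant p l u g | u g. H1_mu_pendant l \<mu> u g} < c"
    and "\<exists>u g. ground_state_pendant p l \<mu> u g"
proof -
  let ?S = "{E_pendant p l u g | u g. H1_mu_pendant l \<mu> u g}"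
  obtain C where C: "\<And>u g. H1_mu_pendant l \<mu> u g \<Longrightarrow> kinetic_pendant l g / 4 - C \<le> E_pendant p l u g"
    using E_pendant_coercive[OF p mu l] by blast
  have "- C \<le> E_pendant p l u g" if "H1_mu_pendant l \<mu> u g" for u g
    using C[OF that] kinetic_pendant_nonneg[of l g] by linarith
  then have bdd: "bdd_below ?S" by (intro bdd_belowI[of _ "- C"]) auto
  have ne: "?S \<noteq> {}" using ex by blast
  define E0 where "E0 = Inf ?S"
  have low: "E0 \<le> E_pendant p l u g" if "H1_mu_pendant l \<mu> u g" for u g
    unfolding E0_def using that by (intro cInf_lower[OF _ bdd]) blast
  show gap: "Inf ?S < c"
    using ex low unfolding E0_def by (meson le_less_trans)
  have "\<exists>u g. H1_mu_pendant l \<mu> u g \<and> E_pendant p l u g < E0 + 1 / Suc n" for n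
  proof -
    have "Inf ?S < E0 + 1 / Suc n" unfolding E0_def by simp
    then show ?thesis using cInf_lessD[OF ne] by blast
  qed
  then obtain u g where ug: "\<And>n. H1_mu_pendant l \<mu> (u n) (g n)" "\<And>n. E_pendant p l (u n) (g n) < E0 + 1 / Suc n"
    by metis
  define U1 U2 U3 where "U1 n = fst (u n)" and "U2 n = fst (snd (u n))" and "U3 n = snd (snd (u n))" for n
  define G1 G2 G3 where "G1 n = fst (g n)" and "G2 n = fst (snd (g n))" and "G3 n = snd (snd (g n))" for n
  have u: "u n = (U1 n, U2 n, U3 n)" and g: "g n = (G1 n, G2 n, G3 n)" for n
    by (simp_all add: U1_def U2_def U3_def G1_def G2_def G3_def)
  \<comment> \<open>Coercivity applied to energies below \<open>E0 + 1\<close>.\<close>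
  define K where "K = 4 * (E0 + 1 + C)"
  have K: "kinetic_pendant l (g n) \<le> K" for n
  proof -
    note ug(2)[of n]
    also have "E0 + 1 / real (Suc n) \<le> E0 + 1" by simp
    finally have lt: "E_pendant p l (u n) (g n) < E0 + 1" .
    have "kinetic_pendant l (g n) \<le> 4 * (E_pendant p l (u n) (g n) + C)"
      using C[OF ug(1)[of n]] by simp
    also have "\<dots> \<le> 4 * (E0 + 1 + C)" using lt by simp
    finally show ?thesis unfolding K_def .
  qed
  obtain r v1 v2 v3 h1 h2 h3 where r: "strict_mono (r :: nat \<Rightarrow> nat)" and v: "H1_pendant l (v1, v2, v3) (h1, h2, h3)"
    and lim: "\<And>x. 0 \<le> x \<Longrightarrow> (\<lambda>n. U1 (r n) x) \<longlonglongrightarrow> v1 x" "\<And>x. 0 \<le> x \<Longrightarrow> (\<lambda>n. U2 (r n) x) \<longlonglongrightarrow> v2 x"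
      "\<And>x. x \<in> {0..l} \<Longrightarrow> (\<lambda>n. U3 (r n) x) \<longlonglongrightarrow> v3 x"
    using pendant_limit_exists[where ?U1.0=U1 and ?U2.0=U2 and ?U3.0=U3 and ?G1.0=G1 and ?G2.0=G2 and ?G3.0=G3,
        OF l ug(1)[unfolded u g] K[unfolded g]] by blast
  define B where "B = sqrt (1 * \<mu> + K / 1)"
  have Bb: "\<bar>x\<bar> \<le> B" if "x\<^sup>2 \<le> 1 * \<mu> + kinetic_pendant l (G1 n, G2 n, G3 n) / 1" for x n
  proof -
    have "x\<^sup>2 \<le> 1 * \<mu> + K / 1" using that K[of n] unfolding g by simp
    from real_sqrt_le_mono[OF this] show ?thesis by (simp add: B_def)
  qed
  have B: "0 \<le> x \<Longrightarrow> \<bar>U1 n x\<bar> \<le> B" "0 \<le> x \<Longrightarrow> \<bar>U2 n x\<bar> \<le> B" "x \<in> {0..l} \<Longrightarrow> \<bar>U3 n x\<bar> \<le> B" for n x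
    using pendant_sup_bound[OF ug(1)[of n, unfolded u g] zero_less_one l, of x, THEN Bb] by auto
  have "(\<lambda>n. E_pendant p l (u n) (g n)) \<longlonglongrightarrow> E0"
  proof (rule tendsto_sandwich[OF _ _ tendsto_const])
    have "(\<lambda>n. E0 + 1 / Suc n) \<longlonglongrightarrow> E0 + 0" by (intro tendsto_intros LIMSEQ_Suc[OF lim_1_over_n])
    then show "(\<lambda>n. E0 + 1 / Suc n) \<longlonglongrightarrow> E0" by simp
  qed (use low[OF ug(1)] ug(2) in \<open>auto intro!: always_eventually less_imp_le\<close>)
  from LIMSEQ_subseq_LIMSEQ[OF this r]
  have El: "(\<lambda>n. E_pendant p l (U1 (r n), U2 (r n), U3 (r n)) (G1 (r n), G2 (r n), G3 (r n))) \<longlonglongrightarrow> E0"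
    unfolding o_def u g .
  define m where "m = mass_pendant l (v1, v2, v3)"
  define Ev where "Ev = E_pendant p l (v1, v2, v3) (h1, h2, h3)"
  have esc: "m \<le> \<mu>" "Ev + (\<mu> - m) / \<mu> * c \<le> E0"
    using escaping_mass_bound[where ?U1.0="\<lambda>n. U1 (r n)" and ?U2.0="\<lambda>n. U2 (r n)" and ?U3.0="\<lambda>n. U3 (r n)"
        and ?G1.0="\<lambda>n. G1 (r n)" and ?G2.0="\<lambda>n. G2 (r n)" and ?G3.0="\<lambda>n. G3 (r n)", OF p(1) l mu ug(1)[unfolded u g] B v lim El c] unfolding m_def Ev_def by auto
  have gap': "E0 < c" using gap unfolding E0_def .
  have h: "H1_on {0..} 0 v1 h1" "H1_on {0..} 0 v2 h2" "H1_on {0..l} 0 v3 h3"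
    using v unfolding H1_pendant_def by auto
  have m0: "0 \<le> m"
    unfolding m_def mass_pendant_def by (auto intro!: add_nonneg_nonneg set_integral_nonneg')
  \<comment> \<open>Rescaling needs positive mass. At mass 0 the L^p terms of the limit vanish, its
    energy is nonnegative, and the escape inequality gives c \<le> E0, against the gap.\<close>
  have "m \<noteq> 0"
  proof
    assume "m = 0"
    have vB: "0 \<le> x \<Longrightarrow> \<bar>v1 x\<bar> \<le> B" "0 \<le> x \<Longrightarrow> \<bar>v2 x\<bar> \<le> B" "x \<in> {0..l} \<Longrightarrow> \<bar>v3 x\<bar> \<le> B" for x
      by (rule LIMSEQ_le_const2[OF tendsto_rabs[OF lim(1)]] LIMSEQ_le_const2[OF tendsto_rabs[OF lim(2)]]
            LIMSEQ_le_const2[OF tendsto_rabs[OF lim(3)]]; use B in blast)+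
    have "(LINT x:{0..}|lborel. \<bar>v1 x\<bar> powr p) \<le> B powr (p - 2) * (LINT x:{0..}|lborel. (v1 x)\<^sup>2)"
      "(LINT x:{0..}|lborel. \<bar>v2 x\<bar> powr p) \<le> B powr (p - 2) * (LINT x:{0..}|lborel. (v2 x)\<^sup>2)"
      "(LINT x:{0..l}|lborel. \<bar>v3 x\<bar> powr p) \<le> B powr (p - 2) * (LINT x:{0..l}|lborel. (v3 x)\<^sup>2)"
      using h vB p by (auto intro!: set_integrable_abs_powr(2) H1_onD(1))
    then have "(LINT x:{0..}|lborel. \<bar>v1 x\<bar> powr p) + (LINT x:{0..}|lborel. \<bar>v2 x\<bar> powr p) + (LINT x:{0..l}|lborel. \<bar>v3 x\<bar> powr p)
        \<le> B powr (p - 2) * m"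
      unfolding m_def mass_pendant_def prod.case distrib_left by linarith
    then have L: "(1/p) * ((LINT x:{0..}|lborel. \<bar>v1 x\<bar> powr p) + (LINT x:{0..}|lborel. \<bar>v2 x\<bar> powr p) + (LINT x:{0..l}|lborel. \<bar>v3 x\<bar> powr p)) \<le> 0"
      using p \<open>m = 0\<close> by (intro mult_nonneg_nonpos) auto
    have "Ev = kinetic_pendant l (h1, h2, h3) / 2 - (1/p) * ((LINT x:{0..}|lborel. \<bar>v1 x\<bar> powr p) + (LINT x:{0..}|lborel. \<bar>v2 x\<bar> powr p) + (LINT x:{0..l}|lborel. \<bar>v3 x\<bar> powr p))"
      unfolding Ev_def E_pendant_def kinetic_pendant_def prod.case by simp
    then have "0 \<le> Ev" using L kinetic_pendant_nonneg[of l "(h1, h2, h3)"] by linarith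
    then show False using esc(2) gap' \<open>m = 0\<close> mu by simp
  qed
  then have mp: "0 < m" using m0 by simp
  obtain w k where "H1_mu_pendant l \<mu> w k" "E_pendant p l w k \<le> \<mu> / m * Ev"
    using E_pendant_scale[OF p(1) v] mp esc(1) unfolding m_def Ev_def by blast
  then have "E0 \<le> \<mu> / m * Ev" using low by (meson order_trans)
  then have "m / \<mu> * E0 \<le> m / \<mu> * (\<mu> / m * Ev)"
    using mp mu by (intro mult_left_mono) auto
  then have scale: "m / \<mu> * E0 \<le> Ev" using mp mu by simp
  \<comment> \<open>\<open>E0\<close> splits into the shares of retained and escaped mass; a
    positive escaped share of \<open>E0\<close> would be strictly below the same share of
    \<open>c\<close>.\<close>
  have "m = \<mu>"
  proof (rule ccontr)
    assume "m \<noteq> \<mu>"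
    then have lt: "0 < (\<mu> - m) / \<mu>" using esc(1) mu by simp
    have "m / \<mu> * E0 + (\<mu> - m) / \<mu> * E0 = E0" using mu by (simp add: field_simps)
    moreover have "(\<mu> - m) / \<mu> * E0 < (\<mu> - m) / \<mu> * c" using gap' lt by (rule mult_strict_left_mono)
    ultimately show False using scale esc(2) by linarith
  qed
  then have "H1_mu_pendant l \<mu> (v1, v2, v3) (h1, h2, h3)" "Ev \<le> E0"
    using v esc(2) unfolding H1_mu_pendant_def m_def by auto
  then show "\<exists>u g. ground_state_pendant p l \<mu> u g"
    unfolding ground_state_pendant_def Ev_def using low by (meson order_trans)
qed

theorem theorem6p3:
  fixes p \<mu> l :: real
  assumes "2 < p" and "p < 6" and "0 < \<mu>" and "0 < l"
  shows "Inf {E_pendant p l u g | u g. H1_mu_pendant l \<mu> u g} < soliton_energy p \<mu>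
         \<and> (\<exists>u g. ground_state_pendant p l \<mu> u g)"
proof -
  obtain c where "\<And>M. 0 \<le> M \<Longrightarrow> c \<le> 2 * calib p 1 * M powr ((p + 2) / 2) - \<mu> * M powr (p - 2) / p"
    and c: "c \<le> soliton_energy p \<mu>" and "\<exists>u g. H1_mu_pendant l \<mu> u g \<and> E_pendant p l u g < c"
    using pendant_below_soliton_energy[OF assms] by blast
  from ground_state_of_energy_gap[OF assms this(1,3)] c show ?thesis
    by auto
qed

end
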